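(* Let $(X,d)$ be a compact metric space and let $\phi$ be a non-trivial (i.e. $X$ is not a single point) minimal expansive continuous flow on $X$. Then the topological (covering) dimension of $X$ is equal to one. Consequently, a non-trivial continuous flow on a compact metric space is minimal and expansive if, and only if, it is (topologically equivalent to) the suspension flow of a minimal subshift.
   Context: A continuous flow on $X$ is a continuous map $\phi\colon\mathbb{R}\times X\to X$, $\phi_t=\phi(t,\cdot)$, with $\phi_0=\mathrm{id}$ and $\phi_{t+s}=\phi_s\circ\phi_t$. A compact set $K\subset X$ is invariant if $\phi_t(K)=K$ for all $t$; $\phi$ is minimal if $X$ has no nonempty proper compact invariant subset (equivalently every orbit is dense). Let $Rep$ be the set of increasing homeomorphisms $h\colon\mathbb{R}\to\mathbb{R}$ with $h(0)=0$. The flow $\phi$ is expansive if for every $\varepsilon>0$ there is $\delta>0$ such that whenever $x,y\in X$ and $h\in Rep$ satisfy $d(\phi_t(x),\phi_{h(t)}(y))\le\delta$ for all $t\in\mathbb{R}$, then $y\in\phi_{[-\varepsilon,\varepsilon]}(x)$. A subshift is a closed shift-invariant subset of $A^{\mathbb{Z}}$ ($A$ finite) with the shift map; it is minimal if every orbit is dense. The suspension flow of a homeomorphism $f$ of a compact space $Y$ under a continuous roof function $r\colon Y\to(0,\infty)$ is the flow on $\{(y,s):0\le s\le r(y)\}/(y,r(y))\sim(f(y),0)$ given by moving vertically at unit speed; two flows are topologically equivalent if there is a homeomorphism mapping orbits to orbits preserving the time orientation. *)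

theory Defs
  imports "HOL-Analysis.Analysis"
begin

definition is_flow :: "'a::metric_space set \<Rightarrow> (real \<Rightarrow> 'a \<Rightarrow> 'a) \<Rightarrow> bool" where
  "is_flow X \<phi> \<longleftrightarrow>
     continuous_on (UNIV \<times> X) (\<lambda>(t, x). \<phi> t x) \<and>
     (\<forall>t. \<phi> t ` X \<subseteq> X) \<and>
     (\<forall>x\<in>X. \<phi> 0 x = x) \<and>
     (\<forall>t s. \<forall>x\<in>X. \<phi> (t + s) x = \<phi> s (\<phi> t x))"

definition flow_invariant :: "'a set \<Rightarrow> (real \<Rightarrow> 'a \<Rightarrow> 'a) \<Rightarrow> bool" where
  "flow_invariant K \<phi> \<longleftrightarrow> (\<forall>t. \<phi> t ` K = K)"

definition minimal_flow :: "'a::metric_space set \<Rightarrow> (real \<Rightarrow> 'a \<Rightarrow> 'a) \<Rightarrow> bool" where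
  "minimal_flow X \<phi> \<longleftrightarrow>
     (\<forall>K. K \<subseteq> X \<and> K \<noteq> {} \<and> compact K \<and> flow_invariant K \<phi> \<longrightarrow> K = X)"

definition Rep :: "(real \<Rightarrow> real) set" where
  "Rep = {h. continuous_on UNIV h \<and> strict_mono h \<and> surj h \<and> h 0 = 0}"

definition expansive_flow :: "'a::metric_space set \<Rightarrow> (real \<Rightarrow> 'a \<Rightarrow> 'a) \<Rightarrow> bool" where
  "expansive_flow X \<phi> \<longleftrightarrow>
     (\<forall>\<epsilon>>0. \<exists>\<delta>>0. \<forall>x\<in>X. \<forall>y\<in>X. \<forall>h\<in>Rep.
        (\<forall>t. dist (\<phi> t x) (\<phi> (h t) y) \<le> \<delta>) \<longrightarrow> (\<exists>s. \<bar>s\<bar> \<le> \<epsilon> \<and> y = \<phi> s x))"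

definition covering_dim_le :: "'a::topological_space set \<Rightarrow> nat \<Rightarrow> bool" where
  "covering_dim_le X n \<longleftrightarrow>
     (\<forall>\<U>. finite \<U> \<and> (\<forall>U\<in>\<U>. openin (top_of_set X) U) \<and> X \<subseteq> \<Union>\<U> \<longrightarrow>
        (\<exists>\<V>. finite \<V> \<and> (\<forall>V\<in>\<V>. openin (top_of_set X) V) \<and> X \<subseteq> \<Union>\<V> \<and>
             (\<forall>V\<in>\<V>. \<exists>U\<in>\<U>. V \<subseteq> U) \<and>
             (\<forall>x\<in>X. card {V\<in>\<V>. x \<in> V} \<le> n + 1)))"

definition covering_dim_eq :: "'a::topological_space set \<Rightarrow> nat \<Rightarrow> bool" where
  "covering_dim_eq X n \<longleftrightarrow> covering_dim_le X n \<and> (\<forall>m<n. \<not> covering_dim_le X m)"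

definition shiftk :: "int \<Rightarrow> (int \<Rightarrow> nat) \<Rightarrow> (int \<Rightarrow> nat)" where
  "shiftk k y = (\<lambda>n. y (n + k))"

definition subshift :: "nat set \<Rightarrow> (int \<Rightarrow> nat) set \<Rightarrow> bool" where
  "subshift A \<Sigma> \<longleftrightarrow> finite A \<and> \<Sigma> \<subseteq> {y. \<forall>n. y n \<in> A} \<and> closed \<Sigma> \<and> shiftk 1 ` \<Sigma> = \<Sigma>"

definition minimal_subshift :: "nat set \<Rightarrow> (int \<Rightarrow> nat) set \<Rightarrow> bool" where
  "minimal_subshift A \<Sigma> \<longleftrightarrow> subshift A \<Sigma> \<and>
     (\<forall>y\<in>\<Sigma>. \<Sigma> \<subseteq> closure {shiftk k y | k. True})"

text \<open>Birkhoff sums of the roof: the time needed to go from (y,0) to (shift^k y, 0).\<close>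
definition roof_sum :: "((int \<Rightarrow> nat) \<Rightarrow> real) \<Rightarrow> (int \<Rightarrow> nat) \<Rightarrow> int \<Rightarrow> real" where
  "roof_sum r y k =
     (if 0 \<le> k then (\<Sum>j\<in>{0..<k}. r (shiftk j y)) else - (\<Sum>j\<in>{k..<0}. r (shiftk j y)))"

text \<open>Points of the suspension space are represented by pairs (y,s) with
  0 \<le> s \<le> r y, modulo (y, r y) ~ (shift y, 0).\<close>
definition susp_dom :: "(int \<Rightarrow> nat) set \<Rightarrow> ((int \<Rightarrow> nat) \<Rightarrow> real) \<Rightarrow> ((int \<Rightarrow> nat) \<times> real) set" where
  "susp_dom \<Sigma> r = {(y, s). y \<in> \<Sigma> \<and> 0 \<le> s \<and> s \<le> r y}"

definition susp_rel :: "((int \<Rightarrow> nat) \<Rightarrow> real) \<Rightarrow> (int \<Rightarrow> nat) \<times> real \<Rightarrow> (int \<Rightarrow> nat) \<times> real \<Rightarrow> bool" where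
  "susp_rel r p q \<longleftrightarrow> p = q
     \<or> (snd p = r (fst p) \<and> fst q = shiftk 1 (fst p) \<and> snd q = 0)
     \<or> (snd q = r (fst q) \<and> fst p = shiftk 1 (fst q) \<and> snd p = 0)"

text \<open>The suspension flow (moving vertically at unit speed), on representatives.\<close>
definition susp_flow :: "((int \<Rightarrow> nat) \<Rightarrow> real) \<Rightarrow> real \<Rightarrow> (int \<Rightarrow> nat) \<times> real \<Rightarrow> (int \<Rightarrow> nat) \<times> real" where
  "susp_flow r t p =
     (let y = fst p; u = snd p + t;
          k = (THE k. roof_sum r y k \<le> u \<and> u < roof_sum r y (k + 1))
      in (shiftk k y, u - roof_sum r y k))"

text \<open>The flow \<phi> on X is topologically equivalent to the suspension flow of
  the subshift \<Sigma> under r: there is a quotient map q from the suspension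
  domain onto X whose fibres are exactly the classes of susp_rel (so q induces a
  homeomorphism from the suspension space onto X), and this homeomorphism maps
  orbits onto orbits preserving the time orientation.\<close>
definition equiv_to_suspension ::
  "'a::metric_space set \<Rightarrow> (real \<Rightarrow> 'a \<Rightarrow> 'a) \<Rightarrow> (int \<Rightarrow> nat) set \<Rightarrow> ((int \<Rightarrow> nat) \<Rightarrow> real) \<Rightarrow> bool" where
  "equiv_to_suspension X \<phi> \<Sigma> r \<longleftrightarrow>
     (\<exists>q. quotient_map (top_of_set (susp_dom \<Sigma> r)) (top_of_set X) q \<and>
          (\<forall>p\<in>susp_dom \<Sigma> r. \<forall>p'\<in>susp_dom \<Sigma> r. q p = q p' \<longleftrightarrow> susp_rel r p p') \<and>
          (\<forall>p\<in>susp_dom \<Sigma> r. \<exists>\<alpha>\<in>Rep. \<forall>t. q (susp_flow r t p) = \<phi> (\<alpha> t) (q p)))"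

end

theory Submission
  imports Defs
begin

text \<open>
  A minimal expansive flow has zero-dimensional local sections. Otherwise some section contains a nontrivial
  continuum, and (after reversing time if necessary) one all of whose pairs of points are tracked in backward time:
  either a subcontinuum never grows in forward time, or one takes a limit of grown images of ever smaller
  subcontinua. By expansivity such a continuum grows, within a bounded time, to a definite diameter when it is moved
  forward from section to section, and can then be split into two continua of the original size. After \<open>k\<close> rounds there
  are \<open>2 ^ k\<close> continua, while a small ball is hit by the orbits of the initial continuum during only \<open>O(k)\<close> short time
  intervals, and each interval affects at most one of the continua. Hence one of them avoids the ball, and
  iterating yields an orbit that avoids it forever, against minimality. This counting replaces any discussion of
  spiral points.

  A clopen piece of a local section is then a zero-dimensional global cross-section with continuous return time;
  coding it by a fine partition is injective by expansivity, and the flow is the suspension of the resulting subshift.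

  Conversely, in a suspension let \<open>w\<close> measure position along an orbit so that the base is crossed at integers. If two orbits
  stay close under a reparametrization \<open>k\<close>, then \<open>w - k w\<close> stays close to integers, hence to a single one, so
  both orbits have the same itinerary.
\<close>

section \<open>Compact metric spaces and continua\<close>

text \<open>Expansivity compares whole orbits through a homeomorphism of the time axis, whereas
  growth has to happen within a bounded time. The gap is bridged by a tracking relation with a
  finite horizon: for a fixed horizon it is closed, so compactness turns expansivity into one bound
  on the horizon for all pairs in a section at a given distance. Expansivity asks for tracking in
  both time directions; unlimited backward tracking, kept as an invariant of a continuum and
  inherited by subcontinua and forward images, leaves only the forward direction to fail. That a
  short time interval cannot block both branches comes from transversality: two points of one
  section whose orbits hit the ball at nearly the same time must themselves be close. The dimension
  is read off the suspension. An explicit cover in which every point lies in at most two members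
  gives the upper bound; connectedness of the closure of an orbit gives the lower one.\<close>

text \<open>On the compact part of \<open>K\<close> where \<open>g\<close> is at least \<eta>,
  \<open>f\<close> is positive and so has a positive minimum; half of it is the bound
  \<open>d\<close>. The lemma turns an exact implication between closed conditions into a uniform
  approximate one; several conditions are packed into one \<open>f\<close> by a maximum.\<close>

lemma compact_small:
  fixes f g :: "'a::metric_space \<Rightarrow> real"
  assumes "compact K" "continuous_on K f" "continuous_on K g"
    and imp: "\<And>p. p \<in> K \<Longrightarrow> f p \<le> 0 \<Longrightarrow> g p \<le> 0" and "\<eta> > 0"
  shows "\<exists>d>0. \<forall>p\<in>K. f p \<le> d \<longrightarrow> g p < \<eta>"
proof -
  define K' where "K' = K \<inter> g -` {\<eta>..}"
  have cK': "compact K'"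
    unfolding K'_def using assms continuous_closed_preimage[of K g "{\<eta>..}"]
    by (metis closed_atLeast compact_Int_closed compact_imp_closed inf.absorb_iff2 inf_le1)
  show ?thesis
  proof (cases "K' = {}")
    case True
    then show ?thesis by (intro exI[of _ 1]) (auto simp: K'_def not_le)
  next
    case False
    have "continuous_on K' f" using assms(2) continuous_on_subset K'_def by blast
    then obtain m where m: "m \<in> K'" "\<And>x. x \<in> K' \<Longrightarrow> f m \<le> f x"
      using continuous_attains_inf[OF cK' False] by blast
    have "f m > 0" using imp[of m] m(1) \<open>\<eta> > 0\<close> by (force simp: K'_def not_le)
    moreover have "\<forall>p\<in>K. f p \<le> f m / 2 \<longrightarrow> g p < \<eta>"
    proof (intro ballI impI, rule ccontr)
      fix p assume "p \<in> K" "f p \<le> f m / 2" "\<not> g p < \<eta>"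
      then have "f m \<le> f p" using m(2) by (simp add: K'_def)
      then show False using \<open>f m > 0\<close> \<open>f p \<le> f m / 2\<close> by linarith
    qed
    ultimately show ?thesis by (intro exI[of _ "f m / 2"]) auto
  qed
qed

lemma LIMSEQ_dist_le:
  fixes f :: "nat \<Rightarrow> 'a::metric_space"
  assumes "\<And>n. dist (f n) x \<le> e n" "e \<longlonglongrightarrow> 0"
  shows "f \<longlonglongrightarrow> x"
proof -
  have "(\<lambda>n. dist (f n) x) \<longlonglongrightarrow> 0"
    by (rule tendsto_sandwich[of "\<lambda>_. 0", OF _ _ tendsto_const assms(2)]) (use assms(1) in auto)
  then show ?thesis by (simp add: tendsto_dist_iff[of f])
qed

lemma LIMSEQ_inverse_Suc: "(\<lambda>n. 1 / real (Suc n)) \<longlonglongrightarrow> 0"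
  using LIMSEQ_inverse_real_of_nat by (simp add: inverse_eq_divide)

text \<open>In a compact Hausdorff space components coincide with quasi-components, so a component
  that misses the closed set \<open>T\<close> is separated from it by a clopen set.\<close>

lemma component_separation:
  fixes K :: "'a::metric_space set"
  assumes K: "compact K" and u: "u \<in> K" and T: "closed T" "T \<subseteq> K"
    and noconn: "\<And>C. C \<subseteq> K \<Longrightarrow> connected C \<Longrightarrow> u \<in> C \<Longrightarrow> C \<inter> T = {}"
  shows "\<exists>V. u \<in> V \<and> V \<inter> T = {} \<and> openin (top_of_set K) V \<and> closedin (top_of_set K) V"
proof -
  let ?X = "top_of_set K"
  let ?C = "connected_component_of_set ?X u"
  have cs: "compact_space ?X" using K by (simp add: compact_space_subtopology)
  have hs: "Hausdorff_space ?X" by (simp add: Hausdorff_space_subtopology)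
  have mem: "?C \<in> connected_components_of ?X"
    using u by (simp add: connected_components_of_def)
  have uC: "u \<in> ?C" using u by (simp add: connected_component_of_refl)
  have conC: "connected ?C" "?C \<subseteq> K"
    using connectedin_connected_component_of[of ?X u] connectedin_subtopology[of euclidean K ?C] by auto
  have "closedin ?X ?C" using mem by (simp add: closedin_connected_components_of)
  then have "compactin ?X ?C" using cs closedin_compact_space by blast
  moreover have "disjnt ?C T" using noconn[OF conC(2,1) uC] by (simp add: disjnt_def)
  moreover have "closedin ?X T" using T by (simp add: closed_subset)
  ultimately have "separated_between ?X ?C T"
    using separated_between_compact_connected_component[of ?X ?C T] cs hs mem
    by (simp add: compact_imp_locally_compact_space)
  then obtain U V where UV: "openin ?X U" "openin ?X V" "U \<union> V = topspace ?X" "disjnt U V" "?C \<subseteq> U" "T \<subseteq> V"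
    by (auto simp: separated_between_def)
  have "closedin ?X U"
  proof -
    have "U = topspace ?X - V" using UV by (auto simp: disjnt_def)
    then show ?thesis using UV(2) by blast
  qed
  then show ?thesis using UV uC by (intro exI[of _ U]) (auto simp: disjnt_def)
qed

text \<open>Boundary bumping. If no connected set in the closed ball joined \<open>u\<close> to the
  sphere, some clopen neighbourhood \<open>V\<close> of \<open>u\<close> in
  \<open>C \<inter> cball u e\<close> would miss the sphere, hence lie in the open ball and be
  clopen in all of \<open>C\<close>, which is connected and contains \<open>v\<close> outside the
  ball.\<close>

lemma subcontinuum_reaching:
  fixes C :: "'a::metric_space set"
  assumes C: "compact C" "connected C" and u: "u \<in> C" and v: "v \<in> C" "e < dist u v" and e: "0 < e"
  shows "\<exists>D\<subseteq>C. compact D \<and> connected D \<and> u \<in> D \<and> (\<forall>x\<in>D. dist u x \<le> e) \<and> (\<exists>x\<in>D. dist u x = e)"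
proof -
  define K where "K = C \<inter> cball u e"
  have K: "compact K" using C by (simp add: K_def compact_Int_closed)
  define T where "T = C \<inter> sphere u e"
  have T: "closed T" "T \<subseteq> K" using closed_Int[OF compact_imp_closed[OF C(1)], of "{x. dist u x = e}"]
    by (auto simp: T_def K_def sphere_def closed_Collect_eq continuous_intros)
  have uK: "u \<in> K" using u e by (auto simp: K_def)
  have "\<exists>D\<subseteq>K. connected D \<and> u \<in> D \<and> D \<inter> T \<noteq> {}"
  proof (rule ccontr)
    assume "\<not> ?thesis"
    then obtain V where V: "u \<in> V" "V \<inter> T = {}" "openin (top_of_set K) V" "closedin (top_of_set K) V"
      using component_separation[OF K uK T] by blast
    have clV: "closed V" using V(4) K by (meson closedin_closed_eq compact_imp_closed)
    obtain W where W: "open W" "V = K \<inter> W" using V(3) by (auto simp: openin_open)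
    have "V = C \<inter> (W \<inter> ball u e)"
      using V(2) W(2) by (auto simp: K_def T_def)
    then have "openin (top_of_set C) V" using W(1) by (simp add: openin_open_Int open_Int)
    moreover have "closedin (top_of_set C) V" using clV W(2) by (simp add: K_def closed_subset le_infI1)
    ultimately have "V = C" using C(2) V(1) by (auto simp: connected_clopen)
    then have "v \<in> K" using v(1) W(2) by auto
    then show False using v(2) by (auto simp: K_def)
  qed
  then obtain D where D: "D \<subseteq> K" "connected D" "u \<in> D" "D \<inter> T \<noteq> {}" by blast
  have sub: "closure D \<subseteq> K" using D(1) K by (simp add: closure_minimal compact_imp_closed)
  have "compact (closure D)" using sub K by (metis closed_closure compact_Int_closed inf.absorb_iff2)
  moreover have "connected (closure D)" using D(2) by (rule connected_imp_connected_closure)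
  moreover have "\<exists>x\<in>D. dist u x = e" using D(4) unfolding T_def by auto
  ultimately show ?thesis using sub D(3) closure_subset[of D]
    by (intro exI[of _ "closure D"]) (auto simp: K_def)
qed

text \<open>A finite clopen partition of small mesh, encoded as a continuous map to the discrete
  space \<open>nat\<close> so that it can serve directly as an alphabet. Points of a totally
  disconnected compact set have small clopen neighbourhoods; \<open>P x\<close> is the index of the
  first member of a finite subcover that contains \<open>x\<close>, so each piece is a clopen set
  minus the earlier ones.\<close>

lemma zero_dim_labelling:
  fixes K :: "'a::metric_space set"
  assumes K: "compact K" and td: "\<And>C. C \<subseteq> K \<Longrightarrow> connected C \<Longrightarrow> \<exists>x. C \<subseteq> {x}" and e: "0 < e"
  shows "\<exists>P::'a \<Rightarrow> nat. finite (P ` K) \<and> continuous_on K P \<and> (\<forall>x\<in>K. \<forall>y\<in>K. P x = P y \<longrightarrow> dist x y < e)"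
proof -
  have "\<exists>V. u \<in> V \<and> V \<subseteq> ball u (e/2) \<and> openin (top_of_set K) V \<and> closedin (top_of_set K) V" if u: "u \<in> K" for u
  proof -
    have "\<exists>V. u \<in> V \<and> V \<inter> (K - ball u (e/2)) = {} \<and> openin (top_of_set K) V \<and> closedin (top_of_set K) V"
    proof (rule component_separation[OF K u])
      show "closed (K - ball u (e/2))" using K by (simp add: closed_Diff compact_imp_closed)
      fix C assume C: "C \<subseteq> K" "connected C" "u \<in> C"
      then have "C \<subseteq> {u}" using td[of C] by auto
      then show "C \<inter> (K - ball u (e/2)) = {}" using e by auto
    qed auto
    then obtain V where V: "u \<in> V" "V \<inter> (K - ball u (e/2)) = {}" "openin (top_of_set K) V" "closedin (top_of_set K) V"
      by blast
    moreover have "V \<subseteq> K" using V(3) openin_imp_subset by blast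
    ultimately show ?thesis by blast
  qed
  then obtain V where V: "\<And>u. u \<in> K \<Longrightarrow> u \<in> V u \<and> V u \<subseteq> ball u (e/2) \<and> openin (top_of_set K) (V u) \<and> closedin (top_of_set K) (V u)"
    by metis
  have "\<exists>T\<subseteq>K. finite T \<and> K \<subseteq> (\<Union>u\<in>T. V u)"
  proof -
    have "\<exists>W. open W \<and> V u = K \<inter> W" if "u \<in> K" for u using V[OF that] by (auto simp: openin_open)
    then obtain W where W: "\<And>u. u \<in> K \<Longrightarrow> open (W u) \<and> V u = K \<inter> W u" by metis
    obtain T where "T \<subseteq> K" "finite T" "K \<subseteq> (\<Union>u\<in>T. W u)"
      using compactE_image[OF K, of K W] W V by (metis (no_types, lifting) IntD2 UN_iff subsetI)
    then show ?thesis using W by (intro exI[of _ T]) blast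
  qed
  then obtain T where T: "T \<subseteq> K" "finite T" "K \<subseteq> (\<Union>u\<in>T. V u)" by blast
  obtain us where us: "set us = T" using T(2) finite_list by blast
  define P where "P x = (LEAST i. i < length us \<and> x \<in> V (us ! i))" for x
  have ex: "\<exists>i. i < length us \<and> x \<in> V (us ! i)" if "x \<in> K" for x
    using T(3) that us by (force simp: in_set_conv_nth)
  have P: "P x < length us \<and> x \<in> V (us ! P x)" if "x \<in> K" for x
    unfolding P_def using ex[OF that] by (rule LeastI_ex)
  have "finite (P ` K)" using P by (auto intro: finite_subset[of _ "{..<length us}"])
  moreover have "dist x y < e" if "x \<in> K" "y \<in> K" "P x = P y" for x y
  proof -
    have "us ! P x \<in> K" using P[OF that(1)] us T(1) nth_mem by blast
    then have "dist (us ! P x) x < e/2" "dist (us ! P x) y < e/2"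
      using V P[OF that(1)] P[OF that(2)] that(3) by (metis mem_ball subsetD)+
    then show ?thesis by (metis dist_commute dist_triangle_half_r)
  qed
  moreover have "continuous_on K P"
  proof -
    have level: "openin (top_of_set K) {x \<in> K. P x = i}" for i
    proof (cases "i < length us")
      case True
      have eq: "{x \<in> K. P x = i} = V (us ! i) - (\<Union>j<i. V (us ! j))"
      proof (intro equalityI subsetI)
        fix x assume x: "x \<in> {x \<in> K. P x = i}"
        have "x \<notin> V (us ! j)" if "j < i" for j
        proof
          assume "x \<in> V (us ! j)"
          then have "P x \<le> j" unfolding P_def using that True by (intro Least_le) auto
          then show False using x that by auto
        qed
        then show "x \<in> V (us ! i) - (\<Union>j<i. V (us ! j))" using P[of x] x by auto
      next
        fix x assume x: "x \<in> V (us ! i) - (\<Union>j<i. V (us ! j))"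
        have "us ! i \<in> K" using True us T(1) nth_mem by blast
        then have xK: "x \<in> K" using V x openin_imp_subset by blast
        have "P x \<le> i" unfolding P_def using x True by (intro Least_le) auto
        moreover have "\<not> P x < i" using P[OF xK] x by auto
        ultimately show "x \<in> {x \<in> K. P x = i}" using xK by auto
      qed
      have usK: "us ! j \<in> K" if "j \<le> i" for j using True us T(1) nth_mem that by fastforce
      have "closedin (top_of_set K) (\<Union>j<i. V (us ! j))"
        using V usK by (intro closedin_Union) auto
      then show ?thesis unfolding eq using V usK by (intro openin_diff) auto
    next
      case False
      then have "{x \<in> K. P x = i} = {}" using P by auto
      then show ?thesis by (metis openin_empty)
    qed
    show ?thesis
    proof (subst continuous_on_open_gen[where T = UNIV])
      show "P \<in> K \<rightarrow> UNIV" by simp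
      show "\<forall>U. openin (top_of_set UNIV) U \<longrightarrow> openin (top_of_set K) (K \<inter> P -` U)"
      proof (intro allI impI)
        fix U :: "nat set"
        have "K \<inter> P -` U = (\<Union>i\<in>U. {x \<in> K. P x = i})" by auto
        then show "openin (top_of_set K) (K \<inter> P -` U)" using level by auto
      qed
    qed
  qed
  ultimately show ?thesis by blast
qed

lemma compact_Pi_UNIV:
  fixes A :: "'b \<Rightarrow> 'a::topological_space set"
  assumes "\<And>i. compact (A i)"
  shows "compact {f. \<forall>i. f i \<in> A i}"
proof -
  have "compactin (product_topology (\<lambda>_. euclidean) UNIV) (PiE UNIV A)"
    using assms by (subst compactin_PiE) auto
  then have "compactin euclidean (PiE UNIV A)" by (simp add: euclidean_product_topology)
  moreover have "PiE UNIV A = {f. \<forall>i. f i \<in> A i}" by (auto simp: PiE_def Pi_def)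
  ultimately show ?thesis by simp
qed

text \<open>The subsequence is chosen so that the functions \<open>\<lambda>x. infdist x (E n)\<close> converge on a countable dense
  set; the limit set is the zero set of their limit.\<close>

lemma continua_limit:
  fixes X :: "'a::metric_space set" and E :: "nat \<Rightarrow> 'a set"
  assumes X: "compact X" and E: "\<And>n. connected (E n)" "\<And>n. E n \<subseteq> X" "\<And>n. E n \<noteq> {}"
  shows "\<exists>s F. strict_mono (s::nat\<Rightarrow>nat) \<and> compact F \<and> connected F \<and> F \<subseteq> X \<and>
      (\<forall>x\<in>F. \<exists>\<xi>. (\<forall>n. \<xi> n \<in> E (s n)) \<and> \<xi> \<longlonglongrightarrow> x) \<and>
      (\<forall>x \<xi> s'. strict_mono s' \<longrightarrow> (\<forall>n. \<xi> n \<in> E (s (s' n))) \<longrightarrow> \<xi> \<longlonglongrightarrow> x \<longrightarrow> x \<in> F)"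
proof -
  have "\<exists>T. countable T \<and> T \<subseteq> X \<and> (\<forall>x\<in>X. \<forall>e>0. \<exists>y\<in>T. dist x y < e)"
  proof -
    have "\<exists>k. finite k \<and> k \<subseteq> X \<and> X \<subseteq> (\<Union>x\<in>k. ball x (1 / real (Suc n)))" for n
    proof -
      have "X \<subseteq> (\<Union>x\<in>X. ball x (1 / real (Suc n)))" by (metis UN_I centre_in_ball of_nat_0_less_iff subsetI zero_less_Suc zero_less_divide_1_iff)
      then obtain k where "k \<subseteq> X" "finite k" "X \<subseteq> (\<Union>x\<in>k. ball x (1 / real (Suc n)))"
        using compactE_image[OF X, of X "\<lambda>x. ball x (1 / real (Suc n))"] by (metis open_ball)
      then show ?thesis by blast
    qed
    then obtain k where k: "\<And>n. finite (k n) \<and> k n \<subseteq> X \<and> X \<subseteq> (\<Union>x\<in>k n. ball x (1 / real (Suc n)))"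
      by metis
    have "\<exists>y\<in>(\<Union>n. k n). dist x y < e" if "x \<in> X" "e > 0" for x e
    proof -
      obtain n where n: "1 / real (Suc n) < e" using nat_approx_posE[OF \<open>e > 0\<close>] by auto
      obtain y where "y \<in> k n" "x \<in> ball y (1 / real (Suc n))" using k[of n] \<open>x \<in> X\<close> by blast
      then have "y \<in> k n" "dist y x < 1 / real (Suc n)" by simp_all
      then show ?thesis using n by (metis UNIV_I UN_iff dist_commute less_trans)
    qed
    then show ?thesis using k by (intro exI[of _ "\<Union>n. k n"] conjI countable_UN) (auto intro: countable_finite)
  qed
  then obtain T where T: "countable T" "T \<subseteq> X" "\<And>x e. x \<in> X \<Longrightarrow> e > 0 \<Longrightarrow> \<exists>y\<in>T. dist x y < e" by blast
  have Tne: "T \<noteq> {}" using E(2,3)[of 0] T(3)[of _ 1] by auto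
  define t where "t = from_nat_into T"
  have ran: "range t = T" unfolding t_def by (rule range_from_nat_into[OF Tne T(1)])
  obtain M where M: "\<And>x y. x \<in> X \<Longrightarrow> y \<in> X \<Longrightarrow> dist x y \<le> M"
    using compact_imp_bounded[OF X] by (meson bounded_two_points)
  define \<rho> where "\<rho> n = (\<lambda>i. infdist (t i) (E n))" for n
  have rb: "0 \<le> infdist x (E n) \<and> infdist x (E n) \<le> M" if "x \<in> X" for x n
  proof -
    obtain y where "y \<in> E n" using E(3) by blast
    then show ?thesis using infdist_le2[of y "E n" x M] M[OF that, of y] E(2) by (auto simp: infdist_nonneg)
  qed
  have "\<rho> n \<in> {f. \<forall>i. f i \<in> {0..M}}" for n
  proof -
    have "t i \<in> X" for i using ran T(2) by blast
    then show ?thesis using rb by (simp add: \<rho>_def)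
  qed
  moreover have "compact {f::nat\<Rightarrow>real. \<forall>i. f i \<in> {0..M}}" by (rule compact_Pi_UNIV) auto
  ultimately obtain l s where s: "strict_mono (s::nat\<Rightarrow>nat)" "(\<rho> \<circ> s) \<longlonglongrightarrow> l"
    unfolding compact_def by metis
  have conv_t: "(\<lambda>n. infdist (t i) (E (s n))) \<longlonglongrightarrow> l i" for i
    using continuous_on_tendsto_compose[OF continuous_on_product_coordinates[of i] s(2)] by (simp add: \<rho>_def o_def)
  \<comment> \<open>\<open>infdist\<close> is 1-Lipschitz in its point whatever the set is, so
    convergence on the dense set passes to every point of \<open>X\<close>.\<close>
  have conv: "convergent (\<lambda>n. infdist x (E (s n)))" if x: "x \<in> X" for x
  proof (rule real_Cauchy_convergent, rule metric_CauchyI)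
    fix e :: real assume e: "e > 0"
    obtain i where i: "dist x (t i) < e/3" using T(3)[OF x, of "e/3"] ran e by force
    have "Cauchy (\<lambda>n. infdist (t i) (E (s n)))" using conv_t LIMSEQ_imp_Cauchy by blast
    then obtain N where N: "\<And>m n. m \<ge> N \<Longrightarrow> n \<ge> N \<Longrightarrow> dist (infdist (t i) (E (s m))) (infdist (t i) (E (s n))) < e/3"
      using e by (metis (no_types, lifting) metric_CauchyD zero_less_divide_iff zero_less_numeral)
    have *: "\<bar>infdist x A - infdist (t i) A\<bar> < e/3" for A using i infdist_triangle_abs[of x A "t i"] by linarith
    have "dist (infdist x (E (s m))) (infdist x (E (s n))) < e" if "m \<ge> N" "n \<ge> N" for m n
    proof -
      have "\<bar>infdist x (E (s m)) - infdist (t i) (E (s m))\<bar> < e/3" "\<bar>infdist x (E (s n)) - infdist (t i) (E (s n))\<bar> < e/3"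
        using * by auto
      then show ?thesis using N[OF that] unfolding dist_real_def by linarith
    qed
    then show "\<exists>N. \<forall>m\<ge>N. \<forall>n\<ge>N. dist (infdist x (E (s m))) (infdist x (E (s n))) < e" by blast
  qed
  define F where "F = {x \<in> X. (\<lambda>n. infdist x (E (s n))) \<longlonglongrightarrow> 0}"
  have lim1: "\<exists>\<xi>. (\<forall>n. \<xi> n \<in> E (s n)) \<and> \<xi> \<longlonglongrightarrow> x" if x: "x \<in> F" for x
  proof -
    have "\<exists>y\<in>E (s n). dist x y < infdist x (E (s n)) + 1 / real (Suc n)" for n
    proof -
      have "Inf ((dist x) ` E (s n)) < infdist x (E (s n)) + 1 / real (Suc n)"
        using E(3) by (simp add: infdist_def)
      then show ?thesis using cInf_lessD[of "dist x ` E (s n)"] E(3) by blast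
    qed
    then obtain \<xi> where \<xi>: "\<And>n. \<xi> n \<in> E (s n)" "\<And>n. dist x (\<xi> n) < infdist x (E (s n)) + 1 / real (Suc n)"
      by metis
    have "(\<lambda>n. infdist x (E (s n)) + 1 / real (Suc n)) \<longlonglongrightarrow> 0 + 0"
      using x LIMSEQ_inverse_Suc by (intro tendsto_add) (auto simp: F_def)
    then have lim0: "(\<lambda>n. infdist x (E (s n)) + 1 / real (Suc n)) \<longlonglongrightarrow> 0" by simp
    have "dist (\<xi> n) x \<le> infdist x (E (s n)) + 1 / real (Suc n)" for n
      using \<xi>(2)[of n] by (simp add: dist_commute)
    then have "\<xi> \<longlonglongrightarrow> x" using lim0 by (rule LIMSEQ_dist_le)
    then show ?thesis using \<xi>(1) by blast
  qed
  have lim2: "x \<in> F" if s': "strict_mono s'" and \<xi>: "\<And>n. \<xi> n \<in> E (s (s' n))" "\<xi> \<longlonglongrightarrow> x" for x \<xi> s'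
  proof -
    have "\<xi> n \<in> X" for n using \<xi>(1) E(2) by blast
    then have "x \<in> X" using \<xi>(2) closed_sequentially[OF compact_imp_closed[OF X]] by blast
    then obtain l where l: "(\<lambda>n. infdist x (E (s n))) \<longlonglongrightarrow> l" using conv convergent_def by blast
    have "(\<lambda>n. infdist x (E (s (s' n)))) \<longlonglongrightarrow> l" using LIMSEQ_subseq_LIMSEQ[OF l s'] by (simp add: o_def)
    moreover have "(\<lambda>n. infdist x (E (s (s' n)))) \<longlonglongrightarrow> 0"
    proof (rule LIMSEQ_dist_le[where e = "\<lambda>n. dist (\<xi> n) x"])
      show "(\<lambda>n. dist (\<xi> n) x) \<longlonglongrightarrow> 0" using \<xi>(2) tendsto_dist_iff by blast
      show "dist (infdist x (E (s (s' n)))) 0 \<le> dist (\<xi> n) x" for n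
        using infdist_le[OF \<xi>(1)[of n], of x] infdist_nonneg[of x "E (s (s' n))"] by (simp add: dist_commute)
    qed
    ultimately have "l = 0" using LIMSEQ_unique by blast
    then show ?thesis using l \<open>x \<in> X\<close> by (simp add: F_def)
  qed
  have clF: "closed F"
  proof (subst closed_sequential_limits, intro allI impI, elim conjE)
    fix \<xi> x assume \<xi>: "\<forall>n. \<xi> n \<in> F" "\<xi> \<longlonglongrightarrow> x"
    have "x \<in> X" using \<xi> compact_imp_closed[OF X] by (auto simp: F_def closed_sequential_limits)
    moreover have "(\<lambda>n. infdist x (E (s n))) \<longlonglongrightarrow> 0"
    proof (rule LIMSEQ_I)
      fix e :: real assume e: "e > 0"
      obtain k where k: "dist (\<xi> k) x < e/2" using \<xi>(2) e by (metis half_gt_zero lim_sequentially order_refl)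
      have "(\<lambda>n. infdist (\<xi> k) (E (s n))) \<longlonglongrightarrow> 0" using \<xi>(1) by (simp add: F_def)
      then obtain N where N: "\<And>n. n \<ge> N \<Longrightarrow> norm (infdist (\<xi> k) (E (s n)) - 0) < e/2" using LIMSEQ_D e half_gt_zero by metis
      have "norm (infdist x (E (s n)) - 0) < e" if "n \<ge> N" for n
        using N[OF that] k infdist_triangle[of x "E (s n)" "\<xi> k"] infdist_nonneg[of x "E (s n)"]
        by (simp add: dist_commute)
      then show "\<exists>N. \<forall>n\<ge>N. norm (infdist x (E (s n)) - 0) < e" by blast
    qed
    ultimately show "x \<in> F" by (simp add: F_def)
  qed
  have "X \<inter> F = F" by (auto simp: F_def)
  then have cF: "compact F" using compact_Int_closed[OF X clF] by simp
  have "connected F"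
  proof (rule ccontr)
    assume "\<not> connected F"
    then obtain A B where AB: "closed A" "closed B" "A \<union> B = F" "A \<inter> B = {}" "A \<noteq> {}" "B \<noteq> {}"
      unfolding connected_closed_set[OF clF] by blast
    define U where "U = {x. infdist x A < infdist x B}"
    define V where "V = {x. infdist x B < infdist x A}"
    have UV: "open U" "open V" "U \<inter> V = {}"
      by (auto simp: U_def V_def intro!: open_Collect_less continuous_intros)
    have "infdist x A < infdist x B" if "x \<in> A" for x
    proof -
      have "x \<notin> B" using AB(4) that by blast
      then show ?thesis using infdist_pos_not_in_closed[OF AB(2,6)] that by simp
    qed
    then have AU: "A \<subseteq> U" by (auto simp: U_def)
    have "infdist x B < infdist x A" if "x \<in> B" for x
    proof -
      have "x \<notin> A" using AB(4) that by blast
      then show ?thesis using infdist_pos_not_in_closed[OF AB(1,5)] that by simp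
    qed
    then have BV: "B \<subseteq> V" by (auto simp: V_def)
    \<comment> \<open>Otherwise points of infinitely many \<open>E (s n)\<close> outside the open
      set \<open>U \<union> V\<close> would accumulate at a point of \<open>F\<close> outside it. As
      the sets eventually meet both \<open>U\<close> and \<open>V\<close> as well, they would be
      disconnected.\<close>
    have "eventually (\<lambda>n. E (s n) \<subseteq> U \<union> V) sequentially"
    proof (rule ccontr)
      assume "\<not> ?thesis"
      then have fr: "\<exists>\<^sub>F n in sequentially. \<not> E (s n) \<subseteq> U \<union> V" by (simp add: not_eventually)
      define J where "J = {n. \<not> E (s n) \<subseteq> U \<union> V}"
      have inf: "infinite J" using fr by (simp add: J_def frequently_cofinite[symmetric] cofinite_eq_sequentially)
      define e where "e = enumerate J"
      have e: "strict_mono e" "\<And>n. e n \<in> J"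
        using inf by (auto simp: e_def strict_mono_enumerate enumerate_in_set)
      then have "\<exists>x. x \<in> E (s (e n)) \<and> x \<notin> U \<union> V" for n unfolding J_def by blast
      then obtain \<xi> where \<xi>: "\<And>n. \<xi> n \<in> E (s (e n)) \<and> \<xi> n \<notin> U \<union> V" by metis
      have "\<forall>n. \<xi> n \<in> X" using \<xi> E(2) by blast
      then obtain x g where x: "strict_mono (g::nat\<Rightarrow>nat)" "(\<xi> \<circ> g) \<longlonglongrightarrow> x"
        using X unfolding compact_def by metis
      have "x \<in> F" using lim2[of "e \<circ> g" "\<xi> \<circ> g" x] e(1) x \<xi> by (simp add: strict_mono_o)
      moreover have "x \<in> - (U \<union> V)"
        using UV(1,2) x(2) \<xi> by (intro closed_sequentially[of "- (U \<union> V)" "\<xi> \<circ> g" x]) (auto simp: open_Un)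
      ultimately show False using AU BV AB(3) by blast
    qed
    moreover have *: "eventually (\<lambda>n. E (s n) \<inter> W \<noteq> {}) sequentially" if W: "open W" "x \<in> W" "x \<in> F" for W x
    proof -
      obtain \<xi> where \<xi>: "\<And>n. \<xi> n \<in> E (s n)" "\<xi> \<longlonglongrightarrow> x" using lim1[OF W(3)] by blast
      have "eventually (\<lambda>n. \<xi> n \<in> W) sequentially" using topological_tendstoD[OF \<xi>(2) W(1,2)] .
      then show ?thesis by (rule eventually_mono) (use \<xi>(1) in blast)
    qed
    have "eventually (\<lambda>n. E (s n) \<inter> U \<noteq> {}) sequentially" "eventually (\<lambda>n. E (s n) \<inter> V \<noteq> {}) sequentially"
    proof -
      obtain x y where xy: "x \<in> A" "y \<in> B" using AB(5,6) by blast
      show "eventually (\<lambda>n. E (s n) \<inter> U \<noteq> {}) sequentially" using * [OF UV(1), of x] xy(1) AU AB(3) by blast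
      show "eventually (\<lambda>n. E (s n) \<inter> V \<noteq> {}) sequentially" using * [OF UV(2), of y] xy(2) BV AB(3) by blast
    qed
    ultimately have "eventually (\<lambda>n. False) sequentially"
    proof eventually_elim
      case (elim n)
      then show False using E(1)[of "s n"] UV connectedD[of "E (s n)" U V] by blast
    qed
    then show False by simp
  qed
  moreover have "F \<subseteq> X" by (auto simp: F_def)
  moreover have "\<forall>x \<xi> s'. strict_mono s' \<longrightarrow> (\<forall>n. \<xi> n \<in> E (s (s' n))) \<longrightarrow> \<xi> \<longlonglongrightarrow> x \<longrightarrow> x \<in> F"
    using lim2 by metis
  ultimately show ?thesis using s(1) cF lim1
    by (intro exI[of _ s] exI[of _ F] conjI ballI) assumption+
qed

section \<open>Flows\<close>

locale compact_flow =
  fixes X :: "'a::metric_space set" and \<phi> :: "real \<Rightarrow> 'a \<Rightarrow> 'a"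
  assumes compX: "compact X" and flow: "is_flow X \<phi>"
begin

lemma flow_in [simp]: "x \<in> X \<Longrightarrow> \<phi> t x \<in> X"
  using flow by (auto simp: is_flow_def)

lemma flow_0 [simp]: "x \<in> X \<Longrightarrow> \<phi> 0 x = x"
  using flow by (auto simp: is_flow_def)

lemma flow_flow [simp]: "x \<in> X \<Longrightarrow> \<phi> s (\<phi> t x) = \<phi> (t + s) x"
  using flow by (auto simp: is_flow_def)

lemma flow_inj: "x \<in> X \<Longrightarrow> y \<in> X \<Longrightarrow> \<phi> t x = \<phi> t y \<Longrightarrow> x = y"
  by (metis flow_0 flow_flow add.right_inverse)

lemma flow_eq_iff: "x \<in> X \<Longrightarrow> y \<in> X \<Longrightarrow> \<phi> s x = \<phi> t y \<longleftrightarrow> y = \<phi> (s - t) x"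
  by (metis add_uminus_conv_diff diff_add_cancel flow_flow flow_in flow_inj)

lemma continuous_on_flow:
  assumes "continuous_on S f" "continuous_on S g" "\<And>p. p \<in> S \<Longrightarrow> g p \<in> X"
  shows "continuous_on S (\<lambda>p. \<phi> (f p) (g p))"
proof -
  have "continuous_on (UNIV \<times> X) (\<lambda>(t, x). \<phi> t x)" using flow by (simp add: is_flow_def)
  then have "continuous_on S ((\<lambda>(t, x). \<phi> t x) \<circ> (\<lambda>p. (f p, g p)))"
    by (intro continuous_on_compose continuous_on_Pair assms) (auto elim: continuous_on_subset intro: assms)
  then show ?thesis by (simp add: o_def)
qed

lemma tendsto_flow:
  assumes "(f \<longlongrightarrow> t) F" "(g \<longlongrightarrow> x) F" "\<And>n. g n \<in> X" "x \<in> X"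
  shows "((\<lambda>n. \<phi> (f n) (g n)) \<longlongrightarrow> \<phi> t x) F"
proof -
  have "continuous_on (UNIV \<times> X) (\<lambda>(t, x). \<phi> t x)" using flow by (simp add: is_flow_def)
  then have "((\<lambda>n. (\<lambda>(t, x). \<phi> t x) (f n, g n)) \<longlongrightarrow> (\<lambda>(t, x). \<phi> t x) (t, x)) F"
    using assms by (intro continuous_on_tendsto_compose[where f = "\<lambda>(t, x). \<phi> t x"] tendsto_Pair) auto
  then show ?thesis by simp
qed

text \<open>Time and point are perturbed together, because matched orbits are compared at slightly
  different times. Only \<open>t\<close> is bounded by \<open>C\<close>; \<open>t'\<close> is
  controlled through its distance to \<open>t\<close>.\<close>

definition flow_modulus :: "real \<Rightarrow> real \<Rightarrow> real \<Rightarrow> bool" where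
  "flow_modulus C \<kappa> \<delta> \<longleftrightarrow> (\<forall>t t' x y. \<bar>t\<bar> \<le> C \<longrightarrow> \<bar>t - t'\<bar> \<le> \<kappa> \<longrightarrow> x \<in> X \<longrightarrow> y \<in> X \<longrightarrow> dist x y \<le> \<kappa>
            \<longrightarrow> dist (\<phi> t x) (\<phi> t' y) < \<delta>)"

lemma flow_modulusD:
  "flow_modulus C \<kappa> \<delta> \<Longrightarrow> \<bar>t\<bar> \<le> C \<Longrightarrow> \<bar>t - t'\<bar> \<le> \<kappa> \<Longrightarrow> x \<in> X \<Longrightarrow> y \<in> X \<Longrightarrow> dist x y \<le> \<kappa>
    \<Longrightarrow> dist (\<phi> t x) (\<phi> t' y) < \<delta>"
  by (simp add: flow_modulus_def)

lemma flow_uniform: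
  assumes "\<delta> > 0"
  shows "\<exists>\<kappa>>0. \<kappa> \<le> 1 \<and> flow_modulus C \<kappa> \<delta>"
proof -
  \<comment> \<open>The second time interval is longer by 1 on both sides, which is why
    \<open>\<kappa> \<le> 1\<close> is arranged.\<close>
  let ?K = "({-C..C} \<times> {-C-1..C+1}) \<times> (X \<times> X)"
  have K: "compact ?K" using compX by (intro compact_Times) auto
  have "\<exists>d>0. \<forall>p\<in>?K. max \<bar>fst (fst p) - snd (fst p)\<bar> (dist (fst (snd p)) (snd (snd p))) \<le> d \<longrightarrow>
      dist (\<phi> (fst (fst p)) (fst (snd p))) (\<phi> (snd (fst p)) (snd (snd p))) < \<delta>"
    by (rule compact_small[OF K]) (auto intro!: continuous_intros continuous_on_flow simp: assms)
  then obtain d where d: "d > 0" "\<And>t t' x y. \<bar>t\<bar> \<le> C \<Longrightarrow> \<bar>t'\<bar> \<le> C + 1 \<Longrightarrow> x \<in> X \<Longrightarrow> y \<in> X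
      \<Longrightarrow> \<bar>t - t'\<bar> \<le> d \<Longrightarrow> dist x y \<le> d \<Longrightarrow> dist (\<phi> t x) (\<phi> t' y) < \<delta>"
    by (force simp: abs_le_iff)
  show ?thesis unfolding flow_modulus_def using d(1) by (intro exI[of _ "min d 1"]) (auto intro!: d(2))
qed

section \<open>Recurrence and absence of short periods\<close>

text \<open>\<open>K\<close> is the omega-limit set of \<open>x\<close>: nonempty, compact and
  invariant, hence all of \<open>X\<close> by minimality. Using the limit set instead of the orbit
  closure yields visits after any prescribed time \<open>T\<close>.\<close>

lemma recurrence:
  assumes "minimal_flow X \<phi>" "x \<in> X" "open B" "b \<in> B" "b \<in> X"
  shows "\<exists>t\<ge>T. \<phi> t x \<in> B"
proof -
  define K where "K = {y \<in> X. \<forall>e>0. \<forall>N. \<exists>t\<ge>N. dist (\<phi> t x) y < e}"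
  have seq: "\<exists>\<tau>. (\<forall>n. \<tau> n \<ge> real n) \<and> (\<lambda>n. \<phi> (\<tau> n) x) \<longlonglongrightarrow> y" if "y \<in> K" for y
  proof -
    have "\<exists>t\<ge>real n. dist (\<phi> t x) y < 1 / real (Suc n)" for n using that by (simp add: K_def)
    then obtain \<tau> where \<tau>: "\<And>n. \<tau> n \<ge> real n" "\<And>n. dist (\<phi> (\<tau> n) x) y < 1 / real (Suc n)" by metis
    have "(\<lambda>n. \<phi> (\<tau> n) x) \<longlonglongrightarrow> y"
      by (rule LIMSEQ_dist_le[OF less_imp_le[OF \<tau>(2)] LIMSEQ_inverse_Suc])
    then show ?thesis using \<tau>(1) by blast
  qed
  have KI: "y \<in> K" if "filterlim \<tau> at_top sequentially" "(\<lambda>n. \<phi> (\<tau> n) x) \<longlonglongrightarrow> y" for \<tau> :: "nat \<Rightarrow> real" and y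
  proof -
    have "y \<in> X" using \<open>x \<in> X\<close> by (intro closed_sequentially[OF compact_imp_closed[OF compX] _ that(2)]) simp
    moreover have "\<exists>t\<ge>N. dist (\<phi> t x) y < e" if "e > 0" for e N
    proof -
      have "eventually (\<lambda>n. dist (\<phi> (\<tau> n) x) y < e) sequentially"
        using \<open>(\<lambda>n. \<phi> (\<tau> n) x) \<longlonglongrightarrow> y\<close> \<open>e > 0\<close> by (rule tendstoD)
      moreover have "eventually (\<lambda>n. \<tau> n \<ge> N) sequentially"
        using \<open>filterlim \<tau> at_top sequentially\<close> by (simp add: filterlim_at_top)
      ultimately have "eventually (\<lambda>n. dist (\<phi> (\<tau> n) x) y < e \<and> \<tau> n \<ge> N) sequentially" by eventually_elim auto
      then show ?thesis using eventually_happens by force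
    qed
    ultimately show ?thesis by (simp add: K_def)
  qed
  have "K \<noteq> {}"
  proof -
    obtain y r where r: "strict_mono (r::nat\<Rightarrow>nat)" "((\<lambda>n. \<phi> (real n) x) \<circ> r) \<longlonglongrightarrow> y"
      using compX \<open>x \<in> X\<close> unfolding compact_def by (metis flow_in)
    have "filterlim (\<lambda>n. real (r n)) at_top sequentially"
      using filterlim_subseq[OF r(1)] filterlim_real_sequentially filterlim_compose by blast
    then show ?thesis using KI[of "\<lambda>n. real (r n)" y] r(2) by (auto simp: o_def)
  qed
  moreover have "compact K"
  proof -
    have "closed K"
    proof (subst closed_sequential_limits, intro allI impI, elim conjE)
      fix \<xi> y assume \<xi>: "\<forall>n. \<xi> n \<in> K" "\<xi> \<longlonglongrightarrow> y"
      have "y \<in> X" using \<xi>(1) by (intro closed_sequentially[OF compact_imp_closed[OF compX] _ \<xi>(2)]) (simp add: K_def)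
      moreover have "\<exists>t\<ge>N. dist (\<phi> t x) y < e" if "e > 0" for e N
      proof -
        obtain k where "dist (\<xi> k) y < e/2" using \<xi>(2) \<open>e > 0\<close> by (metis half_gt_zero lim_sequentially order_refl)
        moreover have "e/2 > 0" using \<open>e > 0\<close> by simp
        then obtain t where "t \<ge> N" "dist (\<phi> t x) (\<xi> k) < e/2" using \<xi>(1) unfolding K_def by blast
        ultimately show ?thesis using dist_triangle[of "\<phi> t x" y "\<xi> k"] by (intro exI[of _ t]) (simp add: dist_commute)
      qed
      ultimately show "y \<in> K" by (simp add: K_def)
    qed
    moreover have "K = X \<inter> K" by (auto simp: K_def)
    ultimately show ?thesis using compX compact_Int_closed by metis
  qed
  moreover have "flow_invariant K \<phi>"
  proof -
    have sub: "\<phi> s y \<in> K" if yK: "y \<in> K" for s y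
    proof -
      obtain \<tau> where \<tau>: "\<And>n. \<tau> n \<ge> real n" "(\<lambda>n. \<phi> (\<tau> n) x) \<longlonglongrightarrow> y" using seq[OF yK] by blast
      have "filterlim (\<lambda>n. \<tau> n + s) at_top sequentially"
      proof (rule filterlim_at_top_mono)
        show "filterlim (\<lambda>n. real n + s) at_top sequentially"
          by (rule filterlim_tendsto_add_at_top[OF tendsto_const filterlim_real_sequentially, of s, unfolded add.commute[of s]])
      qed (use \<tau>(1) in auto)
      moreover have "(\<lambda>n. \<phi> s (\<phi> (\<tau> n) x)) \<longlonglongrightarrow> \<phi> s y"
        using yK \<open>x \<in> X\<close> by (intro tendsto_flow \<tau>(2)) (auto simp: K_def)
      ultimately show ?thesis using \<open>x \<in> X\<close> by (intro KI) auto
    qed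
    have "\<phi> s ` K = K" for s
    proof
      show "K \<subseteq> \<phi> s ` K"
      proof
        fix y assume "y \<in> K"
        then have "y = \<phi> s (\<phi> (-s) y)" by (simp add: K_def)
        then show "y \<in> \<phi> s ` K" using sub[OF \<open>y \<in> K\<close>] by blast
      qed
    qed (use sub in auto)
    then show ?thesis by (simp add: flow_invariant_def)
  qed
  moreover have "K \<subseteq> X" by (auto simp: K_def)
  ultimately have "K = X" using assms(1) by (auto simp: minimal_flow_def)
  then have "b \<in> K" using assms by simp
  moreover obtain e where "e > 0" "ball b e \<subseteq> B" using assms open_contains_ball by blast
  ultimately obtain t where "t \<ge> T" "dist (\<phi> t x) b < e" unfolding K_def by blast
  then show ?thesis using \<open>ball b e \<subseteq> B\<close> by (metis dist_commute mem_ball subsetD)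
qed

text \<open>Points with periods tending to 0 accumulate at a fixed point, since the multiples of
  ever smaller periods approximate every time \<open>t\<close>.\<close>

lemma no_small_periods:
  assumes nofix: "\<And>x. x \<in> X \<Longrightarrow> \<exists>t. \<phi> t x \<noteq> x"
  shows "\<exists>\<tau>>0. \<forall>x\<in>X. \<forall>s. 0 < s \<and> s \<le> \<tau> \<longrightarrow> \<phi> s x \<noteq> x"
proof (rule ccontr)
  assume neg: "\<not> ?thesis"
  have "\<exists>x s. x \<in> X \<and> 0 < s \<and> s \<le> 1 / real (Suc n) \<and> \<phi> s x = x" for n
    using neg by (metis of_nat_0_less_iff zero_less_Suc zero_less_divide_1_iff)
  then obtain \<xi> \<sigma> where \<xi>: "\<And>n. \<xi> n \<in> X" "\<And>n. 0 < \<sigma> n" "\<And>n. \<sigma> n \<le> 1 / real (Suc n)" "\<And>n. \<phi> (\<sigma> n) (\<xi> n) = \<xi> n"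
    by metis
  obtain x r where r: "x \<in> X" "strict_mono (r::nat\<Rightarrow>nat)" "(\<xi> \<circ> r) \<longlonglongrightarrow> x"
    using compX \<xi>(1) unfolding compact_def by metis
  have per: "\<phi> (real k * \<sigma> n) (\<xi> n) = \<xi> n" for k n
  proof (induction k)
    case (Suc k)
    have "\<phi> (real (Suc k) * \<sigma> n) (\<xi> n) = \<phi> (\<sigma> n) (\<phi> (real k * \<sigma> n) (\<xi> n))"
      using \<xi>(1) by (simp add: algebra_simps)
    then show ?case using Suc \<xi>(4) by simp
  qed (simp add: \<xi>)
  have pos: "\<phi> t x = x" if t: "t \<ge> 0" for t
  proof -
    define k where "k n = nat \<lfloor>t / \<sigma> n\<rfloor>" for n
    have k: "real (k n) * \<sigma> n \<le> t \<and> t - \<sigma> n \<le> real (k n) * \<sigma> n" for n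
    proof -
      have *: "real (k n) = of_int \<lfloor>t / \<sigma> n\<rfloor>" using t \<xi>(2)[of n] by (simp add: k_def)
      have "of_int \<lfloor>t / \<sigma> n\<rfloor> \<le> t / \<sigma> n" "t / \<sigma> n - 1 \<le> of_int \<lfloor>t / \<sigma> n\<rfloor>" by linarith+
      then have "of_int \<lfloor>t / \<sigma> n\<rfloor> * \<sigma> n \<le> t / \<sigma> n * \<sigma> n" "(t / \<sigma> n - 1) * \<sigma> n \<le> of_int \<lfloor>t / \<sigma> n\<rfloor> * \<sigma> n"
        using \<xi>(2)[of n] mult_right_mono less_imp_le by blast+
      then show ?thesis using \<xi>(2)[of n] by (simp add: * left_diff_distrib)
    qed
    have \<sigma>0: "\<sigma> \<longlonglongrightarrow> 0"
      by (rule LIMSEQ_dist_le[OF _ LIMSEQ_inverse_Suc]) (use \<xi>(2,3) in \<open>simp add: less_imp_le\<close>)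
    have "(\<lambda>n. real (k n) * \<sigma> n) \<longlonglongrightarrow> t"
    proof (rule tendsto_sandwich[of "\<lambda>n. t - \<sigma> n" _ _ "\<lambda>_. t"])
      show "(\<lambda>n. t - \<sigma> n) \<longlonglongrightarrow> t" using tendsto_diff[OF tendsto_const \<sigma>0, of t] by simp
    qed (use k in \<open>auto\<close>)
    then have "(\<lambda>n. real (k (r n)) * \<sigma> (r n)) \<longlonglongrightarrow> t" using LIMSEQ_subseq_LIMSEQ[OF _ r(2)] by (force simp: o_def)
    then have "(\<lambda>n. \<phi> (real (k (r n)) * \<sigma> (r n)) (\<xi> (r n))) \<longlonglongrightarrow> \<phi> t x"
      using r \<xi>(1) by (intro tendsto_flow) (auto simp: o_def)
    then have "(\<lambda>n. \<xi> (r n)) \<longlonglongrightarrow> \<phi> t x" by (simp add: per)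
    then show ?thesis using r(3) LIMSEQ_unique by (auto simp: o_def)
  qed
  have "\<phi> t x = x" for t
  proof (cases "t \<ge> 0")
    case False
    then have "\<phi> t x = \<phi> t (\<phi> (-t) x)" using pos[of "-t"] by simp
    then show ?thesis using r(1) by simp
  qed (simp add: pos)
  then show False using nofix r(1) by blast
qed

lemma minimal_no_fixed:
  assumes "minimal_flow X \<phi>" "\<exists>x\<in>X. \<exists>y\<in>X. x \<noteq> y" "x \<in> X"
  shows "\<exists>t. \<phi> t x \<noteq> x"
proof (rule ccontr)
  assume "\<not> ?thesis"
  then have "flow_invariant {x} \<phi>" by (simp add: flow_invariant_def)
  then have "{x} = X" using assms(1,3) by (simp add: minimal_flow_def)
  then show False using assms(2) by (metis singletonD)
qed

end

section \<open>Time reversal and reparametrizations\<close>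

lemma is_flow_reverse: "is_flow X \<phi> \<Longrightarrow> is_flow X (\<lambda>t. \<phi> (- t))"
proof -
  assume f: "is_flow X \<phi>"
  have "continuous_on (UNIV \<times> X) ((\<lambda>(t, x). \<phi> t x) \<circ> (\<lambda>(t, x). (-t, x)))"
    using f by (intro continuous_on_compose) (auto simp: is_flow_def case_prod_beta intro!: continuous_intros elim: continuous_on_subset)
  moreover have "\<phi> (- t - s) x = \<phi> (- s) (\<phi> (- t) x)" if "x \<in> X" for t s x
    using f that unfolding is_flow_def by (metis add_uminus_conv_diff)
  ultimately show ?thesis using f by (auto simp: is_flow_def o_def case_prod_beta)
qed

lemma minimal_flow_reverse: "minimal_flow X \<phi> \<Longrightarrow> minimal_flow X (\<lambda>t. \<phi> (- t))"
proof -
  have "flow_invariant K (\<lambda>t. \<phi> (- t)) \<longleftrightarrow> flow_invariant K \<phi>" for K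
    unfolding flow_invariant_def by (metis add.inverse_inverse)
  then show "minimal_flow X \<phi> \<Longrightarrow> minimal_flow X (\<lambda>t. \<phi> (- t))" by (simp add: minimal_flow_def)
qed

lemma RepI: "strict_mono h \<Longrightarrow> surj h \<Longrightarrow> h 0 = 0 \<Longrightarrow> h \<in> Rep"
  unfolding Rep_def by (auto intro!: continuous_onI_mono simp: strict_mono_less_eq)

lemma RepD:
  assumes "h \<in> Rep"
  shows "continuous_on S h" "strict_mono h" "surj h" "h 0 = 0"
  using assms continuous_on_subset by (auto simp: Rep_def)

lemma Rep_comp: "g \<in> Rep \<Longrightarrow> h \<in> Rep \<Longrightarrow> (\<lambda>t. g (h t)) \<in> Rep"
  using comp_surj[of h g] by (intro RepI strict_monoI) (auto simp: Rep_def strict_mono_less o_def)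

lemma Rep_inverse:
  assumes "h \<in> Rep"
  shows "\<exists>g\<in>Rep. (\<forall>t. h (g t) = t) \<and> (\<forall>t. g (h t) = t)"
proof -
  have inj: "inj h" using RepD(2)[OF assms] strict_mono_imp_inj_on by blast
  have 1: "h (inv h t) = t" for t using RepD(3)[OF assms] by (simp add: surj_f_inv_f)
  have 2: "inv h (h t) = t" for t using inj by simp
  have "inv h \<in> Rep"
  proof (rule RepI)
    show "strict_mono (inv h)"
      by (rule strict_monoI) (metis 1 RepD(2)[OF assms] strict_mono_less)
    show "surj (inv h)" using 2 by (metis surjI)
    show "inv h 0 = 0" using 2 RepD(4)[OF assms] by metis
  qed
  then show ?thesis using 1 2 by blast
qed

text \<open>The piecewise linear map through the values \<open>a n\<close> at the integers. For two
  sequences of node times, \<open>interp b\<close> composed with the inverse of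
  \<open>interp a\<close> is a reparametrization that sends each node \<open>a n\<close> to
  \<open>b n\<close>.\<close>

definition interp :: "(int \<Rightarrow> real) \<Rightarrow> real \<Rightarrow> real" where
  "interp a u = a \<lfloor>u\<rfloor> + frac u * (a (\<lfloor>u\<rfloor> + 1) - a \<lfloor>u\<rfloor>)"

lemma gap_mono:
  fixes a :: "int \<Rightarrow> real"
  assumes "\<And>n. a n + c \<le> a (n + 1)" "m \<le> n"
  shows "c * of_int (n - m) \<le> a n - a m"
  using assms(2)
proof (induction n rule: int_ge_induct)
  case (step n)
  then show ?case using assms(1)[of n] by (simp add: algebra_simps)
qed simp

text \<open>Gaps of at least \<open>c\<close> drive the nodes to both infinities, so the half-open
  intervals between consecutive nodes tile the line. Used for surjectivity of \<open>interp\<close>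
  and to evaluate the \<open>THE\<close> in \<open>susp_flow\<close>.\<close>

lemma ex1_bracket:
  fixes a :: "int \<Rightarrow> real"
  assumes gap: "\<And>n. a n + c \<le> a (n + 1)" and c: "c > 0"
  shows "\<exists>!n. a n \<le> v \<and> v < a (n + 1)"
proof (rule ex_ex1I)
  show "\<exists>n. a n \<le> v \<and> v < a (n + 1)"
  proof (rule ccontr)
    assume neg: "\<not> ?thesis"
    obtain N :: nat where N: "real N * c > \<bar>v\<bar> + \<bar>a 0\<bar>" using reals_Archimedean3[OF c] by blast
    have "a (int N) \<ge> a 0 + c * real N" "a (- int N) \<le> a 0 - c * real N"
      using gap_mono[where a = a, OF gap, of 0 "int N"] gap_mono[where a = a, OF gap, of "- int N" 0] by auto
    then have *: "a (- int N) \<le> v" "v < a (int N)" using N by (auto simp: mult.commute abs_le_iff)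
    have "a n \<le> v" if "- int N \<le> n" for n
      using that by (induction n rule: int_ge_induct) (use neg * in \<open>auto simp: not_less\<close>)
    then show False using *(2) by (metis leD le_less_linear neg_le_iff_le not_less of_nat_0_le_iff order_trans neg_le_0_iff_le)
  qed
next
  fix m n assume *: "a m \<le> v \<and> v < a (m + 1)" "a n \<le> v \<and> v < a (n + 1)"
  have mono: "a i \<le> a j" if "i \<le> j" for i j
  proof -
    have "0 \<le> c * of_int (j - i)" using that c by simp
    then show ?thesis using gap_mono[where a = a, OF gap that] by linarith
  qed
  show "m = n"
  proof (rule linorder_cases[of m n])
    assume "m < n" then show ?thesis using mono[of "m+1" n] * by linarith
  next
    assume "n < m" then show ?thesis using mono[of "n+1" m] * by linarith
  qed
qed

lemma interp_at:
  assumes "0 \<le> w" "w < 1" shows "interp a (of_int n + w) = a n + w * (a (n + 1) - a n)"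
proof -
  have "\<lfloor>of_int n + w\<rfloor> = n" using assms by linarith
  then show ?thesis by (simp add: interp_def frac_def)
qed

lemma interp_Rep:
  assumes gap: "\<And>n. a n + c \<le> a (n + 1)" and c: "c > 0" and a0: "a 0 = 0"
  shows "interp a \<in> Rep"
proof (rule RepI)
  have pos: "a (n + 1) - a n > 0" for n using gap[of n] c by linarith
  show "strict_mono (interp a)"
  proof (rule strict_monoI)
    fix u v :: real assume uv: "u < v"
    show "interp a u < interp a v"
    proof (cases "\<lfloor>u\<rfloor> = \<lfloor>v\<rfloor>")
      case True
      have "frac u < frac v" using uv True by (simp add: frac_def)
      then show ?thesis using pos[of "\<lfloor>v\<rfloor>"] True by (simp add: interp_def)
    next
      case False
      then have le: "\<lfloor>u\<rfloor> + 1 \<le> \<lfloor>v\<rfloor>" using uv by linarith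
      have "frac u * (a (\<lfloor>u\<rfloor> + 1) - a \<lfloor>u\<rfloor>) < 1 * (a (\<lfloor>u\<rfloor> + 1) - a \<lfloor>u\<rfloor>)"
        using pos frac_lt_1 by (intro mult_strict_right_mono) auto
      then have "interp a u < a (\<lfloor>u\<rfloor> + 1)" by (simp add: interp_def)
      also have "0 \<le> c * of_int (\<lfloor>v\<rfloor> - (\<lfloor>u\<rfloor> + 1))" using le c by simp
      then have "a (\<lfloor>u\<rfloor> + 1) \<le> a \<lfloor>v\<rfloor>" using gap_mono[where a = a, OF gap le] by linarith
      also have "0 \<le> frac v * (a (\<lfloor>v\<rfloor> + 1) - a \<lfloor>v\<rfloor>)"
        using pos[of "\<lfloor>v\<rfloor>"] frac_ge_0[of v] by (simp add: mult_nonneg_nonneg)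
      then have "a \<lfloor>v\<rfloor> \<le> interp a v" by (simp add: interp_def)
      finally show ?thesis .
    qed
  qed
  have "\<exists>u. interp a u = v" for v
  proof -
    obtain n where n: "a n \<le> v" "v < a (n + 1)"
      using ex1_bracket[where a = a, OF gap c, of v] by blast
    then have "0 \<le> (v - a n) / (a (n + 1) - a n)" "(v - a n) / (a (n + 1) - a n) < 1" by auto
    then have "interp a (of_int n + (v - a n) / (a (n + 1) - a n)) = v"
      using pos[of n] by (simp add: interp_at)
    then show ?thesis by blast
  qed
  then show "surj (interp a)" by (metis surj_def)
  show "interp a 0 = 0" by (simp add: interp_def a0)
qed

text \<open>Closeness has to be checked at the nodes only: between consecutive nodes the first orbit
  runs for at most \<open>C\<close>, the two durations differ by at most \<kappa>, and uniform
  continuity of the flow carries closeness across.\<close>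

lemma (in compact_flow) expansive_nodes:
  assumes exp: "expansive_flow X \<phi>" and "\<epsilon> > 0"
  shows "\<exists>\<kappa>>0. \<kappa> \<le> 1 \<and> (\<forall>x\<in>X. \<forall>y\<in>X. \<forall>(a::int\<Rightarrow>real) b c. a 0 = 0 \<and> b 0 = 0 \<and> c > 0 \<and>
      (\<forall>n. a n + c \<le> a (n + 1) \<and> a (n + 1) \<le> a n + C \<and> b n + c \<le> b (n + 1) \<and>
           \<bar>(a (n + 1) - a n) - (b (n + 1) - b n)\<bar> \<le> \<kappa> \<and> dist (\<phi> (a n) x) (\<phi> (b n) y) \<le> \<kappa>)
      \<longrightarrow> (\<exists>s. \<bar>s\<bar> \<le> \<epsilon> \<and> y = \<phi> s x))"
proof -
  have "\<exists>\<delta>>0. \<forall>x\<in>X. \<forall>y\<in>X. \<forall>h\<in>Rep. (\<forall>t. dist (\<phi> t x) (\<phi> (h t) y) \<le> \<delta>) \<longrightarrow> (\<exists>s. \<bar>s\<bar> \<le> \<epsilon> \<and> y = \<phi> s x)"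
    using exp \<open>\<epsilon> > 0\<close> by (simp add: expansive_flow_def)
  then obtain \<delta> where \<delta>0: "\<delta> > 0"
    and \<delta>': "\<forall>x\<in>X. \<forall>y\<in>X. \<forall>h\<in>Rep. (\<forall>t. dist (\<phi> t x) (\<phi> (h t) y) \<le> \<delta>) \<longrightarrow> (\<exists>s. \<bar>s\<bar> \<le> \<epsilon> \<and> y = \<phi> s x)"
    by (elim exE conjE)
  note \<delta> = \<delta>0 \<delta>'[rule_format]
  obtain \<kappa> where \<kappa>0: "\<kappa> > 0" "\<kappa> \<le> 1" "flow_modulus C \<kappa> \<delta>"
    using flow_uniform[OF \<delta>(1)] by blast
  note \<kappa> = \<kappa>0(1,2) flow_modulusD[OF \<kappa>0(3)]
  have "\<exists>s. \<bar>s\<bar> \<le> \<epsilon> \<and> y = \<phi> s x"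
    if xy: "x \<in> X" "y \<in> X" and a0: "a 0 = 0" "b 0 = 0" "c > 0"
      and h: "\<And>n. a n + c \<le> a (n + 1)" "\<And>n. a (n + 1) \<le> a n + C" "\<And>n. b n + c \<le> b (n + 1)"
        "\<And>n. \<bar>(a (n + 1) - a n) - (b (n + 1) - b n)\<bar> \<le> \<kappa>" "\<And>n. dist (\<phi> (a n) x) (\<phi> (b n) y) \<le> \<kappa>"
    for x y c and a b :: "int \<Rightarrow> real"
  proof -
    have aR: "interp a \<in> Rep" and bR: "interp b \<in> Rep" using interp_Rep[of a c, OF h(1) a0(3,1)] interp_Rep[of b c, OF h(3) a0(3,2)] by blast+
    \<comment> \<open>The reparametrization is \<open>interp b\<close> after \<open>g\<close>; in
      this parameter a time \<open>t\<close> lies at the same fraction \<open>w\<close> of the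
      \<open>n\<close>-th interval on both orbits.\<close>
    obtain g where g: "g \<in> Rep" "\<And>t. interp a (g t) = t" using Rep_inverse[OF aR] by blast
    have "dist (\<phi> t x) (\<phi> (interp b (g t)) y) \<le> \<delta>" for t
    proof -
      define n where "n = \<lfloor>g t\<rfloor>" define w where "w = frac (g t)"
      have w: "0 \<le> w" "w < 1" by (auto simp: w_def frac_lt_1)
      have "interp a (g t) = a n + w * (a (n + 1) - a n)" by (simp add: interp_def n_def w_def)
      then have t: "t = a n + w * (a (n + 1) - a n)" using g(2) by simp
      have b: "interp b (g t) = b n + w * (b (n + 1) - b n)" by (simp add: interp_def n_def w_def)
      have ga: "0 \<le> a (n + 1) - a n" "a (n + 1) - a n \<le> C" using h(1,2)[of n] a0(3) by auto
      have "w * (a (n + 1) - a n) \<le> 1 * C" using w ga by (intro mult_mono) auto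
      then have 1: "\<bar>w * (a (n + 1) - a n)\<bar> \<le> C" using w ga by (simp add: abs_mult)
      have "w * \<bar>(a (n + 1) - a n) - (b (n + 1) - b n)\<bar> \<le> 1 * \<kappa>" using w h(4)[of n] by (intro mult_mono) auto
      then have 2: "\<bar>w * (a (n + 1) - a n) - w * (b (n + 1) - b n)\<bar> \<le> \<kappa>"
        using w by (simp add: right_diff_distrib[symmetric] abs_mult)
      have "dist (\<phi> (w * (a (n + 1) - a n)) (\<phi> (a n) x)) (\<phi> (w * (b (n + 1) - b n)) (\<phi> (b n) y)) < \<delta>"
        by (rule \<kappa>(3)[OF 1 2 flow_in[OF xy(1)] flow_in[OF xy(2)] h(5)])
      then show ?thesis using xy unfolding b by (subst (1) t) simp
    qed
    then show ?thesis using \<delta>(2)[OF xy Rep_comp[OF bR g(1)]] by blast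
  qed
  note main = this
  show ?thesis
  proof (rule exI[of _ \<kappa>], intro conjI ballI allI impI)
    fix x y c and a b :: "int \<Rightarrow> real"
    assume xy: "x \<in> X" "y \<in> X" and A: "a 0 = 0 \<and> b 0 = 0 \<and> c > 0 \<and>
      (\<forall>n. a n + c \<le> a (n + 1) \<and> a (n + 1) \<le> a n + C \<and> b n + c \<le> b (n + 1) \<and>
           \<bar>(a (n + 1) - a n) - (b (n + 1) - b n)\<bar> \<le> \<kappa> \<and> dist (\<phi> (a n) x) (\<phi> (b n) y) \<le> \<kappa>)"
    show "\<exists>s. \<bar>s\<bar> \<le> \<epsilon> \<and> y = \<phi> s x"
      by (rule main[of x y a b c]) (use xy A in simp_all)
  qed (use \<kappa>(1,2) in auto)
qed

section \<open>Local sections and tracked orbits\<close>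

lemma compactE_subseq:
  fixes S :: "'a::metric_space set"
  assumes "compact S" "\<forall>n. f n \<in> S"
  obtains l r where "l \<in> S" "strict_mono (r::nat\<Rightarrow>nat)" "(f \<circ> r) \<longlonglongrightarrow> l"
proof -
  have "(\<forall>n. f n \<in> S) \<longrightarrow> (\<exists>l\<in>S. \<exists>r. strict_mono (r::nat\<Rightarrow>nat) \<and> (f \<circ> r) \<longlonglongrightarrow> l)"
    using assms(1) unfolding compact_def by (rule spec)
  then show ?thesis using assms(2) that by blast
qed

lemma compact_Int_of_closed: "compact K \<Longrightarrow> closed (K \<inter> A) \<Longrightarrow> compact (K \<inter> A)"
  using compact_Int_closed[of K "K \<inter> A"] by (simp add: Int_left_absorb)

text \<open>\<open>F z\<close> is a clock near \<open>z\<close>: along the orbit of any point within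
  \<open>r\<close> of \<open>z\<close> it advances at speed at least \<open>c\<close> during the
  times of absolute value at most \<open>a\<close>. Its level sets near \<open>z\<close> are
  therefore transversal to the flow, with constants that do not depend on \<open>z\<close>.\<close>

locale sectioned_flow = compact_flow X \<phi> for X :: "'a::metric_space set" and \<phi> +
  fixes F :: "'a \<Rightarrow> 'a \<Rightarrow> real" and r a c :: real
  assumes contF: "continuous_on (X \<times> X) (\<lambda>(z, y). F z y)"
    and rpos: "0 < r" and apos: "0 < a" and cpos: "0 < c"
    and incr: "\<And>z y s t. \<lbrakk>z \<in> X; y \<in> X; dist z y \<le> r; - a \<le> s; s \<le> t; t \<le> a\<rbrakk>
      \<Longrightarrow> c * (t - s) \<le> F z (\<phi> t y) - F z (\<phi> s y)"

text \<open>Whitney's function: along the flow, the integral of \<open>dist z\<close> over a short orbit segment starting near \<open>z\<close>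
  has derivative \<open>dist z (\<phi> (t + \<tau>) y) - dist z (\<phi> t y)\<close>, which is positive since \<open>\<phi> \<tau> z \<noteq> z\<close>.\<close>

lemma (in compact_flow) section_function_exists:
  assumes \<tau>: "\<tau> > 0" "\<And>x s. x \<in> X \<Longrightarrow> 0 < s \<Longrightarrow> s \<le> \<tau> \<Longrightarrow> \<phi> s x \<noteq> x" and ne: "X \<noteq> {}"
  shows "\<exists>F r a c. sectioned_flow X \<phi> F r a c"
proof -
  define F where "F z y = integral {0..\<tau>} (\<lambda>s. dist z (\<phi> s y))" for z y
  have "continuous_on X (\<lambda>z. dist z (\<phi> \<tau> z))"
    by (intro continuous_intros continuous_on_flow) auto
  then obtain z0 where z0: "z0 \<in> X" "\<And>z. z \<in> X \<Longrightarrow> dist z0 (\<phi> \<tau> z0) \<le> dist z (\<phi> \<tau> z)"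
    using continuous_attains_inf[OF compX ne] by blast
  define m where "m = dist z0 (\<phi> \<tau> z0)"
  have "\<phi> \<tau> z0 \<noteq> z0" using \<tau> z0(1) by auto
  then have m: "m > 0" by (simp add: m_def)
  let ?K = "(X \<times> X) \<times> {-1..1::real}"
  have "compact ?K" using compX by (intro compact_Times) auto
  \<comment> \<open>At \<open>y = z\<close> and \<open>t = 0\<close> the difference of distances is
    the displacement of \<open>z\<close> in time \<tau>, which is at least \<open>m\<close>; nearby
    at least half of \<open>m\<close> is left.\<close>
  then have "\<exists>d>0. \<forall>p\<in>?K. max (dist (fst (fst p)) (snd (fst p))) \<bar>snd p\<bar> \<le> d \<longrightarrow>
      m - (dist (fst (fst p)) (\<phi> (snd p + \<tau>) (snd (fst p))) - dist (fst (fst p)) (\<phi> (snd p) (snd (fst p)))) < m/2"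
    by (rule compact_small) (use m z0(2) in \<open>auto simp: m_def intro!: continuous_intros continuous_on_flow\<close>)
  then obtain d where d: "d > 0" and d2: "\<And>z y t. z \<in> X \<Longrightarrow> y \<in> X \<Longrightarrow> \<bar>t\<bar> \<le> 1 \<Longrightarrow> dist z y \<le> d \<Longrightarrow> \<bar>t\<bar> \<le> d \<Longrightarrow>
      m/2 \<le> dist z (\<phi> (t + \<tau>) y) - dist z (\<phi> t y)"
    by (force simp: abs_le_iff)
  have "sectioned_flow X \<phi> F d (min d 1) (m/2)"
  proof
    have "continuous_on ((X \<times> X) \<times> cbox 0 \<tau>) (\<lambda>q. dist (fst (fst q)) (\<phi> (snd q) (snd (fst q))))"
      by (intro continuous_intros continuous_on_flow) auto
    then have "continuous_on (X \<times> X) (\<lambda>p. integral (cbox 0 \<tau>) (\<lambda>s. dist (fst p) (\<phi> s (snd p))))"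
      by (intro integral_continuous_on_param) (simp add: case_prod_beta)
    then show "continuous_on (X \<times> X) (\<lambda>(z, y). F z y)" by (simp add: F_def case_prod_beta)
    fix z y s t assume A: "z \<in> X" "y \<in> X" "dist z y \<le> d" "- min d 1 \<le> s" "s \<le> t" "t \<le> min d 1"
    define p where "p v = dist z (\<phi> v y)" for v
    have cp: "continuous_on I p" for I unfolding p_def using A(2) by (intro continuous_intros continuous_on_flow) auto
    then have ip: "p integrable_on {u..v}" for u v by (rule integrable_continuous_real)
    have Fp: "F z (\<phi> u y) = integral {u..u+\<tau>} p" for u
    proof -
      have "F z (\<phi> u y) = integral {0..\<tau>} (p \<circ> (\<lambda>x. x + u))" using A(2) by (simp add: F_def p_def o_def add.commute)
      also have "\<dots> = integral {0+u..\<tau>+u} p" by (rule integral_shift) (rule cp)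
      finally show ?thesis by (simp add: add.commute)
    qed
    \<comment> \<open>The windows from \<open>s\<close> to \<open>s+\<tau>\<close> and from
      \<open>t\<close> to \<open>t+\<tau>\<close> differ by two intervals of length
      \<open>t - s\<close>, so the increment of \<open>F z\<close> is the integral of
      \<open>p (v + \<tau>) - p v\<close> from \<open>s\<close> to \<open>t\<close>.\<close>
    have "integral {s..t} p + integral {t..t+\<tau>} p = integral {s..t+\<tau>} p"
      "integral {s..s+\<tau>} p + integral {s+\<tau>..t+\<tau>} p = integral {s..t+\<tau>} p"
      using A(5) \<tau>(1) ip by (auto intro!: Henstock_Kurzweil_Integration.integral_combine)
    moreover have "integral {s+\<tau>..t+\<tau>} p = integral {s..t} (\<lambda>v. p (v + \<tau>))"
      using integral_shift[of s \<tau> t p] cp by (simp add: o_def)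
    moreover have "integral {s..t} (\<lambda>v. p v + m/2) \<le> integral {s..t} (\<lambda>v. p (v + \<tau>))"
    proof (rule integral_le)
      show "(\<lambda>v. p v + m/2) integrable_on {s..t}" by (intro integrable_continuous_real continuous_intros cp)
      show "(\<lambda>v. p (v + \<tau>)) integrable_on {s..t}"
        by (intro integrable_continuous_real continuous_on_compose2[OF cp[of UNIV]] continuous_intros) auto
      fix v assume "v \<in> {s..t}"
      then have "\<bar>v\<bar> \<le> 1" "\<bar>v\<bar> \<le> d" using A by auto
      then show "p v + m/2 \<le> p (v + \<tau>)" using d2[OF A(1,2), of v] A(3) by (simp add: p_def)
    qed
    moreover have "integral {s..t} (\<lambda>v. p v + m/2) = integral {s..t} p + m/2 * (t - s)"
      using A(5) ip by (subst Henstock_Kurzweil_Integration.integral_add) auto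
    ultimately show "m/2 * (t - s) \<le> F z (\<phi> t y) - F z (\<phi> s y)" by (simp add: Fp)
  qed (use d m in simp_all)
  then show ?thesis by blast
qed

text \<open>The clock runs backwards with the flow, so it changes sign. Its level sets stay the
  same, so a continuum in a section can be followed in either time direction.\<close>

lemma sectioned_flow_reverse:
  assumes "sectioned_flow X \<phi> F r a c"
  shows "sectioned_flow X (\<lambda>t. \<phi> (- t)) (\<lambda>z y. - F z y) r a c"
proof -
  interpret sectioned_flow X \<phi> F r a c by fact
  show ?thesis
  proof
    show "continuous_on (X \<times> X) (\<lambda>(z, y). - F z y)"
      using continuous_on_minus[OF contF] by (simp add: case_prod_beta)
    fix z y s t assume A: "z \<in> X" "y \<in> X" "dist z y \<le> r" "- a \<le> s" "s \<le> t" "t \<le> a"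
    show "c * (t - s) \<le> - F z (\<phi> (- t) y) - - F z (\<phi> (- s) y)"
      using incr[of z y "-t" "-s"] A by simp
  qed (rule compX is_flow_reverse[OF flow] rpos apos cpos)+
qed

context sectioned_flow
begin

lemma continuous_on_F:
  assumes "continuous_on S f" "continuous_on S g" "\<And>p. p \<in> S \<Longrightarrow> f p \<in> X" "\<And>p. p \<in> S \<Longrightarrow> g p \<in> X"
  shows "continuous_on S (\<lambda>p. F (f p) (g p))"
proof -
  have "continuous_on S ((\<lambda>(z, y). F z y) \<circ> (\<lambda>p. (f p, g p)))"
    by (intro continuous_on_compose continuous_on_Pair assms continuous_on_subset[OF contF]) (auto intro: assms)
  then show ?thesis by (simp add: o_def)
qed

definition sect :: "'a \<Rightarrow> 'a set" where
  "sect z = {x \<in> X. dist z x \<le> r \<and> F z x = F z z}"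

lemma sect_sub: "x \<in> sect z \<Longrightarrow> x \<in> X"
  by (simp add: sect_def)

lemma compact_sect: "z \<in> X \<Longrightarrow> compact (sect z)"
proof -
  assume z: "z \<in> X"
  have "sect z = (X \<inter> (\<lambda>x. F z x) -` {F z z}) \<inter> cball z r" by (auto simp: sect_def)
  moreover have "closed (X \<inter> (\<lambda>x. F z x) -` {F z z})"
    using z compX by (intro continuous_closed_preimage continuous_on_F) (auto simp: compact_imp_closed)
  then have "compact (X \<inter> (\<lambda>x. F z x) -` {F z z})"
    by (rule compact_Int_of_closed[OF compX])
  ultimately show ?thesis by (simp add: compact_Int_closed)
qed

lemma transversal:
  assumes "z \<in> X" "x \<in> sect z" "\<phi> s x \<in> sect z" "\<bar>s\<bar> \<le> a"
  shows "s = 0"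
proof -
  have x: "x \<in> X" "dist z x \<le> r" using assms(2) by (auto simp: sect_def)
  have eq: "F z (\<phi> s x) = F z x" using assms(2,3) by (simp add: sect_def)
  show ?thesis
  proof (cases "s \<ge> 0")
    case True
    then have "c * s \<le> 0" using incr[OF assms(1) x, of 0 s] assms(4) eq x(1) apos by simp
    then show ?thesis using cpos True by (simp add: mult_le_0_iff)
  next
    case False
    then have "c * (- s) \<le> 0" using incr[OF assms(1) x, of s 0] assms(4) eq x(1) apos by simp
    moreover have "c * (- s) > 0" using cpos False by (intro mult_pos_pos) auto
    ultimately show ?thesis by simp
  qed
qed

text \<open>If \<open>y\<close> lies exactly on the orbit of \<open>x\<close> at a time of absolute
  value at most \<open>a\<close>, then \<open>transversal\<close> gives \<open>x = y\<close>;
  compactness makes this approximate. It bounds the size of an obstacle inside a section.\<close>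

lemma near_transversal:
  assumes "\<eta> > 0"
  shows "\<exists>\<eta>'>0. \<forall>z x y s. z \<in> X \<longrightarrow> x \<in> sect z \<longrightarrow> y \<in> sect z \<longrightarrow> \<bar>s\<bar> \<le> a \<longrightarrow> dist y (\<phi> s x) \<le> \<eta>' \<longrightarrow> dist x y < \<eta>"
proof -
  let ?K = "(X \<times> {-a..a}) \<times> (X \<times> X)"
  let ?z = "\<lambda>p::('a \<times> real) \<times> 'a \<times> 'a. fst (fst p)" let ?s = "\<lambda>p::('a \<times> real) \<times> 'a \<times> 'a. snd (fst p)"
  let ?x = "\<lambda>p::('a \<times> real) \<times> 'a \<times> 'a. fst (snd p)" let ?y = "\<lambda>p::('a \<times> real) \<times> 'a \<times> 'a. snd (snd p)"
  \<comment> \<open>\<open>?f p \<le> 0\<close> says that \<open>y = \<phi> s x\<close> and that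
    both points belong to \<open>sect z\<close>.\<close>
  let ?f = "\<lambda>p. max (dist (?y p) (\<phi> (?s p) (?x p))) (max (max (dist (?z p) (?x p) - r) (dist (?z p) (?y p) - r))
     (max \<bar>F (?z p) (?x p) - F (?z p) (?z p)\<bar> \<bar>F (?z p) (?y p) - F (?z p) (?z p)\<bar>))"
  have "compact ?K" using compX by (intro compact_Times) auto
  then have "\<exists>d>0. \<forall>p\<in>?K. ?f p \<le> d \<longrightarrow> dist (?x p) (?y p) < \<eta>"
  proof (rule compact_small)
    show "continuous_on ?K ?f" by (intro continuous_intros continuous_on_flow continuous_on_F) auto
    show "continuous_on ?K (\<lambda>p. dist (?x p) (?y p))" by (intro continuous_intros)
    fix p assume p: "p \<in> ?K" "?f p \<le> 0"
    obtain z s x y where pe: "p = ((z, s), (x, y))" by (metis prod.collapse)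
    have "x \<in> sect z" "y \<in> sect z" "y = \<phi> s x" "z \<in> X" "\<bar>s\<bar> \<le> a" "x \<in> X" using p by (auto simp: pe sect_def)
    then have "s = 0" using transversal by blast
    then show "dist (?x p) (?y p) \<le> 0" using \<open>y = \<phi> s x\<close> \<open>x \<in> X\<close> by (simp add: pe)
  qed (rule assms)
  then obtain d where d: "d > 0" "\<And>p. p \<in> ?K \<Longrightarrow> ?f p \<le> d \<Longrightarrow> dist (?x p) (?y p) < \<eta>" by blast
  have "dist x y < \<eta>" if "z \<in> X" "x \<in> sect z" "y \<in> sect z" "\<bar>s\<bar> \<le> a" "dist y (\<phi> s x) \<le> d" for z x y s
    using d(2)[of "((z, s), (x, y))"] that d(1) by (simp add: sect_def abs_le_iff)
  then show ?thesis using d(1) by blast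
qed

text \<open>For \<open>x = y\<close> both transit times lead into the same section and differ by at
  most \<open>2 * \<epsilon> \<le> a\<close>, hence agree. So the landing point depends uniformly
  continuously on the starting point, however the transit times near 1 were chosen and whatever the
  section is.\<close>

lemma step_modulus:
  assumes "\<eta> > 0" "2 * \<epsilon> \<le> a"
  shows "\<exists>\<eta>'>0. \<forall>z x y s t. z \<in> X \<longrightarrow> x \<in> X \<longrightarrow> y \<in> X \<longrightarrow> \<phi> s x \<in> sect z \<longrightarrow> \<phi> t y \<in> sect z \<longrightarrow> \<bar>s - 1\<bar> \<le> \<epsilon> \<longrightarrow> \<bar>t - 1\<bar> \<le> \<epsilon> \<longrightarrow>
    dist x y \<le> \<eta>' \<longrightarrow> dist (\<phi> s x) (\<phi> t y) < \<eta>"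
proof -
  let ?K = "(X \<times> ({1-\<epsilon>..1+\<epsilon>} \<times> {1-\<epsilon>..1+\<epsilon>})) \<times> (X \<times> X)"
  let ?z = "\<lambda>p::('a \<times> real \<times> real) \<times> 'a \<times> 'a. fst (fst p)" let ?s = "\<lambda>p::('a \<times> real \<times> real) \<times> 'a \<times> 'a. fst (snd (fst p))"
  let ?t = "\<lambda>p::('a \<times> real \<times> real) \<times> 'a \<times> 'a. snd (snd (fst p))"
  let ?x = "\<lambda>p::('a \<times> real \<times> real) \<times> 'a \<times> 'a. fst (snd p)" let ?y = "\<lambda>p::('a \<times> real \<times> real) \<times> 'a \<times> 'a. snd (snd p)"
  let ?u = "\<lambda>p. \<phi> (?s p) (?x p)" let ?v = "\<lambda>p. \<phi> (?t p) (?y p)"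
  let ?f = "\<lambda>p. max (dist (?x p) (?y p)) (max (max (dist (?z p) (?u p) - r) (dist (?z p) (?v p) - r))
     (max \<bar>F (?z p) (?u p) - F (?z p) (?z p)\<bar> \<bar>F (?z p) (?v p) - F (?z p) (?z p)\<bar>))"
  have "compact ?K" using compX by (intro compact_Times) auto
  then have "\<exists>d>0. \<forall>p\<in>?K. ?f p \<le> d \<longrightarrow> dist (?u p) (?v p) < \<eta>"
  proof (rule compact_small)
    show "continuous_on ?K ?f" by (intro continuous_intros continuous_on_flow continuous_on_F) auto
    show "continuous_on ?K (\<lambda>p. dist (?u p) (?v p))" by (intro continuous_intros continuous_on_flow) auto
    fix p assume p: "p \<in> ?K" "?f p \<le> 0"
    obtain z s t x y where pe: "p = ((z, s, t), (x, y))" by (metis prod.collapse)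
    have A: "x = y" "\<phi> s x \<in> sect z" "\<phi> t x \<in> sect z" "z \<in> X" "\<bar>t - s\<bar> \<le> a" "x \<in> X" using p assms(2) by (auto simp: pe sect_def)
    then have "\<phi> (t - s) (\<phi> s x) \<in> sect z" by simp
    then have "t - s = 0" using transversal A by blast
    then show "dist (?u p) (?v p) \<le> 0" using A(1) by (simp add: pe)
  qed (rule assms)
  then obtain d where d: "d > 0" "\<And>p. p \<in> ?K \<Longrightarrow> ?f p \<le> d \<Longrightarrow> dist (?u p) (?v p) < \<eta>" by blast
  have "dist (\<phi> s x) (\<phi> t y) < \<eta>" if "z \<in> X" "x \<in> X" "y \<in> X" "\<phi> s x \<in> sect z" "\<phi> t y \<in> sect z" "\<bar>s - 1\<bar> \<le> \<epsilon>" "\<bar>t - 1\<bar> \<le> \<epsilon>" "dist x y \<le> d" for z x y s t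
    using d(2)[of "((z, s, t), (x, y))"] that d(1) by (simp add: sect_def abs_le_iff)
  then show ?thesis using d(1) by blast
qed

text \<open>At \<open>y = z\<close> the clock is below \<open>F z z\<close> at time
  \<open>-h\<close> and above it at time \<open>h\<close>, with margin \<open>c * h\<close>. For
  \<open>y\<close> close to \<open>z\<close> both inequalities persist, and the intermediate value
  theorem gives a crossing in between.\<close>

lemma projection_exists:
  assumes "\<eta> > 0"
  shows "\<exists>\<rho>>0. \<forall>z\<in>X. \<forall>y\<in>X. dist z y \<le> \<rho> \<longrightarrow> (\<exists>s. \<bar>s\<bar> \<le> \<eta> \<and> \<phi> s y \<in> sect z \<and> dist z (\<phi> s y) \<le> \<eta>)"
proof -
  \<comment> \<open>One \<open>m\<close> for the distance from \<open>z\<close> to \<open>y\<close>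
    and one for the displacement up to the crossing keep the crossing point within both
    \<open>r\<close> and \<eta> of \<open>z\<close>.\<close>
  define m where "m = min r \<eta> / 2"
  have m: "m > 0" using rpos assms by (simp add: m_def)
  obtain \<kappa> where \<kappa>0: "\<kappa> > 0" and \<kappa>1: "flow_modulus 0 \<kappa> m"
    using flow_uniform[OF m] by blast
  note \<kappa> = \<kappa>0 flow_modulusD[OF \<kappa>1]
  define h where "h = min \<kappa> (min a \<eta>)"
  have h: "h > 0" "h \<le> \<kappa>" "h \<le> a" "h \<le> \<eta>" using \<kappa>(1) apos assms by (auto simp: h_def)
  have ch: "c * h > 0" using cpos h by simp
  let ?z = "fst :: 'a \<times> 'a \<Rightarrow> 'a" let ?y = "snd :: 'a \<times> 'a \<Rightarrow> 'a"
  have "\<exists>d>0. \<forall>p\<in>X \<times> X. dist (?z p) (?y p) \<le> d \<longrightarrow>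
     max (F (?z p) (?z p) + c * h - F (?z p) (\<phi> h (?y p))) (F (?z p) (\<phi> (-h) (?y p)) + c * h - F (?z p) (?z p)) < c * h"
  proof (rule compact_small[OF compact_Times[OF compX compX]])
    fix p assume p: "p \<in> X \<times> X" "dist (?z p) (?y p) \<le> 0"
    then obtain z where z: "p = (z, z)" "z \<in> X" by auto
    show "max (F (?z p) (?z p) + c * h - F (?z p) (\<phi> h (?y p))) (F (?z p) (\<phi> (-h) (?y p)) + c * h - F (?z p) (?z p)) \<le> 0"
      using incr[OF z(2) z(2), of 0 h] incr[OF z(2) z(2), of "-h" 0] h rpos z by simp
  next
    show "continuous_on (X \<times> X) (\<lambda>p. max (F (?z p) (?z p) + c * h - F (?z p) (\<phi> h (?y p))) (F (?z p) (\<phi> (-h) (?y p)) + c * h - F (?z p) (?z p)))"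
      by (intro continuous_intros continuous_on_flow continuous_on_F) auto
    show "continuous_on (X \<times> X) (\<lambda>p. dist (?z p) (?y p))" by (intro continuous_intros)
  qed (rule ch)
  then obtain d where d0: "d > 0" and d1: "\<forall>p\<in>X \<times> X. dist (?z p) (?y p) \<le> d \<longrightarrow>
     max (F (?z p) (?z p) + c * h - F (?z p) (\<phi> h (?y p))) (F (?z p) (\<phi> (-h) (?y p)) + c * h - F (?z p) (?z p)) < c * h"
    by (elim exE conjE)
  have "F z z < F z (\<phi> h y) \<and> F z (\<phi> (-h) y) < F z z" if "z \<in> X" "y \<in> X" "dist z y \<le> d" for z y
    using d1[rule_format, of "(z, y)"] that by simp
  note d = d0 this
  have "\<exists>s. \<bar>s\<bar> \<le> \<eta> \<and> \<phi> s y \<in> sect z \<and> dist z (\<phi> s y) \<le> \<eta>" if zy: "z \<in> X" "y \<in> X" "dist z y \<le> min d m" for z y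
  proof -
    have "\<exists>s\<ge>-h. s \<le> h \<and> F z (\<phi> s y) = F z z"
      using d(2)[of z y] zy h by (intro IVT' continuous_on_F continuous_on_flow continuous_intros) auto
    then obtain s where s: "- h \<le> s" "s \<le> h" "F z (\<phi> s y) = F z z" by blast
    have "dist y (\<phi> s y) < m" using \<kappa>(2)[of 0 s y y] s h \<kappa>(1) zy by simp
    then have "dist z (\<phi> s y) \<le> 2 * m" using zy(3) dist_triangle[of z "\<phi> s y" y] by simp
    then show ?thesis using s h zy by (intro exI[of _ s]) (auto simp: sect_def m_def)
  qed
  then show ?thesis using d(1) m by (intro exI[of _ "min d m"]) auto
qed

text \<open>A transfer of \<open>C\<close> into one section about one time unit later, with a
  transit time that may vary from point to point. The bound on the image supplies the distance
  clause of \<open>trk\<close>.\<close>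

definition step :: "real \<Rightarrow> 'a set \<Rightarrow> ('a \<Rightarrow> 'a) \<Rightarrow> bool" where
  "step \<epsilon> C g \<longleftrightarrow> continuous_on C g \<and> (\<exists>z\<in>X. \<forall>y\<in>C. g y \<in> sect z) \<and> (\<forall>y\<in>C. \<exists>s. \<bar>s - 1\<bar> \<le> \<epsilon> \<and> g y = \<phi> s y) \<and>
     (\<forall>x\<in>C. \<forall>y\<in>C. dist (g x) (g y) \<le> \<epsilon>)"

text \<open>The new section is taken at the time-one image of an arbitrary point of
  \<open>C\<close>; the time-one images of the other points are close to it and get projected.
  Continuity comes from \<open>step_modulus\<close>, not from the choice of the projection
  times.\<close>

lemma step_exists:
  assumes "\<epsilon> > 0" "2 * \<epsilon> \<le> a"
  shows "\<exists>\<rho>>0. \<forall>C\<subseteq>X. (\<forall>x\<in>C. \<forall>y\<in>C. dist x y \<le> \<rho>) \<and> C \<noteq> {} \<longrightarrow> (\<exists>g. step \<epsilon> C g)"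
proof -
  have "\<epsilon>/2 > 0" using assms by simp
  from projection_exists[OF this] obtain \<rho>0 where *: "\<rho>0 > 0 \<and> (\<forall>z\<in>X. \<forall>y\<in>X. dist z y \<le> \<rho>0 \<longrightarrow> (\<exists>s. \<bar>s\<bar> \<le> \<epsilon>/2 \<and> \<phi> s y \<in> sect z \<and> dist z (\<phi> s y) \<le> \<epsilon>/2))"
    by (rule exE)
  note \<rho>0 = *[THEN conjunct1] *[THEN conjunct2, rule_format]
  obtain \<rho> where \<rho>10: "\<rho> > 0" and \<rho>11: "flow_modulus 1 \<rho> \<rho>0"
    using flow_uniform[OF \<rho>0(1)] by blast
  note \<rho> = \<rho>10 flow_modulusD[OF \<rho>11]
  have "\<exists>g. step \<epsilon> C g" if C: "C \<subseteq> X" "\<And>x y. x \<in> C \<Longrightarrow> y \<in> C \<Longrightarrow> dist x y \<le> \<rho>" "C \<noteq> {}" for C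
  proof -
    obtain x0 where x0: "x0 \<in> C" using C(3) by blast
    define z where "z = \<phi> 1 x0"
    have z: "z \<in> X" using x0 C(1) by (auto simp: z_def)
    have "\<exists>s. \<bar>s\<bar> \<le> \<epsilon>/2 \<and> \<phi> s (\<phi> 1 y) \<in> sect z \<and> dist z (\<phi> s (\<phi> 1 y)) \<le> \<epsilon>/2" if y: "y \<in> C" for y
    proof -
      have yX: "y \<in> X" "x0 \<in> X" using y x0 C(1) by auto
      have "dist z (\<phi> 1 y) < \<rho>0" unfolding z_def using \<rho>(1) by (intro \<rho>(2) yX C(2) x0 y) auto
      then show ?thesis using \<rho>0(2)[of z "\<phi> 1 y"] z yX by simp
    qed
    then obtain \<sigma> where \<sigma>: "\<And>y. y \<in> C \<Longrightarrow> \<bar>\<sigma> y\<bar> \<le> \<epsilon>/2 \<and> \<phi> (\<sigma> y) (\<phi> 1 y) \<in> sect z \<and> dist z (\<phi> (\<sigma> y) (\<phi> 1 y)) \<le> \<epsilon>/2"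
      by metis
    define g where "g y = \<phi> (1 + \<sigma> y) y" for y
    have g: "\<bar>\<sigma> y\<bar> \<le> \<epsilon>/2" "g y \<in> sect z" "dist z (g y) \<le> \<epsilon>/2" if "y \<in> C" for y
      using \<sigma>[OF that] that C(1) by (auto simp: g_def)
    have "continuous_on C g"
      unfolding continuous_on_iff
    proof (intro ballI allI impI)
      fix x and e :: real assume x: "x \<in> C" "e > 0"
      obtain \<eta>' where \<eta>': "\<eta>' > 0" "\<forall>z x y s t. z \<in> X \<longrightarrow> x \<in> X \<longrightarrow> y \<in> X \<longrightarrow> \<phi> s x \<in> sect z \<longrightarrow> \<phi> t y \<in> sect z \<longrightarrow> \<bar>s - 1\<bar> \<le> \<epsilon> \<longrightarrow> \<bar>t - 1\<bar> \<le> \<epsilon> \<longrightarrow>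
        dist x y \<le> \<eta>' \<longrightarrow> dist (\<phi> s x) (\<phi> t y) < e" using step_modulus[OF x(2) assms(2)] by blast
      have "dist (g y) (g x) < e" if y: "y \<in> C" "dist y x < \<eta>'" for y
        using \<eta>'(2)[rule_format, of z y x "1 + \<sigma> y" "1 + \<sigma> x"] g[OF x(1)] g[OF y(1)] y x C(1) z assms(1) by (auto simp: g_def)
      then show "\<exists>d>0. \<forall>y\<in>C. dist y x < d \<longrightarrow> dist (g y) (g x) < e" using \<eta>'(1) by blast
    qed
    moreover have "\<exists>s. \<bar>s - 1\<bar> \<le> \<epsilon> \<and> g y = \<phi> s y" if "y \<in> C" for y
      using g(1)[OF that] assms(1) by (intro exI[of _ "1 + \<sigma> y"]) (auto simp: g_def)
    moreover have "dist (g x) (g y) \<le> \<epsilon>" if "x \<in> C" "y \<in> C" for x y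
      using g(3)[OF that(1)] g(3)[OF that(2)] dist_triangle2[of "g x" "g y" z] by (simp add: dist_commute)
    moreover have "\<exists>z\<in>X. \<forall>y\<in>C. g y \<in> sect z" using g(2) z by (intro bexI[of _ z] ballI)
    ultimately have "step \<epsilon> C g" unfolding step_def by (intro conjI ballI)
    then show ?thesis by blast
  qed
  note main = this
  show ?thesis
  proof (intro exI[of _ \<rho>] conjI allI impI, rule \<rho>(1))
    fix C assume "C \<subseteq> X" and C: "(\<forall>x\<in>C. \<forall>y\<in>C. dist x y \<le> \<rho>) \<and> C \<noteq> {}"
    show "\<exists>g. step \<epsilon> C g"
      by (rule main[OF \<open>C \<subseteq> X\<close> C[THEN conjunct1, rule_format] C[THEN conjunct2]])
  qed
qed

end

text \<open>Instead of a reparametrization \<open>h\<close>, each step moves both points by times within \<open>\<epsilon>\<close> of \<open>1\<close>. This makes the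
  finite-time relations closed and compatible with moving the points from section to section.\<close>

primrec trk :: "(real \<Rightarrow> 'a \<Rightarrow> 'a::metric_space) \<Rightarrow> real \<Rightarrow> nat \<Rightarrow> 'a \<Rightarrow> 'a \<Rightarrow> bool" where
  "trk \<phi> \<epsilon> 0 x y \<longleftrightarrow> dist x y \<le> \<epsilon>"
| "trk \<phi> \<epsilon> (Suc n) x y \<longleftrightarrow> dist x y \<le> \<epsilon> \<and> (\<exists>s t. \<bar>s - 1\<bar> \<le> \<epsilon> \<and> \<bar>t - 1\<bar> \<le> \<epsilon> \<and> trk \<phi> \<epsilon> n (\<phi> s x) (\<phi> t y))"

lemma trk_dist: "trk \<phi> \<epsilon> n x y \<Longrightarrow> dist x y \<le> \<epsilon>"
  by (cases n) (simp_all only: trk.simps)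

lemma trk_Suc: "trk \<phi> \<epsilon> (Suc n) x y \<Longrightarrow> trk \<phi> \<epsilon> n x y"
proof (induction n arbitrary: x y)
  case 0
  then show ?case by (simp only: trk.simps)
next
  case (Suc n)
  from Suc.prems obtain s t where "dist x y \<le> \<epsilon>" "\<bar>s - 1\<bar> \<le> \<epsilon>" "\<bar>t - 1\<bar> \<le> \<epsilon>" "trk \<phi> \<epsilon> (Suc n) (\<phi> s x) (\<phi> t y)"
    by (subst (asm) trk.simps(2)) blast
  then show ?case using Suc.IH[of "\<phi> s x" "\<phi> t y"] by (subst trk.simps(2)) blast
qed

lemma trk_mono:
  assumes "m \<le> n" "trk \<phi> \<epsilon> n x y" shows "trk \<phi> \<epsilon> m x y"
proof -
  have "trk \<phi> \<epsilon> n x y \<longrightarrow> trk \<phi> \<epsilon> m x y"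
    using assms(1) by (induction n rule: dec_induct) (use trk_Suc in blast)+
  then show ?thesis using assms(2) by blast
qed

context compact_flow
begin

text \<open>The transit times of one step range over a compact square, so each induction step
  projects a compact set.\<close>

lemma closed_trk: "closed {(x, y) \<in> X \<times> X. trk \<phi> \<epsilon> n x y}"
proof (induction n)
  case 0
  have "closed ((X \<times> X) \<inter> (\<lambda>p. dist (fst p) (snd p)) -` {..\<epsilon>})"
    using compX by (intro continuous_closed_preimage continuous_intros closed_Times) (auto simp: compact_imp_closed)
  also have "(X \<times> X) \<inter> (\<lambda>p. dist (fst p) (snd p)) -` {..\<epsilon>} = {(x, y) \<in> X \<times> X. trk \<phi> \<epsilon> 0 x y}" by auto
  finally show ?case .
next
  case (Suc n)
  let ?T = "{(x, y) \<in> X \<times> X. trk \<phi> \<epsilon> n x y}"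
  let ?I = "{1-\<epsilon>..1+\<epsilon>}"
  let ?K = "(X \<times> X) \<times> (?I \<times> ?I)"
  let ?g = "\<lambda>p. (\<phi> (fst (snd p)) (fst (fst p)), \<phi> (snd (snd p)) (snd (fst p)))"
  have K: "compact ?K" using compX by (intro compact_Times) auto
  have "closed (?K \<inter> ?g -` ?T)"
    using K Suc by (intro continuous_closed_preimage continuous_intros continuous_on_flow) (auto simp: compact_imp_closed)
  then have "compact (?K \<inter> ?g -` ?T)" by (rule compact_Int_of_closed[OF K])
  then have "compact (fst ` (?K \<inter> ?g -` ?T))" by (intro compact_continuous_image continuous_intros)
  then have "closed (fst ` (?K \<inter> ?g -` ?T))" by (rule compact_imp_closed)
  moreover have "closed ((X \<times> X) \<inter> (\<lambda>p. dist (fst p) (snd p)) -` {..\<epsilon>})"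
    using compX by (intro continuous_closed_preimage continuous_intros closed_Times) (auto simp: compact_imp_closed)
  ultimately have "closed (fst ` (?K \<inter> ?g -` ?T) \<inter> ((X \<times> X) \<inter> (\<lambda>p. dist (fst p) (snd p)) -` {..\<epsilon>}))" by (rule closed_Int)
  also have "fst ` (?K \<inter> ?g -` ?T) \<inter> ((X \<times> X) \<inter> (\<lambda>p. dist (fst p) (snd p)) -` {..\<epsilon>}) = {(x, y) \<in> X \<times> X. trk \<phi> \<epsilon> (Suc n) x y}"
  proof (intro equalityI subsetI)
    fix p assume p: "p \<in> {(x, y) \<in> X \<times> X. trk \<phi> \<epsilon> (Suc n) x y}"
    then obtain x y s t where A: "p = (x, y)" "x \<in> X" "y \<in> X" "dist x y \<le> \<epsilon>" "\<bar>s - 1\<bar> \<le> \<epsilon>" "\<bar>t - 1\<bar> \<le> \<epsilon>" "trk \<phi> \<epsilon> n (\<phi> s x) (\<phi> t y)"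
      by auto
    then have "s \<in> ?I" "t \<in> ?I" by (auto simp: abs_le_iff)
    then have "((x, y), (s, t)) \<in> ?K \<inter> ?g -` ?T" using A by simp
    then have "p \<in> fst ` (?K \<inter> ?g -` ?T)" by (rule image_eqI[rotated]) (simp add: A(1))
    then show "p \<in> fst ` (?K \<inter> ?g -` ?T) \<inter> ((X \<times> X) \<inter> (\<lambda>p. dist (fst p) (snd p)) -` {..\<epsilon>})"
      using A(1-4) by simp
  next
    fix p assume "p \<in> fst ` (?K \<inter> ?g -` ?T) \<inter> ((X \<times> X) \<inter> (\<lambda>p. dist (fst p) (snd p)) -` {..\<epsilon>})"
    then obtain q where q: "q \<in> ?K \<inter> ?g -` ?T" "p = fst q" "dist (fst p) (snd p) \<le> \<epsilon>" by auto
    obtain x y s t where qe: "q = ((x, y), (s, t))" by (metis prod.collapse)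
    have A: "p = (x, y)" "x \<in> X" "y \<in> X" "dist x y \<le> \<epsilon>" "s \<in> ?I" "t \<in> ?I" "trk \<phi> \<epsilon> n (\<phi> s x) (\<phi> t y)"
      using q by (simp_all add: qe)
    then have "\<bar>s - 1\<bar> \<le> \<epsilon>" "\<bar>t - 1\<bar> \<le> \<epsilon>" by (auto simp: abs_le_iff)
    then show "p \<in> {(x, y) \<in> X \<times> X. trk \<phi> \<epsilon> (Suc n) x y}" using A by auto
  qed
  finally show ?case .
qed

lemma trk_limit:
  assumes "\<xi> \<longlonglongrightarrow> x" "\<zeta> \<longlonglongrightarrow> y" "\<And>k. \<xi> k \<in> X" "\<And>k. \<zeta> k \<in> X" "\<And>k. k \<ge> N \<Longrightarrow> trk \<phi> \<epsilon> n (\<xi> k) (\<zeta> k)"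
  shows "trk \<phi> \<epsilon> n x y"
proof -
  have lim: "(\<lambda>k. (\<xi> (k + N), \<zeta> (k + N))) \<longlonglongrightarrow> (x, y)" using assms(1,2) by (intro tendsto_Pair LIMSEQ_ignore_initial_segment)
  have "(x, y) \<in> {(x, y) \<in> X \<times> X. trk \<phi> \<epsilon> n x y}"
    by (rule closed_sequentially[OF closed_trk _ lim]) (simp add: assms(3-5))
  then show ?thesis by simp
qed

text \<open>Each horizon may come with its own initial step. A limit of these steps serves all
  horizons at once, because tracking up to a longer horizon implies tracking up to a shorter one and
  every finite relation is closed.\<close>

lemma trk_all_step:
  assumes "\<And>n. trk \<phi> \<epsilon> n x y" "x \<in> X" "y \<in> X"
  shows "\<exists>s t. \<bar>s - 1\<bar> \<le> \<epsilon> \<and> \<bar>t - 1\<bar> \<le> \<epsilon> \<and> (\<forall>n. trk \<phi> \<epsilon> n (\<phi> s x) (\<phi> t y))"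
proof -
  have "\<exists>s t. \<bar>s - 1\<bar> \<le> \<epsilon> \<and> \<bar>t - 1\<bar> \<le> \<epsilon> \<and> trk \<phi> \<epsilon> n (\<phi> s x) (\<phi> t y)" for n
    using assms(1)[of "Suc n"] by simp
  then obtain s t where st: "\<And>n. \<bar>s n - 1\<bar> \<le> \<epsilon>" "\<And>n. \<bar>t n - 1\<bar> \<le> \<epsilon>" "\<And>n. trk \<phi> \<epsilon> n (\<phi> (s n) x) (\<phi> (t n) y)" by metis
  have I: "\<forall>n. (s n, t n) \<in> {1-\<epsilon>..1+\<epsilon>} \<times> {1-\<epsilon>..1+\<epsilon>}" using st(1,2) by (simp add: abs_le_iff algebra_simps)
  have "compact ({1-\<epsilon>..1+\<epsilon>} \<times> {1-\<epsilon>..1+\<epsilon>})" by (intro compact_Times compact_Icc)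
  then obtain q k where q: "q \<in> {1-\<epsilon>..1+\<epsilon>} \<times> {1-\<epsilon>..1+\<epsilon>}" "strict_mono (k::nat\<Rightarrow>nat)" "((\<lambda>n. (s n, t n)) \<circ> k) \<longlonglongrightarrow> q"
    using I by (rule compactE_subseq)
  obtain s' t' where qe: "q = (s', t')" by (metis prod.collapse)
  have lim: "(\<lambda>n. s (k n)) \<longlonglongrightarrow> s'" "(\<lambda>n. t (k n)) \<longlonglongrightarrow> t'"
    using tendsto_fst[OF q(3)] tendsto_snd[OF q(3)] by (auto simp: qe o_def)
  have "trk \<phi> \<epsilon> n (\<phi> s' x) (\<phi> t' y)" for n
  proof (rule trk_limit)
    show "(\<lambda>n. \<phi> (s (k n)) x) \<longlonglongrightarrow> \<phi> s' x" "(\<lambda>n. \<phi> (t (k n)) y) \<longlonglongrightarrow> \<phi> t' y"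
      using lim assms(2,3) by (auto intro!: tendsto_flow)
    fix i assume "n \<le> i"
    then have "n \<le> k i" using seq_suble[OF q(2), of i] by linarith
    then show "trk \<phi> \<epsilon> n (\<phi> (s (k i)) x) (\<phi> (t (k i)) y)" using st(3)[of "k i"] by (rule trk_mono)
  qed (simp_all add: assms(2,3))
  then have "\<forall>n. trk \<phi> \<epsilon> n (\<phi> s' x) (\<phi> t' y)" by (rule allI)
  moreover have "\<bar>s' - 1\<bar> \<le> \<epsilon>" "\<bar>t' - 1\<bar> \<le> \<epsilon>" using q(1) by (auto simp: qe abs_le_iff)
  ultimately show ?thesis by blast
qed

lemma trk_all_sequence:
  assumes "\<And>n. trk \<phi> \<epsilon> n x y" "x \<in> X" "y \<in> X"
  obtains a b :: "nat \<Rightarrow> real" where "a 0 = 0" "b 0 = 0" "\<forall>n. \<bar>a (Suc n) - a n - 1\<bar> \<le> \<epsilon>"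
    "\<forall>n. \<bar>b (Suc n) - b n - 1\<bar> \<le> \<epsilon>" "\<forall>n. dist (\<phi> (a n) x) (\<phi> (b n) y) \<le> \<epsilon>"
proof -
  let ?P = "\<lambda>q. \<forall>m. trk \<phi> \<epsilon> m (\<phi> (fst q) x) (\<phi> (snd q) y)"
  \<comment> \<open>The clause for \<open>n = 0\<close> pins the start of the chain to
    \<open>(0, 0)\<close>.\<close>
  have "\<exists>f :: nat \<Rightarrow> real \<times> real. \<forall>n. (?P (f n) \<and> (n = 0 \<longrightarrow> f n = (0, 0))) \<and> (\<bar>fst (f (Suc n)) - fst (f n) - 1\<bar> \<le> \<epsilon> \<and> \<bar>snd (f (Suc n)) - snd (f n) - 1\<bar> \<le> \<epsilon>)"
  proof (rule dependent_nat_choice)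
    show "\<exists>q. ?P q \<and> ((0::nat) = 0 \<longrightarrow> q = (0, 0))" using assms by (intro exI[of _ "(0, 0)"]) simp
    fix q :: "real \<times> real" and n :: nat assume q: "?P q \<and> (n = 0 \<longrightarrow> q = (0, 0))"
    obtain s t where st: "\<bar>s - 1\<bar> \<le> \<epsilon>" "\<bar>t - 1\<bar> \<le> \<epsilon>" "\<forall>n. trk \<phi> \<epsilon> n (\<phi> s (\<phi> (fst q) x)) (\<phi> t (\<phi> (snd q) y))"
      using trk_all_step[of \<epsilon> "\<phi> (fst q) x" "\<phi> (snd q) y", OF q[THEN conjunct1, rule_format]] assms(2,3) flow_in by blast
    then show "\<exists>q'. (?P q' \<and> (Suc n = 0 \<longrightarrow> q' = (0, 0))) \<and> (\<bar>fst q' - fst q - 1\<bar> \<le> \<epsilon> \<and> \<bar>snd q' - snd q - 1\<bar> \<le> \<epsilon>)"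
      using assms(2,3) by (intro exI[of _ "(fst q + s, snd q + t)"]) simp
  qed
  then obtain f :: "nat \<Rightarrow> real \<times> real" where f: "\<forall>n. (?P (f n) \<and> (n = 0 \<longrightarrow> f n = (0, 0))) \<and> (\<bar>fst (f (Suc n)) - fst (f n) - 1\<bar> \<le> \<epsilon> \<and> \<bar>snd (f (Suc n)) - snd (f n) - 1\<bar> \<le> \<epsilon>)"
    by (rule exE)
  have "dist (\<phi> (fst (f n)) x) (\<phi> (snd (f n)) y) \<le> \<epsilon>" for n
    using f[rule_format, of n] trk_dist[of \<phi> \<epsilon> 0] by blast
  then show ?thesis using f by (intro that[of "\<lambda>n. fst (f n)" "\<lambda>n. snd (f n)"]) simp_all
qed

text \<open>The forward chain and the negated backward chain join at 0 to node times indexed by all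
  integers, to which \<open>expansive_nodes\<close> applies. With
  \<open>\<epsilon> \<le> \<kappa>/2 \<le> 1/2\<close> the gaps lie between 1/2 and 2, and matched
  gaps differ by at most \<kappa>.\<close>

lemma expansive_trk:
  assumes exp: "expansive_flow X \<phi>" and "\<mu> > 0"
  shows "\<exists>\<epsilon>0>0. \<forall>\<epsilon>\<le>\<epsilon>0. \<forall>x\<in>X. \<forall>y\<in>X. (\<forall>n. trk \<phi> \<epsilon> n x y) \<and> (\<forall>n. trk (\<lambda>t. \<phi> (- t)) \<epsilon> n x y) \<longrightarrow> (\<exists>s. \<bar>s\<bar> \<le> \<mu> \<and> y = \<phi> s x)"
proof -
  obtain \<kappa> where \<kappa>: "\<kappa> > 0" "\<kappa> \<le> 1" and nodes: "\<forall>x\<in>X. \<forall>y\<in>X. \<forall>(a::int\<Rightarrow>real) b c. a 0 = 0 \<and> b 0 = 0 \<and> c > 0 \<and>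
      (\<forall>n. a n + c \<le> a (n + 1) \<and> a (n + 1) \<le> a n + 2 \<and> b n + c \<le> b (n + 1) \<and>
           \<bar>(a (n + 1) - a n) - (b (n + 1) - b n)\<bar> \<le> \<kappa> \<and> dist (\<phi> (a n) x) (\<phi> (b n) y) \<le> \<kappa>)
      \<longrightarrow> (\<exists>s. \<bar>s\<bar> \<le> \<mu> \<and> y = \<phi> s x)"
    using expansive_nodes[OF assms, of 2] by (elim exE conjE)
  interpret rev: compact_flow X "\<lambda>t. \<phi> (- t)" by unfold_locales (rule compX is_flow_reverse[OF flow])+
  have "\<exists>s. \<bar>s\<bar> \<le> \<mu> \<and> y = \<phi> s x" if \<epsilon>: "\<epsilon> \<le> \<kappa>/2" and xy: "x \<in> X" "y \<in> X" and fw: "\<forall>n. trk \<phi> \<epsilon> n x y" and bw: "\<forall>n. trk (\<lambda>t. \<phi> (- t)) \<epsilon> n x y" for \<epsilon> x y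
  proof -
    obtain a b :: "nat \<Rightarrow> real" where ab: "a 0 = 0" "b 0 = 0" "\<forall>n. \<bar>a (Suc n) - a n - 1\<bar> \<le> \<epsilon>" "\<forall>n. \<bar>b (Suc n) - b n - 1\<bar> \<le> \<epsilon>" "\<forall>n. dist (\<phi> (a n) x) (\<phi> (b n) y) \<le> \<epsilon>"
      by (rule trk_all_sequence[OF fw[rule_format] xy]) (rule that)
    obtain a' b' :: "nat \<Rightarrow> real" where ab': "a' 0 = 0" "b' 0 = 0" "\<forall>n. \<bar>a' (Suc n) - a' n - 1\<bar> \<le> \<epsilon>" "\<forall>n. \<bar>b' (Suc n) - b' n - 1\<bar> \<le> \<epsilon>" "\<forall>n. dist (\<phi> (- a' n) x) (\<phi> (- b' n) y) \<le> \<epsilon>"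
      by (rule rev.trk_all_sequence[OF bw[rule_format] xy]) (rule that)
    define A where "A n = (if n \<ge> 0 then a (nat n) else - a' (nat (- n)))" for n :: int
    define B where "B n = (if n \<ge> 0 then b (nat n) else - b' (nat (- n)))" for n :: int
    have gaps: "\<bar>A (n + 1) - A n - 1\<bar> \<le> \<epsilon>" "\<bar>B (n + 1) - B n - 1\<bar> \<le> \<epsilon>" for n
    proof -
      consider "n \<ge> 0" | "n < 0" by linarith
      then have "\<bar>A (n + 1) - A n - 1\<bar> \<le> \<epsilon> \<and> \<bar>B (n + 1) - B n - 1\<bar> \<le> \<epsilon>"
      proof cases
        case 1
        then have "nat (n + 1) = Suc (nat n)" by simp
        then show ?thesis using 1 ab(3,4)[rule_format, of "nat n"] by (simp add: A_def B_def)
      next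
        case 2
        define m where "m = nat (- n - 1)"
        have m: "nat (- n) = Suc m" using 2 by (simp add: m_def)
        have "A (n + 1) = - a' m \<and> B (n + 1) = - b' m"
        proof (cases "n = -1")
          case True
          then show ?thesis using ab(1,2) ab'(1,2) by (simp add: A_def B_def m_def)
        next
          case False
          then have "nat (- (n + 1)) = m" "\<not> 0 \<le> n + 1" using 2 by (auto simp: m_def)
          then show ?thesis by (simp only: A_def B_def if_False)
        qed
        then show ?thesis using 2 m ab'(3,4)[rule_format, of m] by (simp add: A_def B_def)
      qed
      then show "\<bar>A (n + 1) - A n - 1\<bar> \<le> \<epsilon>" "\<bar>B (n + 1) - B n - 1\<bar> \<le> \<epsilon>" by auto
    qed
    have "A 0 = 0 \<and> B 0 = 0 \<and> 1/2 > (0::real) \<and> (\<forall>n. A n + 1/2 \<le> A (n + 1) \<and> A (n + 1) \<le> A n + 2 \<and> B n + 1/2 \<le> B (n + 1) \<and>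
           \<bar>(A (n + 1) - A n) - (B (n + 1) - B n)\<bar> \<le> \<kappa> \<and> dist (\<phi> (A n) x) (\<phi> (B n) y) \<le> \<kappa>)"
    proof (intro conjI allI)
      fix n
      have g: "- \<epsilon> \<le> A (n + 1) - A n - 1" "A (n + 1) - A n - 1 \<le> \<epsilon>" "- \<epsilon> \<le> B (n + 1) - B n - 1" "B (n + 1) - B n - 1 \<le> \<epsilon>"
        using gaps[of n] by (auto simp: abs_le_iff)
      show "A n + 1/2 \<le> A (n + 1)" "A (n + 1) \<le> A n + 2" "B n + 1/2 \<le> B (n + 1)" using g \<epsilon> \<kappa> by linarith+
      show "\<bar>(A (n + 1) - A n) - (B (n + 1) - B n)\<bar> \<le> \<kappa>" using g \<epsilon> \<kappa> by linarith
      have "dist (\<phi> (A n) x) (\<phi> (B n) y) \<le> \<epsilon>"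
        using ab(5)[rule_format, of "nat n"] ab'(5)[rule_format, of "nat (- n)"] by (cases "0 \<le> n") (simp_all add: A_def B_def)
      then show "dist (\<phi> (A n) x) (\<phi> (B n) y) \<le> \<kappa>" using \<epsilon> \<kappa> by linarith
    qed (simp_all add: A_def B_def ab(1,2))
    then show ?thesis by (rule nodes[rule_format, OF xy, of A B "1/2"])
  qed
  note main = this
  show ?thesis
  proof (rule exI[of _ "\<kappa>/2"], intro conjI allI impI ballI)
    show "\<kappa>/2 > 0" using \<kappa>(1) by simp
    fix \<epsilon> x y assume "\<epsilon> \<le> \<kappa>/2" "x \<in> X" "y \<in> X" "(\<forall>n. trk \<phi> \<epsilon> n x y) \<and> (\<forall>n. trk (\<lambda>t. \<phi> (- t)) \<epsilon> n x y)"
    then show "\<exists>s. \<bar>s\<bar> \<le> \<mu> \<and> y = \<phi> s x" by (intro main) auto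
  qed
qed

end

section \<open>Growth of continua in local sections\<close>

text \<open>Sections depend upper semicontinuously on their base point, because the conditions
  defining them are closed jointly in both points.\<close>

lemma (in sectioned_flow) sect_limit:
  assumes "\<zeta> \<longlonglongrightarrow> z" "\<xi> \<longlonglongrightarrow> x" "\<And>k. \<zeta> k \<in> X" "\<And>k. \<xi> k \<in> sect (\<zeta> k)"
  shows "x \<in> sect z"
proof -
  have X: "\<xi> k \<in> X" for k using assms(4) sect_sub by blast
  have zX: "z \<in> X" by (rule closed_sequentially[OF compact_imp_closed[OF compX] _ assms(1)]) (simp add: assms)
  have xX: "x \<in> X" by (rule closed_sequentially[OF compact_imp_closed[OF compX] _ assms(2)]) (simp add: X)
  have "(\<lambda>k. dist (\<zeta> k) (\<xi> k)) \<longlonglongrightarrow> dist z x" by (intro tendsto_dist assms)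
  moreover have "dist (\<zeta> k) (\<xi> k) \<le> r" for k using assms(4)[of k] by (simp add: sect_def)
  ultimately have "dist z x \<le> r" by (intro LIMSEQ_le_const2[where a = r]) auto
  moreover have lF: "(\<lambda>k. F (\<zeta> k) (\<theta> k)) \<longlonglongrightarrow> F z y" if "\<theta> \<longlonglongrightarrow> y" "\<And>k. \<theta> k \<in> X" "y \<in> X" for \<theta> y
  proof -
    have "(\<lambda>k. (\<lambda>(z, y). F z y) (\<zeta> k, \<theta> k)) \<longlonglongrightarrow> (\<lambda>(z, y). F z y) (z, y)"
      by (rule continuous_on_tendsto_compose[OF contF]) (use that assms zX in \<open>auto intro!: tendsto_Pair\<close>)
    then show ?thesis by simp
  qed
  have "F (\<zeta> k) (\<xi> k) = F (\<zeta> k) (\<zeta> k)" for k using assms(4)[of k] by (simp add: sect_def)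
  then have "(\<lambda>k. F (\<zeta> k) (\<zeta> k)) \<longlonglongrightarrow> F z x" using lF[OF assms(2) X xX] by simp
  then have "F z x = F z z" using lF[OF assms(1,3) zX] LIMSEQ_unique by blast
  ultimately show ?thesis using xX by (simp add: sect_def)
qed

text \<open>\<epsilon> is the slack of tracking and of transit times:
  \<open>2 * \<epsilon> \<le> a\<close> makes the transit time of a point into a given section
  unique, \<open>\<epsilon> \<le> 1/2\<close> keeps it at least 1/2. Sets of diameter at most \<rho>
  can be transferred. The displacement in \<open>expd\<close> is at most \<open>a\<close>, so for
  two points of one section it must vanish.\<close>

locale growth_flow = sectioned_flow X \<phi> F r a c for X :: "'a::metric_space set" and \<phi> F r a c +
  fixes \<epsilon> \<rho> :: real
  assumes eps: "0 < \<epsilon>" "2 * \<epsilon> \<le> a" "\<epsilon> \<le> 1/2"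
    and rho: "0 < \<rho>" "\<rho> \<le> \<epsilon>"
    and stepex: "\<And>C. C \<subseteq> X \<Longrightarrow> \<forall>x\<in>C. \<forall>y\<in>C. dist x y \<le> \<rho> \<Longrightarrow> C \<noteq> {} \<Longrightarrow> \<exists>g. step \<epsilon> C g"
    and expd: "\<And>x y. x \<in> X \<Longrightarrow> y \<in> X \<Longrightarrow> \<forall>n. trk \<phi> \<epsilon> n x y \<Longrightarrow> \<forall>n. trk (\<lambda>t. \<phi> (- t)) \<epsilon> n x y \<Longrightarrow> \<exists>s. \<bar>s\<bar> \<le> a \<and> y = \<phi> s x"
begin

sublocale rev: compact_flow X "\<lambda>t. \<phi> (- t)"
  by unfold_locales (rule compX is_flow_reverse[OF flow])+

abbreviation bwd :: "nat \<Rightarrow> 'a \<Rightarrow> 'a \<Rightarrow> bool" where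
  "bwd \<equiv> trk (\<lambda>t. \<phi> (- t)) \<epsilon>"

definition flat :: "'a set \<Rightarrow> bool" where
  "flat C \<longleftrightarrow> (\<exists>z\<in>X. \<forall>x\<in>C. x \<in> sect z)"

definition small :: "'a set \<Rightarrow> bool" where
  "small C \<longleftrightarrow> (\<forall>x\<in>C. \<forall>y\<in>C. dist x y \<le> \<rho>)"

text \<open>Backward tracking of all pairs at every horizon is inherited by subcontinua and by
  forward transfers; since two-sided tracking is excluded for distinct points of a section, only
  forward tracking can fail.\<close>

definition good :: "'a set \<Rightarrow> bool" where
  "good D \<longleftrightarrow> compact D \<and> connected D \<and> D \<subseteq> X \<and> flat D \<and> (\<forall>x\<in>D. \<forall>y\<in>D. \<forall>n. bwd n x y)"

text \<open>\<open>G\<close> is a composition of \<open>n\<close> transfers. A further transfer is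
  allowed only from a small image, so the first image that is not small ends the process.\<close>

inductive mv :: "'a set \<Rightarrow> nat \<Rightarrow> ('a \<Rightarrow> 'a) \<Rightarrow> bool" for D where
  mv_0: "mv D 0 (\<lambda>y. y)"
| mv_Suc: "mv D n G \<Longrightarrow> small (G ` D) \<Longrightarrow> step \<epsilon> (G ` D) g \<Longrightarrow> mv D (Suc n) (\<lambda>y. g (G y))"

lemma flat_subset: "flat C \<Longrightarrow> D \<subseteq> C \<Longrightarrow> flat D"
  by (auto simp: flat_def)

lemma step_time:
  assumes "step \<epsilon> C g" "y \<in> C"
  shows "\<exists>s. \<bar>s - 1\<bar> \<le> \<epsilon> \<and> g y = \<phi> s y"
  using assms by (simp add: step_def)

lemma mv_in: "mv D n G \<Longrightarrow> D \<subseteq> X \<Longrightarrow> y \<in> D \<Longrightarrow> G y \<in> X"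
proof (induction rule: mv.induct)
  case (mv_Suc n G g)
  then have "G y \<in> G ` D" "G y \<in> X" by auto
  then show ?case using step_time[OF mv_Suc.hyps(3), of "G y"] by auto
qed auto

lemma mv_cont: "mv D n G \<Longrightarrow> continuous_on D G"
proof (induction rule: mv.induct)
  case (mv_Suc n G g)
  have "continuous_on (G ` D) g" using mv_Suc.hyps(3) by (simp add: step_def)
  then show ?case using continuous_on_compose[OF mv_Suc.IH] by (simp add: o_def)
qed auto

lemma mv_flat: "mv D n G \<Longrightarrow> flat D \<Longrightarrow> flat (G ` D)"
proof (induction rule: mv.induct)
  case (mv_Suc n G g)
  then show ?case by (auto simp: step_def flat_def)
qed auto

text \<open>The lower bound makes every round of the construction consume a definite amount of time,
  and the upper one limits how many time slots a round can meet.\<close>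

lemma mv_time: "mv D n G \<Longrightarrow> D \<subseteq> X \<Longrightarrow> y \<in> D \<Longrightarrow> \<exists>t. real n / 2 \<le> t \<and> t \<le> 2 * real n \<and> G y = \<phi> t y"
proof (induction rule: mv.induct)
  case mv_0
  then show ?case by (intro exI[of _ 0]) auto
next
  case (mv_Suc n G g)
  then obtain t where t: "real n / 2 \<le> t" "t \<le> 2 * real n" "G y = \<phi> t y" by blast
  obtain s where s: "\<bar>s - 1\<bar> \<le> \<epsilon>" "g (G y) = \<phi> s (G y)"
    using step_time[OF mv_Suc.hyps(3), of "G y"] mv_Suc.prems by blast
  have "1/2 \<le> s" "s \<le> 2" using s(1) eps(3) by (auto simp: abs_le_iff)
  moreover have "g (G y) = \<phi> (t + s) y" using s(2) t(3) mv_Suc.prems by auto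
  ultimately show ?case using t(1,2) by (intro exI[of _ "t + s"]) auto
qed

lemma step_bwd:
  assumes "step \<epsilon> C g" "C \<subseteq> X" "x \<in> C" "y \<in> C" "bwd n x y"
  shows "bwd (Suc n) (g x) (g y)"
proof -
  obtain s where s: "\<bar>s - 1\<bar> \<le> \<epsilon>" "g x = \<phi> s x" using step_time[OF assms(1,3)] by blast
  obtain t where t: "\<bar>t - 1\<bar> \<le> \<epsilon>" "g y = \<phi> t y" using step_time[OF assms(1,4)] by blast
  have "dist (g x) (g y) \<le> \<epsilon>" using assms by (simp add: step_def)
  moreover have "\<phi> (- s) (g x) = x" "\<phi> (- t) (g y) = y" using s t assms by auto
  ultimately show ?thesis using s(1) t(1) assms(5) by (subst trk.simps(2)) metis
qed

text \<open>Undoing the transfers tracks the images backwards for \<open>n\<close> steps, provided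
  only that the initial set has diameter at most \<epsilon>. This creates the backward tracking that
  a limit of grown continua inherits.\<close>

lemma mv_bwd:
  assumes "mv D n G" "D \<subseteq> X" "\<forall>x\<in>D. \<forall>y\<in>D. dist x y \<le> \<epsilon>" "x \<in> D" "y \<in> D"
  shows "bwd n (G x) (G y)"
  using assms
proof (induction rule: mv.induct)
  case (mv_Suc n G g)
  then show ?case using mv_in[OF mv_Suc.hyps(1)] by (intro step_bwd[OF mv_Suc.hyps(3)]) auto
qed auto

lemma mv_bwd_all:
  assumes "mv D n G" "D \<subseteq> X" "\<forall>x\<in>D. \<forall>y\<in>D. \<forall>n. bwd n x y" "x \<in> D" "y \<in> D"
  shows "bwd k (G x) (G y)"
  using assms
proof (induction arbitrary: k rule: mv.induct)
  case (mv_Suc n G g)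
  have "bwd (Suc k) (g (G x)) (g (G y))"
    using mv_in[OF mv_Suc.hyps(1)] mv_Suc.prems mv_Suc.IH[OF mv_Suc.prems] by (intro step_bwd[OF mv_Suc.hyps(3)]) auto
  then show ?case by (rule trk_Suc)
qed auto

lemma mv_good:
  assumes "mv D n G" "good D"
  shows "good (G ` D)"
proof -
  have D: "compact D" "connected D" "D \<subseteq> X" "flat D" "\<forall>x\<in>D. \<forall>y\<in>D. \<forall>n. bwd n x y"
    using assms(2) by (auto simp: good_def)
  have "compact (G ` D)" "connected (G ` D)"
    using mv_cont[OF assms(1)] D by (auto intro: compact_continuous_image connected_continuous_image)
  moreover have "G ` D \<subseteq> X" using mv_in[OF assms(1) D(3)] by auto
  moreover have "\<forall>x\<in>G ` D. \<forall>y\<in>G ` D. \<forall>n. bwd n x y" using mv_bwd_all[OF assms(1) D(3,5)] by blast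
  ultimately show ?thesis using mv_flat[OF assms(1) D(4)] by (simp add: good_def)
qed

text \<open>A composition of at most \<open>N\<close> maps that share one modulus by
  \<open>step_modulus\<close>. It keeps obstacles thin under transfer, and it shows that a tiny
  continuum needs many transfers to grow.\<close>

lemma mv_modulus:
  assumes "\<eta> > 0"
  shows "\<exists>\<eta>'>0. \<forall>m\<le>N. \<forall>D G x y. D \<subseteq> X \<and> mv D m G \<and> x \<in> D \<and> y \<in> D \<and> dist x y \<le> \<eta>' \<longrightarrow> dist (G x) (G y) < \<eta>"
  using assms
proof (induction N arbitrary: \<eta>)
  case 0
  show ?case
  proof (intro exI[of _ "\<eta>/2"] conjI allI impI)
    show "\<eta>/2 > 0" using 0 by simp
    fix m D G x y assume "m \<le> (0::nat)" and A: "D \<subseteq> X \<and> mv D m G \<and> x \<in> D \<and> y \<in> D \<and> dist x y \<le> \<eta>/2"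
    then have "mv D 0 G" by simp
    then have "G = (\<lambda>y. y)" by (cases rule: mv.cases) auto
    then show "dist (G x) (G y) < \<eta>" using A 0 by simp
  qed
next
  case (Suc N)
  from step_modulus[OF Suc.prems eps(2)] obtain \<eta>1 where
    \<eta>1: "\<eta>1 > 0 \<and> (\<forall>z x y s t. z \<in> X \<longrightarrow> x \<in> X \<longrightarrow> y \<in> X \<longrightarrow> \<phi> s x \<in> sect z \<longrightarrow> \<phi> t y \<in> sect z \<longrightarrow> \<bar>s - 1\<bar> \<le> \<epsilon> \<longrightarrow> \<bar>t - 1\<bar> \<le> \<epsilon> \<longrightarrow>
    dist x y \<le> \<eta>1 \<longrightarrow> dist (\<phi> s x) (\<phi> t y) < \<eta>)" by (rule exE)
  from Suc.IH[OF \<eta>1[THEN conjunct1]] obtain \<eta>2 where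
    \<eta>2: "\<eta>2 > 0 \<and> (\<forall>m\<le>N. \<forall>D G x y. D \<subseteq> X \<and> mv D m G \<and> x \<in> D \<and> y \<in> D \<and> dist x y \<le> \<eta>2 \<longrightarrow> dist (G x) (G y) < \<eta>1)" by (rule exE)
  from Suc.IH[OF Suc.prems] obtain \<eta>3 where
    \<eta>3: "\<eta>3 > 0 \<and> (\<forall>m\<le>N. \<forall>D G x y. D \<subseteq> X \<and> mv D m G \<and> x \<in> D \<and> y \<in> D \<and> dist x y \<le> \<eta>3 \<longrightarrow> dist (G x) (G y) < \<eta>)" by (rule exE)
  show ?case
  \<comment> \<open>\<open>\<eta>3\<close> serves up to \<open>N\<close> transfers;
    \<open>\<eta>2\<close> prepares for one more.\<close>
  proof (intro exI[of _ "min \<eta>2 \<eta>3"] conjI allI impI)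
    show "min \<eta>2 \<eta>3 > 0" using \<eta>2 \<eta>3 by simp
    fix m D G x y assume m: "m \<le> Suc N" and A: "D \<subseteq> X \<and> mv D m G \<and> x \<in> D \<and> y \<in> D \<and> dist x y \<le> min \<eta>2 \<eta>3"
    show "dist (G x) (G y) < \<eta>"
    proof (cases "m \<le> N")
      case True
      then show ?thesis using \<eta>3[THEN conjunct2, rule_format, of m D G x y] A by simp
    next
      case False
      then have "mv D (Suc N) G" using m A by (metis le_SucE)
      then obtain G' g where G: "mv D N G'" "step \<epsilon> (G' ` D) g" "G = (\<lambda>y. g (G' y))"
        by (cases rule: mv.cases) auto
      have d: "dist (G' x) (G' y) \<le> \<eta>1" using \<eta>2[THEN conjunct2, rule_format, of N D G' x y] A G(1) by simp
      have X: "G' x \<in> X" "G' y \<in> X" using mv_in[OF G(1)] A by auto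
      have D: "G' x \<in> G' ` D" "G' y \<in> G' ` D" using A by auto
      obtain s where s: "\<bar>s - 1\<bar> \<le> \<epsilon>" "g (G' x) = \<phi> s (G' x)" using step_time[OF G(2) D(1)] by blast
      obtain t where t: "\<bar>t - 1\<bar> \<le> \<epsilon>" "g (G' y) = \<phi> t (G' y)" using step_time[OF G(2) D(2)] by blast
      obtain z where z: "z \<in> X" "g (G' x) \<in> sect z" "g (G' y) \<in> sect z" using G(2) D unfolding step_def by blast
      have "dist (\<phi> s (G' x)) (\<phi> t (G' y)) < \<eta>"
        using z s t by (intro \<eta>1[THEN conjunct2, rule_format, OF z(1) X _ _ s(1) t(1) d]) auto
      then show ?thesis using s t G(3) by simp
    qed
  qed
qed

text \<open>While all images stay small the transfers can be continued, and their transit times are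
  the witnesses for forward tracking. \<open>m + n \<le> N\<close> splits the horizon into transfers
  already made and those still to come.\<close>

lemma small_imp_trk:
  assumes D: "D \<subseteq> X" "D \<noteq> {}" and small: "\<And>m G. m \<le> N \<Longrightarrow> mv D m G \<Longrightarrow> small (G ` D)"
    and xy: "x \<in> D" "y \<in> D"
  shows "mv D m G \<Longrightarrow> m + n \<le> N \<Longrightarrow> trk \<phi> \<epsilon> n (G x) (G y)"
proof (induction n arbitrary: m G)
  case 0
  then have "small (G ` D)" using small by simp
  then have "dist (G x) (G y) \<le> \<epsilon>" using xy rho(2) by (fastforce simp: small_def)
  then show ?case by simp
next
  case (Suc n)
  have sm: "small (G ` D)" using small[of m G] Suc.prems by simp
  have "G ` D \<subseteq> X" using mv_in[OF Suc.prems(1) D(1)] by auto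
  then obtain g where g: "step \<epsilon> (G ` D) g" using stepex[of "G ` D"] sm D(2) by (auto simp: small_def)
  have "mv D (Suc m) (\<lambda>y. g (G y))" by (rule mv_Suc[OF Suc.prems(1) sm g])
  then have n: "trk \<phi> \<epsilon> n (g (G x)) (g (G y))" using Suc.IH[of "Suc m"] Suc.prems(2) by simp
  obtain s where s: "\<bar>s - 1\<bar> \<le> \<epsilon>" "g (G x) = \<phi> s (G x)" using step_time[OF g] xy by blast
  obtain t where t: "\<bar>t - 1\<bar> \<le> \<epsilon>" "g (G y) = \<phi> t (G y)" using step_time[OF g] xy by blast
  have "dist (G x) (G y) \<le> \<epsilon>" using sm xy rho(2) by (fastforce simp: small_def)
  then show ?case using s t n by (subst trk.simps(2)) metis
qed

lemma not_trk_grows: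
  assumes "D \<subseteq> X" "x \<in> D" "y \<in> D" "\<not> trk \<phi> \<epsilon> N x y"
  shows "\<exists>m G. m \<le> N \<and> mv D m G \<and> \<not> small (G ` D)"
proof (rule ccontr)
  assume neg: "\<not> ?thesis"
  have "trk \<phi> \<epsilon> N x y"
  proof (rule small_imp_trk[of D N x y 0 "\<lambda>y. y" N])
    show "\<And>m G. m \<le> N \<Longrightarrow> mv D m G \<Longrightarrow> small (G ` D)" using neg by blast
  qed (use assms mv_0 in auto)
  then show False using assms(4) by simp
qed

text \<open>Pairs violating the claim for larger and larger \<open>N\<close> accumulate at a pair in
  one section, at distance at least \<delta>, that is tracked in both directions. Expansivity puts
  it on one short orbit piece, and transversality makes its points equal.\<close>

lemma uniform_expansive:
  assumes "\<delta> > 0"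
  shows "\<exists>N. \<forall>z\<in>X. \<forall>x\<in>sect z. \<forall>y\<in>sect z. \<delta> \<le> dist x y \<and> (\<forall>n. bwd n x y) \<longrightarrow> \<not> trk \<phi> \<epsilon> N x y"
proof (rule ccontr)
  assume "\<not> ?thesis"
  then have "\<forall>N. \<exists>z x y. z \<in> X \<and> x \<in> sect z \<and> y \<in> sect z \<and> \<delta> \<le> dist x y \<and> (\<forall>n. bwd n x y) \<and> trk \<phi> \<epsilon> N x y" by blast
  then have "\<forall>N. \<exists>p. fst p \<in> X \<and> fst (snd p) \<in> sect (fst p) \<and> snd (snd p) \<in> sect (fst p) \<and> \<delta> \<le> dist (fst (snd p)) (snd (snd p)) \<and>
     (\<forall>n. bwd n (fst (snd p)) (snd (snd p))) \<and> trk \<phi> \<epsilon> N (fst (snd p)) (snd (snd p))" by simp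
  then obtain p where p: "\<forall>N. fst (p N) \<in> X \<and> fst (snd (p N)) \<in> sect (fst (p N)) \<and> snd (snd (p N)) \<in> sect (fst (p N)) \<and> \<delta> \<le> dist (fst (snd (p N))) (snd (snd (p N))) \<and>
     (\<forall>n. bwd n (fst (snd (p N))) (snd (snd (p N)))) \<and> trk \<phi> \<epsilon> N (fst (snd (p N))) (snd (snd (p N)))"
    by (rule choice[THEN exE])
  define \<zeta> \<xi> \<theta> where "\<zeta> N = fst (p N)" and "\<xi> N = fst (snd (p N))" and "\<theta> N = snd (snd (p N))" for N
  have q: "\<zeta> N \<in> X" "\<xi> N \<in> sect (\<zeta> N)" "\<theta> N \<in> sect (\<zeta> N)" "\<delta> \<le> dist (\<xi> N) (\<theta> N)" "bwd n (\<xi> N) (\<theta> N)" "trk \<phi> \<epsilon> N (\<xi> N) (\<theta> N)" for N n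
    using p by (simp_all add: \<zeta>_def \<xi>_def \<theta>_def)
  have qX: "\<xi> N \<in> X" "\<theta> N \<in> X" for N using q(2,3) sect_sub by blast+
  have pX: "\<forall>N. (\<zeta> N, \<xi> N, \<theta> N) \<in> X \<times> X \<times> X" using q(1) qX by simp
  have "compact (X \<times> X \<times> X)" using compX by (intro compact_Times)
  then obtain l k where l: "l \<in> X \<times> X \<times> X" "strict_mono (k::nat\<Rightarrow>nat)" "((\<lambda>N. (\<zeta> N, \<xi> N, \<theta> N)) \<circ> k) \<longlonglongrightarrow> l"
    using pX by (rule compactE_subseq)
  obtain z x y where le: "l = (z, x, y)" by (metis prod.collapse)
  have lim: "(\<lambda>i. \<zeta> (k i)) \<longlonglongrightarrow> z" "(\<lambda>i. \<xi> (k i)) \<longlonglongrightarrow> x" "(\<lambda>i. \<theta> (k i)) \<longlonglongrightarrow> y"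
    using tendsto_fst[OF l(3)] tendsto_fst[OF tendsto_snd[OF l(3)]] tendsto_snd[OF tendsto_snd[OF l(3)]] by (simp_all add: le o_def)
  have mem: "z \<in> X" "x \<in> X" "y \<in> X" using l(1) by (simp_all add: le)
  have xs: "x \<in> sect z" by (rule sect_limit[OF lim(1,2)]) (rule q)+
  have ys: "y \<in> sect z" by (rule sect_limit[OF lim(1,3)]) (rule q)+
  have "(\<lambda>i. dist (\<xi> (k i)) (\<theta> (k i))) \<longlonglongrightarrow> dist x y" by (intro tendsto_dist lim)
  then have d: "\<delta> \<le> dist x y" by (rule LIMSEQ_le_const) (use q(4) in blast)
  have "trk \<phi> \<epsilon> n x y" for n
  proof (rule trk_limit[OF lim(2,3)])
    fix i assume "n \<le> i"
    then have "n \<le> k i" using seq_suble[OF l(2), of i] by linarith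
    then show "trk \<phi> \<epsilon> n (\<xi> (k i)) (\<theta> (k i))" using q(6) by (rule trk_mono)
  qed (rule qX)+
  moreover have "bwd n x y" for n
    by (rule rev.trk_limit[OF lim(2,3), where N = 0]) (rule qX q)+
  ultimately obtain s where s: "\<bar>s\<bar> \<le> a" "y = \<phi> s x" using expd[OF mem(2,3)] by blast
  then have "s = 0" using transversal[OF mem(1) xs, of s] ys by simp
  then show False using s(2) d assms mem(2) by simp
qed

lemma growth:
  assumes "\<delta> > 0"
  shows "\<exists>N. \<forall>D x y. good D \<and> x \<in> D \<and> y \<in> D \<and> \<delta> \<le> dist x y \<longrightarrow> (\<exists>m G. m \<le> N \<and> mv D m G \<and> \<not> small (G ` D))"
proof -
  from uniform_expansive[OF assms] obtain N where
    N: "\<forall>z\<in>X. \<forall>x\<in>sect z. \<forall>y\<in>sect z. \<delta> \<le> dist x y \<and> (\<forall>n. bwd n x y) \<longrightarrow> \<not> trk \<phi> \<epsilon> N x y" by (rule exE)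
  show ?thesis
  proof (rule exI[of _ N], intro allI impI)
    fix D x y assume A: "good D \<and> x \<in> D \<and> y \<in> D \<and> \<delta> \<le> dist x y"
    then obtain z where z: "z \<in> X" "x \<in> sect z" "y \<in> sect z" unfolding good_def flat_def by blast
    have "\<not> trk \<phi> \<epsilon> N x y" using N[rule_format, OF z] A by (simp add: good_def)
    then show "\<exists>m G. m \<le> N \<and> mv D m G \<and> \<not> small (G ` D)" using not_trk_grows[of D x y N] A by (simp add: good_def)
  qed
qed

section \<open>Splitting continua and avoiding a ball\<close>

text \<open>Diameter at least \<open>\<rho>/4\<close> makes the growth time uniform, and smallness
  ensures that growing takes at least one transfer.\<close>

definition ok :: "'a set \<Rightarrow> bool" where
  "ok D \<longleftrightarrow> good D \<and> small D \<and> (\<exists>x\<in>D. \<exists>y\<in>D. \<rho>/4 \<le> dist x y)"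

lemma good_subset: "good D \<Longrightarrow> D' \<subseteq> D \<Longrightarrow> compact D' \<Longrightarrow> connected D' \<Longrightarrow> good D'"
  using flat_subset[of D D'] unfolding good_def by blast

text \<open>Boundary bumping with radius \<open>\<rho>/4\<close> around two points more than \<rho>
  apart: each piece has diameter between \<open>\<rho>/4\<close> and \<open>\<rho>/2\<close>, and
  points of different pieces are more than \<open>\<rho>/2\<close> apart.\<close>

lemma split_continuum:
  assumes "good D" "\<not> small D"
  shows "\<exists>D1 D2. D1 \<subseteq> D \<and> D2 \<subseteq> D \<and> ok D1 \<and> ok D2 \<and> (\<forall>p\<in>D1. \<forall>q\<in>D2. \<rho>/4 \<le> dist p q)"
proof -
  obtain u v where uv: "u \<in> D" "v \<in> D" "\<rho> < dist u v" using assms(2) by (auto simp: small_def not_le)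
  have cD: "compact D" "connected D" using assms(1) by (auto simp: good_def)
  have r4: "0 < \<rho>/4" "\<rho>/4 < dist u v" "\<rho>/4 < dist v u" using uv(3) rho(1) by (auto simp: dist_commute)
  obtain D1 where D1: "D1 \<subseteq> D" "compact D1" "connected D1" "u \<in> D1" "\<forall>x\<in>D1. dist u x \<le> \<rho>/4" "\<exists>x\<in>D1. dist u x = \<rho>/4"
    using subcontinuum_reaching[OF cD uv(1,2) r4(2,1)] by blast
  obtain D2 where D2: "D2 \<subseteq> D" "compact D2" "connected D2" "v \<in> D2" "\<forall>x\<in>D2. dist v x \<le> \<rho>/4" "\<exists>x\<in>D2. dist v x = \<rho>/4"
    using subcontinuum_reaching[OF cD uv(2,1) r4(3,1)] by blast
  have sm: "small E" if "\<forall>x\<in>E. dist w x \<le> \<rho>/4" for E w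
    unfolding small_def
  proof (intro ballI)
    fix x y assume "x \<in> E" "y \<in> E"
    then have "dist w x \<le> \<rho>/4" "dist w y \<le> \<rho>/4" using that by auto
    then show "dist x y \<le> \<rho>" using dist_triangle3[of x y w] rho(1) by linarith
  qed
  have "ok D1" unfolding ok_def using good_subset[OF assms(1) D1(1-3)] sm[OF D1(5)] D1(4,6) by (metis order_refl)
  moreover have "ok D2" unfolding ok_def using good_subset[OF assms(1) D2(1-3)] sm[OF D2(5)] D2(4,6) by (metis order_refl)
  moreover have "\<rho>/4 \<le> dist p q" if "p \<in> D1" "q \<in> D2" for p q
  proof -
    have "dist u p \<le> \<rho>/4" "dist v q \<le> \<rho>/4" using that D1(5) D2(5) by auto
    moreover have "dist u v \<le> dist u p + dist p q + dist v q"
      using dist_triangle[of u v p] dist_triangle[of p v q] by (simp add: dist_commute)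
    ultimately show ?thesis using uv(3) rho(1) by linarith
  qed
  ultimately show ?thesis using D1(1) D2(1) by blast
qed

text \<open>The finitely many sets in \<open>\<Z>\<close> are obstacles in the root continuum \<open>D\<close>. At each branching
  an obstacle survives in at most one of the two branches, so that one branch meets at most half of them.\<close>

lemma avoid_obstacles:
  assumes N: "\<forall>D x y. good D \<and> x \<in> D \<and> y \<in> D \<and> \<rho>/4 \<le> dist x y \<longrightarrow> (\<exists>m G. m \<le> N \<and> mv D m G \<and> \<not> small (G ` D))"
  shows "\<exists>\<eta>>0. \<forall>D \<Z>. ok D \<and> finite \<Z> \<and> card \<Z> < 2^k \<and> (\<forall>Z\<in>\<Z>. \<forall>x\<in>Z \<inter> D. \<forall>y\<in>Z \<inter> D. dist x y < \<eta>) \<longrightarrow>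
    (\<exists>L. ok L \<and> (\<forall>w\<in>L. \<exists>t w0. real k / 2 \<le> t \<and> t \<le> 2 * real N * real k \<and> w0 \<in> D \<and> w0 \<notin> \<Union>\<Z> \<and> w = \<phi> t w0))"
proof (induction k)
  case 0
  show ?case
  proof (intro exI[of _ 1] conjI allI impI)
    fix D and \<Z> :: "'a set set" assume A: "ok D \<and> finite \<Z> \<and> card \<Z> < 2^0 \<and> (\<forall>Z\<in>\<Z>. \<forall>x\<in>Z \<inter> D. \<forall>y\<in>Z \<inter> D. dist x y < 1)"
    then have "finite \<Z>" "card \<Z> = 0" by simp_all
    then have Z: "\<Z> = {}" by (simp only: card_0_eq)
    have "D \<subseteq> X" using A by (simp add: ok_def good_def)
    then have "\<exists>t w0. real 0 / 2 \<le> t \<and> t \<le> 2 * real N * real 0 \<and> w0 \<in> D \<and> w0 \<notin> \<Union>\<Z> \<and> w = \<phi> t w0" if "w \<in> D" for w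
      using that Z by (intro exI[of _ 0] exI[of _ w]) auto
    then show "\<exists>L. ok L \<and> (\<forall>w\<in>L. \<exists>t w0. real 0 / 2 \<le> t \<and> t \<le> 2 * real N * real 0 \<and> w0 \<in> D \<and> w0 \<notin> \<Union>\<Z> \<and> w = \<phi> t w0)"
      using A by (intro exI[of _ D] conjI ballI) auto
  qed simp
next
  case (Suc k)
  from Suc obtain \<eta>k where \<eta>k: "\<eta>k > 0 \<and> (\<forall>D \<Z>. ok D \<and> finite \<Z> \<and> card \<Z> < 2^k \<and> (\<forall>Z\<in>\<Z>. \<forall>x\<in>Z \<inter> D. \<forall>y\<in>Z \<inter> D. dist x y < \<eta>k) \<longrightarrow>
    (\<exists>L. ok L \<and> (\<forall>w\<in>L. \<exists>t w0. real k / 2 \<le> t \<and> t \<le> 2 * real N * real k \<and> w0 \<in> D \<and> w0 \<notin> \<Union>\<Z> \<and> w = \<phi> t w0)))" by (rule exE)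
  \<comment> \<open>Images of obstacles must have diameter below \<open>\<rho>/4\<close> in order to
    miss one of the two branches, and below \<open>\<eta>k\<close> for the induction
    hypothesis.\<close>
  have "min \<eta>k (\<rho>/4) > 0" using \<eta>k rho by simp
  from mv_modulus[OF this, of N] obtain \<eta> where
    \<eta>: "\<eta> > 0 \<and> (\<forall>m\<le>N. \<forall>D G x y. D \<subseteq> X \<and> mv D m G \<and> x \<in> D \<and> y \<in> D \<and> dist x y \<le> \<eta> \<longrightarrow> dist (G x) (G y) < min \<eta>k (\<rho>/4))" by (rule exE)
  show ?case
  proof (intro exI[of _ \<eta>] conjI allI impI)
    show "\<eta> > 0" using \<eta> by simp
    fix D and \<Z> :: "'a set set"
    assume A: "ok D \<and> finite \<Z> \<and> card \<Z> < 2^Suc k \<and> (\<forall>Z\<in>\<Z>. \<forall>x\<in>Z \<inter> D. \<forall>y\<in>Z \<inter> D. dist x y < \<eta>)"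
    then have D: "good D" "small D" "D \<subseteq> X" by (auto simp: ok_def good_def)
    obtain x y where "x \<in> D" "y \<in> D" "\<rho>/4 \<le> dist x y" using A by (auto simp: ok_def)
    then obtain m G where mG: "m \<le> N" "mv D m G" "\<not> small (G ` D)" using N D(1) by blast
    have m1: "m \<ge> 1"
    proof (rule ccontr)
      assume "\<not> m \<ge> 1"
      then have "m = 0" by simp
      then have "mv D 0 G" using mG(2) by (simp only:)
      then have "G = (\<lambda>y. y)" by (cases rule: mv.cases) auto
      then show False using mG(3) D(2) by simp
    qed
    obtain D1 D2 where D12: "D1 \<subseteq> G ` D" "D2 \<subseteq> G ` D" "ok D1" "ok D2" "\<forall>p\<in>D1. \<forall>q\<in>D2. \<rho>/4 \<le> dist p q"
      using split_continuum[OF mv_good[OF mG(2) D(1)] mG(3)] by blast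
    have close: "dist (G x) (G y) < \<eta>k" "dist (G x) (G y) < \<rho>/4" if "Z \<in> \<Z>" "x \<in> Z \<inter> D" "y \<in> Z \<inter> D" for Z x y
    proof -
      have "dist x y < \<eta>" using A that by blast
      then have "dist (G x) (G y) < min \<eta>k (\<rho>/4)"
        using \<eta>[THEN conjunct2, rule_format, OF mG(1), of D G x y] mG(2) D(3) that by simp
      then show "dist (G x) (G y) < \<eta>k" "dist (G x) (G y) < \<rho>/4" by simp_all
    qed
    define hit where "hit E = {Z \<in> \<Z>. G ` (Z \<inter> D) \<inter> E \<noteq> {}}" for E
    have fin: "finite (hit E)" for E using A by (simp add: hit_def)
    have "hit D1 \<inter> hit D2 = {}"
    proof (rule equals0I)
      fix Z assume "Z \<in> hit D1 \<inter> hit D2"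
      then obtain x y where "Z \<in> \<Z>" "x \<in> Z \<inter> D" "G x \<in> D1" "y \<in> Z \<inter> D" "G y \<in> D2" unfolding hit_def by blast
      then show False using close(2)[of Z x y] D12(5) by (meson not_le)
    qed
    then have "card (hit D1) + card (hit D2) = card (hit D1 \<union> hit D2)" using card_Un_disjoint[OF fin fin] by simp
    also have "\<dots> \<le> card \<Z>" using A by (intro card_mono) (auto simp: hit_def)
    also have "\<dots> < 2 * 2^k" using A by simp
    finally have "card (hit D1) < 2^k \<or> card (hit D2) < 2^k" by linarith
    then obtain E where E: "E \<subseteq> G ` D" "ok E" "card (hit E) < 2^k" using D12 by blast
    \<comment> \<open>The obstacles in the chosen branch are the transferred ones; a point avoiding
      them comes from a point of \<open>D\<close> that avoids the original ones.\<close>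
    define \<Z>' where "\<Z>' = (\<lambda>Z. G ` (Z \<inter> D) \<inter> E) ` hit E"
    have "finite \<Z>'" using fin by (simp add: \<Z>'_def)
    moreover have "card \<Z>' < 2^k" using card_image_le[OF fin, of "\<lambda>Z. G ` (Z \<inter> D) \<inter> E" E] E(3) unfolding \<Z>'_def by linarith
    moreover have "\<forall>Z\<in>\<Z>'. \<forall>x\<in>Z \<inter> E. \<forall>y\<in>Z \<inter> E. dist x y < \<eta>k"
    proof (intro ballI)
      fix Z' x' y' assume "Z' \<in> \<Z>'" "x' \<in> Z' \<inter> E" "y' \<in> Z' \<inter> E"
      then obtain Z x y where "Z \<in> \<Z>" "x \<in> Z \<inter> D" "y \<in> Z \<inter> D" "x' = G x" "y' = G y" unfolding \<Z>'_def hit_def by blast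
      then show "dist x' y' < \<eta>k" using close(1) by blast
    qed
    ultimately have "\<exists>L. ok L \<and> (\<forall>w\<in>L. \<exists>t w0. real k / 2 \<le> t \<and> t \<le> 2 * real N * real k \<and> w0 \<in> E \<and> w0 \<notin> \<Union>\<Z>' \<and> w = \<phi> t w0)"
      using \<eta>k[THEN conjunct2, rule_format, of E \<Z>'] E(2) by simp
    then obtain L where L: "ok L \<and> (\<forall>w\<in>L. \<exists>t w0. real k / 2 \<le> t \<and> t \<le> 2 * real N * real k \<and> w0 \<in> E \<and> w0 \<notin> \<Union>\<Z>' \<and> w = \<phi> t w0)" by (rule exE)
    have "\<exists>t w0. real (Suc k) / 2 \<le> t \<and> t \<le> 2 * real N * real (Suc k) \<and> w0 \<in> D \<and> w0 \<notin> \<Union>\<Z> \<and> w = \<phi> t w0" if w: "w \<in> L" for w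
    proof -
      obtain t w1 where t: "real k / 2 \<le> t" "t \<le> 2 * real N * real k" "w1 \<in> E" "w1 \<notin> \<Union>\<Z>'" "w = \<phi> t w1" using L w by blast
      obtain w0 where w0: "w0 \<in> D" "w1 = G w0" using t(3) E(1) by blast
      obtain t1 where t1: "real m / 2 \<le> t1" "t1 \<le> 2 * real m" "G w0 = \<phi> t1 w0" using mv_time[OF mG(2) D(3) w0(1)] by blast
      have "w0 \<notin> \<Union>\<Z>"
      proof
        assume "w0 \<in> \<Union>\<Z>"
        then obtain Z where Z: "Z \<in> \<Z>" "w0 \<in> Z" by blast
        then have "w1 \<in> G ` (Z \<inter> D) \<inter> E" using w0 t(3) by blast
        then have "Z \<in> hit E" "w1 \<in> G ` (Z \<inter> D) \<inter> E" using Z(1) by (auto simp: hit_def)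
        then have "w1 \<in> \<Union>\<Z>'" unfolding \<Z>'_def by blast
        then show False using t(4) by simp
      qed
      moreover have "w0 \<in> X" using w0 D(3) by blast
      then have "w = \<phi> (t1 + t) w0" using t(5) w0(2) t1(3) by simp
      moreover have "real (Suc k) / 2 \<le> t1 + t" using t(1) t1(1) m1 by simp
      moreover have "real m \<le> real N" using mG(1) by simp
      then have "t1 + t \<le> 2 * real N * real (Suc k)" using t(2) t1(2) by (simp add: algebra_simps)
      ultimately show ?thesis using w0(1) by blast
    qed
    then show "\<exists>L. ok L \<and> (\<forall>w\<in>L. \<exists>t w0. real (Suc k) / 2 \<le> t \<and> t \<le> 2 * real N * real (Suc k) \<and> w0 \<in> D \<and> w0 \<notin> \<Union>\<Z> \<and> w = \<phi> t w0)"
      using L by (intro exI[of _ L]) blast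
  qed
qed

lemma square_le_power2: "4 \<le> k \<Longrightarrow> k * k \<le> (2::nat)^k"
proof (induction k rule: dec_induct)
  case (step n)
  have "4 * n \<le> n * n" using step.hyps(1) by (rule mult_le_mono1)
  moreover have "Suc n * Suc n = n * n + 2 * n + 1" by simp
  ultimately have "Suc n * Suc n \<le> n * n + n * n" using step.hyps(1) by linarith
  also have "\<dots> \<le> 2^Suc n" using step.IH by simp
  finally show ?case .
qed simp

lemma linear_less_power2: "\<exists>k\<ge>1. b * real k + 2 < 2^k"
proof -
  obtain k0 :: nat where k0: "b + 4 \<le> real k0" using real_arch_simple by blast
  define k where "k = max 4 k0"
  have k: "4 \<le> k" "b + 4 \<le> real k" using k0 by (auto simp: k_def)
  have "b * real k + 2 < (b + 4) * real k" using k(1) by (simp add: algebra_simps)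
  also have "\<dots> \<le> real k * real k" using k by (intro mult_right_mono) auto
  also have "\<dots> \<le> 2^k" using square_le_power2[OF k(1)] by (metis of_nat_le_iff of_nat_mult of_nat_numeral of_nat_power)
  finally show ?thesis using k(1) by (intro exI[of _ k]) auto
qed

text \<open>The time \<open>T\<close> available to \<open>k\<close> rounds is cut into slots of
  length \<open>a\<close>, and \<open>Z j\<close> collects the points whose orbit meets
  \<open>B\<close> in slot \<open>j\<close>. Two points of \<open>Z j\<close> in one section lie
  almost on a common orbit piece of duration at most \<open>a\<close>, so
  \<open>near_transversal\<close> makes each obstacle thin.\<close>

lemma avoid_ball:
  assumes "p \<in> X"
  shows "\<exists>B. open B \<and> p \<in> B \<and> (\<forall>D. ok D \<longrightarrow> (\<exists>L. ok L \<and> (\<forall>w\<in>L. \<exists>t w0. 1/2 \<le> t \<and> w0 \<in> D \<and> w = \<phi> t w0 \<and> (\<forall>s. 0 \<le> s \<and> s \<le> t \<longrightarrow> \<phi> s w0 \<notin> B))))"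
proof -
  have "\<rho>/4 > 0" using rho by simp
  from growth[OF this] obtain N where
    N: "\<forall>D x y. good D \<and> x \<in> D \<and> y \<in> D \<and> \<rho>/4 \<le> dist x y \<longrightarrow> (\<exists>m G. m \<le> N \<and> mv D m G \<and> \<not> small (G ` D))" by (rule exE)
  \<comment> \<open>The number of slots is at most \<open>T / a + 2\<close>, hence bounded linearly
    in \<open>k\<close>, and has to stay below \<open>2^k\<close>.\<close>
  from linear_less_power2[of "2 * real N / a"] obtain k :: nat where k: "k \<ge> 1 \<and> 2 * real N / a * real k + 2 < 2^k" by (rule exE)
  define T where "T = 2 * real N * real k"
  have T0: "T \<ge> 0" by (simp add: T_def)
  \<comment> \<open>The extra slot covers the endpoint \<open>s = T\<close> when
    \<open>T / a\<close> is an integer.\<close>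
  define J where "J = nat \<lceil>T / a\<rceil> + 1"
  have "real J \<le> T / a + 2" using T0 apos by (simp add: J_def) linarith
  also have "\<dots> < 2^k" using k by (simp add: T_def)
  finally have "real J < real (2^k)" by simp
  then have J2: "J < 2^k" by (simp only: of_nat_less_iff)
  from avoid_obstacles[OF N, of k] obtain \<eta> where
    \<eta>: "\<eta> > 0 \<and> (\<forall>D \<Z>. ok D \<and> finite \<Z> \<and> card \<Z> < 2^k \<and> (\<forall>Z\<in>\<Z>. \<forall>x\<in>Z \<inter> D. \<forall>y\<in>Z \<inter> D. dist x y < \<eta>) \<longrightarrow>
    (\<exists>L. ok L \<and> (\<forall>w\<in>L. \<exists>t w0. real k / 2 \<le> t \<and> t \<le> 2 * real N * real k \<and> w0 \<in> D \<and> w0 \<notin> \<Union>\<Z> \<and> w = \<phi> t w0)))" by (rule exE)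
  from near_transversal[OF \<eta>[THEN conjunct1]] obtain \<eta>' where
    \<eta>': "\<eta>' > 0 \<and> (\<forall>z x y s. z \<in> X \<longrightarrow> x \<in> sect z \<longrightarrow> y \<in> sect z \<longrightarrow> \<bar>s\<bar> \<le> a \<longrightarrow> dist y (\<phi> s x) \<le> \<eta>' \<longrightarrow> dist x y < \<eta>)" by (rule exE)
  \<comment> \<open>Two hits of \<open>B\<close>, a ball of radius \<open>\<kappa>/2\<close>, are
    within \<kappa> of each other; flowing back by the hitting time of \<open>y\<close>, which is at
    most \<open>real J * a\<close>, keeps them within \<open>\<eta>'\<close>.\<close>
  obtain \<kappa> where \<kappa>: "\<kappa> > 0" "flow_modulus (real J * a) \<kappa> \<eta>'" using flow_uniform[OF \<eta>'[THEN conjunct1]] by blast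
  define B where "B = ball p (\<kappa>/2)"
  define Z where "Z j = {x \<in> X. \<exists>s. real j * a \<le> s \<and> s \<le> real (Suc j) * a \<and> \<phi> s x \<in> B}" for j :: nat
  have close: "dist x y < \<eta>" if j: "j < J" and x: "x \<in> Z j" and y: "y \<in> Z j" and z: "z \<in> X" "x \<in> sect z" "y \<in> sect z" for j x y z
  proof -
    obtain s where s: "real j * a \<le> s" "s \<le> real (Suc j) * a" "\<phi> s x \<in> B" using x by (auto simp: Z_def)
    obtain t where t: "real j * a \<le> t" "t \<le> real (Suc j) * a" "\<phi> t y \<in> B" using y by (auto simp: Z_def)
    have X: "x \<in> X" "y \<in> X" using x y by (auto simp: Z_def)
    have "dist (\<phi> t y) (\<phi> s x) \<le> dist p (\<phi> t y) + dist p (\<phi> s x)" by (rule dist_triangle3)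
    then have d: "dist (\<phi> t y) (\<phi> s x) \<le> \<kappa>" using s(3) t(3) by (simp add: B_def)
    have "real (Suc j) * a \<le> real J * a" using j apos by (intro mult_right_mono) auto
    moreover have "0 \<le> real j * a" using apos by simp
    ultimately have "\<bar>- t\<bar> \<le> real J * a" using t by linarith
    then have "dist (\<phi> (- t) (\<phi> t y)) (\<phi> (- t) (\<phi> s x)) < \<eta>'"
      using flow_modulusD[OF \<kappa>(2), of "- t" "- t" "\<phi> t y" "\<phi> s x"] d \<kappa>(1) X by simp
    then have "dist y (\<phi> (s - t) x) \<le> \<eta>'" using X by simp
    moreover have "\<bar>s - t\<bar> \<le> a" using s t by (simp add: abs_le_iff algebra_simps)
    ultimately show ?thesis using \<eta>'[THEN conjunct2, rule_format, OF z] by blast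
  qed
  have cov: "\<exists>j<J. real j * a \<le> s \<and> s \<le> real (Suc j) * a" if s: "0 \<le> s" "s \<le> T" for s
  proof -
    define j where "j = nat \<lfloor>s / a\<rfloor>"
    have "0 \<le> s / a" using s apos by simp
    then have rj: "real j = of_int \<lfloor>s / a\<rfloor>" by (simp add: j_def)
    have "real j \<le> s / a" "s / a \<le> real (Suc j)" unfolding of_nat_Suc rj by linarith+
    then have 1: "real j * a \<le> s" "s \<le> real (Suc j) * a" using apos by (simp_all add: field_simps)
    have "s / a \<le> T / a" using s apos by (simp add: divide_right_mono)
    then have "\<lfloor>s / a\<rfloor> \<le> \<lceil>T / a\<rceil>" by linarith
    then have "j < J" by (simp add: j_def J_def nat_mono le_imp_less_Suc)
    then show ?thesis using 1 by blast
  qed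
  have main: "\<exists>L. ok L \<and> (\<forall>w\<in>L. \<exists>t w0. 1/2 \<le> t \<and> w0 \<in> D \<and> w = \<phi> t w0 \<and> (\<forall>s. 0 \<le> s \<and> s \<le> t \<longrightarrow> \<phi> s w0 \<notin> B))" if D: "ok D" for D
  proof -
    have DX: "D \<subseteq> X" "flat D" using D by (auto simp: ok_def good_def)
    define \<Z> where "\<Z> = Z ` {..<J}"
    have "finite \<Z>" "card \<Z> < 2^k" using J2 card_image_le[of "{..<J}" Z] by (auto simp: \<Z>_def)
    moreover have "\<forall>Z\<in>\<Z>. \<forall>x\<in>Z \<inter> D. \<forall>y\<in>Z \<inter> D. dist x y < \<eta>"
    proof (intro ballI)
      fix Y x y assume A: "Y \<in> \<Z>" "x \<in> Y \<inter> D" "y \<in> Y \<inter> D"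
      then obtain j where j: "j < J" "Y = Z j" by (auto simp: \<Z>_def)
      obtain z where "z \<in> X" "x \<in> sect z" "y \<in> sect z" using DX(2) A unfolding flat_def by blast
      then show "dist x y < \<eta>" using close[OF j(1)] j(2) A by blast
    qed
    ultimately have "\<exists>L. ok L \<and> (\<forall>w\<in>L. \<exists>t w0. real k / 2 \<le> t \<and> t \<le> 2 * real N * real k \<and> w0 \<in> D \<and> w0 \<notin> \<Union>\<Z> \<and> w = \<phi> t w0)"
      using \<eta>[THEN conjunct2, rule_format, of D \<Z>] D by simp
    then obtain L where L: "ok L \<and> (\<forall>w\<in>L. \<exists>t w0. real k / 2 \<le> t \<and> t \<le> 2 * real N * real k \<and> w0 \<in> D \<and> w0 \<notin> \<Union>\<Z> \<and> w = \<phi> t w0)" by (rule exE)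
    have "\<exists>t w0. 1/2 \<le> t \<and> w0 \<in> D \<and> w = \<phi> t w0 \<and> (\<forall>s. 0 \<le> s \<and> s \<le> t \<longrightarrow> \<phi> s w0 \<notin> B)" if w: "w \<in> L" for w
    proof -
      obtain t w0 where t: "real k / 2 \<le> t" "t \<le> T" "w0 \<in> D" "w0 \<notin> \<Union>\<Z>" "w = \<phi> t w0" using L w unfolding T_def by blast
      have "\<phi> s w0 \<notin> B" if s: "0 \<le> s" "s \<le> t" for s
      proof
        assume h: "\<phi> s w0 \<in> B"
        obtain j where j: "j < J" "real j * a \<le> s" "s \<le> real (Suc j) * a" using cov[of s] s t(2) by auto
        then have "w0 \<in> Z j" using h t(3) DX(1) unfolding Z_def by blast
        then show False using t(4) j(1) by (auto simp: \<Z>_def)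
      qed
      moreover have "1/2 \<le> t" using t(1) k by linarith
      ultimately show ?thesis using t(3,5) by blast
    qed
    then show ?thesis using L by blast
  qed
  show ?thesis using \<kappa>(1) main by (intro exI[of _ B]) (simp add: B_def)
qed

text \<open>The rounds of \<open>avoid_ball\<close> are nested, so a point of the last continuum
  pulls back to a point of \<open>D0\<close> whose orbit avoids \<open>B\<close> during all rounds,
  each lasting at least 1/2. A limit of such points avoids \<open>B\<close> at all nonnegative
  times, against recurrence.\<close>

lemma no_ok:
  assumes "minimal_flow X \<phi>" "ok D0"
  shows False
proof -
  obtain p where p: "p \<in> D0" using assms(2) by (auto simp: ok_def)
  have pX: "p \<in> X" using p assms(2) by (auto simp: ok_def good_def)
  from avoid_ball[OF pX] obtain B where
    B: "open B \<and> p \<in> B \<and> (\<forall>D. ok D \<longrightarrow> (\<exists>L. ok L \<and> (\<forall>w\<in>L. \<exists>t w0. 1/2 \<le> t \<and> w0 \<in> D \<and> w = \<phi> t w0 \<and> (\<forall>s. 0 \<le> s \<and> s \<le> t \<longrightarrow> \<phi> s w0 \<notin> B))))" by (rule exE)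
  have "\<exists>w0\<in>D. \<forall>s. 0 \<le> s \<and> s \<le> real m / 2 \<longrightarrow> \<phi> s w0 \<notin> B" if "ok D" for m D
    using that
  proof (induction m arbitrary: D)
    case 0
    then obtain L where L: "ok L" "\<forall>w\<in>L. \<exists>t w0. 1/2 \<le> t \<and> w0 \<in> D \<and> w = \<phi> t w0 \<and> (\<forall>s. 0 \<le> s \<and> s \<le> t \<longrightarrow> \<phi> s w0 \<notin> B)" using B by blast
    obtain w where "w \<in> L" using L(1) by (auto simp: ok_def)
    then obtain t w0 where t: "1/2 \<le> t" "w0 \<in> D" "\<forall>s. 0 \<le> s \<and> s \<le> t \<longrightarrow> \<phi> s w0 \<notin> B" using L(2) by blast
    have "\<forall>s. 0 \<le> s \<and> s \<le> real 0 / 2 \<longrightarrow> \<phi> s w0 \<notin> B" using t(1,3) by simp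
    then show ?case using t(2) by blast
  next
    case (Suc m)
    then obtain L where L: "ok L" "\<forall>w\<in>L. \<exists>t w0. 1/2 \<le> t \<and> w0 \<in> D \<and> w = \<phi> t w0 \<and> (\<forall>s. 0 \<le> s \<and> s \<le> t \<longrightarrow> \<phi> s w0 \<notin> B)" using B by blast
    obtain w where w: "w \<in> L" "\<forall>s. 0 \<le> s \<and> s \<le> real m / 2 \<longrightarrow> \<phi> s w \<notin> B" using Suc.IH[OF L(1)] by blast
    then obtain t w0 where t: "1/2 \<le> t" "w0 \<in> D" "w = \<phi> t w0" "\<forall>s. 0 \<le> s \<and> s \<le> t \<longrightarrow> \<phi> s w0 \<notin> B" using L(2) by blast
    have w0X: "w0 \<in> X" using t(2) Suc.prems by (auto simp: ok_def good_def)
    have "\<phi> s w0 \<notin> B" if s: "0 \<le> s" "s \<le> real (Suc m) / 2" for s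
    proof (cases "s \<le> t")
      case False
      then have "\<phi> (s - t) w \<notin> B" using w(2) s t(1) by simp
      then show ?thesis using t(3) w0X by simp
    qed (use t(4) s in simp)
    then show ?case using t(2) by blast
  qed
  then have "\<forall>m. \<exists>w0. w0 \<in> D0 \<and> (\<forall>s. 0 \<le> s \<and> s \<le> real m / 2 \<longrightarrow> \<phi> s w0 \<notin> B)" using assms(2) by blast
  then obtain w where w: "\<forall>m. w m \<in> D0 \<and> (\<forall>s. 0 \<le> s \<and> s \<le> real m / 2 \<longrightarrow> \<phi> s (w m) \<notin> B)" by (rule choice[THEN exE])
  have wX: "\<forall>m. w m \<in> X" using w assms(2) by (auto simp: ok_def good_def)
  obtain l k where l: "l \<in> X" "strict_mono (k::nat\<Rightarrow>nat)" "(w \<circ> k) \<longlonglongrightarrow> l" using compX wX by (rule compactE_subseq)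
  have "\<phi> s l \<notin> B" if s: "s \<ge> 0" for s
  proof -
    obtain M :: nat where M: "2 * s \<le> real M" using real_arch_simple by blast
    have "(\<lambda>i. \<phi> s (w (k i))) \<longlonglongrightarrow> \<phi> s l" using l wX by (intro tendsto_flow) (auto simp: o_def)
    then have "(\<lambda>i. \<phi> s (w (k (i + M)))) \<longlonglongrightarrow> \<phi> s l" by (rule LIMSEQ_ignore_initial_segment)
    moreover have nB: "\<phi> s (w (k (i + M))) \<in> - B" for i
    proof -
      have "i + M \<le> k (i + M)" by (rule seq_suble[OF l(2)])
      then have "s \<le> real (k (i + M)) / 2" using M by linarith
      then show ?thesis using w s by simp
    qed
    moreover have "closed (- B)" using B by (simp add: closed_Compl)
    ultimately have "\<phi> s l \<in> - B" using closed_sequentially[of "- B" "\<lambda>i. \<phi> s (w (k (i + M)))" "\<phi> s l"] by simp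
    then show ?thesis by simp
  qed
  note avoid = this
  have "open B" "p \<in> B" using B by simp_all
  from recurrence[OF assms(1) l(1) this pX, of 0] obtain t where "t \<ge> 0 \<and> \<phi> t l \<in> B" by (rule exE)
  then show False using avoid[of t] by simp
qed

text \<open>A nondegenerate good continuum would grow and, once split, yield an \<open>ok\<close>
  continuum.\<close>

lemma no_good:
  assumes "minimal_flow X \<phi>" "good D" "x \<in> D" "y \<in> D"
  shows "x = y"
proof (rule ccontr)
  assume "x \<noteq> y"
  then have "dist x y > 0" by simp
  from growth[OF this] obtain N where
    N: "\<forall>D x' y'. good D \<and> x' \<in> D \<and> y' \<in> D \<and> dist x y \<le> dist x' y' \<longrightarrow> (\<exists>m G. m \<le> N \<and> mv D m G \<and> \<not> small (G ` D))" by (rule exE)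
  then obtain m G where "mv D m G" "\<not> small (G ` D)" using assms(2-4) by blast
  then obtain E where "ok E" using split_continuum[OF mv_good] assms(2) by blast
  then show False by (rule no_ok[OF assms(1)])
qed

text \<open>The new continuum is a limit of the grown images of arbitrarily small subcontinua of \<open>C0\<close>.\<close>

lemma grown_limit:
  assumes C0: "compact C0" "connected C0" "C0 \<subseteq> X" "flat C0" "x0 \<in> C0" "y0 \<in> C0" "x0 \<noteq> y0"
    and grow: "\<And>C x y. C \<subseteq> C0 \<Longrightarrow> compact C \<Longrightarrow> connected C \<Longrightarrow> x \<in> C \<Longrightarrow> y \<in> C \<Longrightarrow> x \<noteq> y \<Longrightarrow> \<exists>x\<in>C. \<exists>y\<in>C. \<exists>n. \<not> trk \<phi> \<epsilon> n x y"
  shows "\<exists>D x y. good D \<and> x \<in> D \<and> y \<in> D \<and> x \<noteq> y"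
proof -
  have "\<exists>E. connected E \<and> E \<subseteq> X \<and> E \<noteq> {} \<and> flat E \<and> \<not> small E \<and> (\<forall>x\<in>E. \<forall>y\<in>E. bwd n x y)" for n
  proof -
    from mv_modulus[OF rho(1), of n] obtain \<eta> where
      \<eta>: "\<eta> > 0 \<and> (\<forall>m\<le>n. \<forall>D G x y. D \<subseteq> X \<and> mv D m G \<and> x \<in> D \<and> y \<in> D \<and> dist x y \<le> \<eta> \<longrightarrow> dist (G x) (G y) < \<rho>)" by (rule exE)
    \<comment> \<open>\<open>2 * e \<le> \<eta>\<close> prevents growth during the first
      \<open>n\<close> transfers, \<open>2 * e \<le> \<rho> \<le> \<epsilon>\<close> lets the
      backward tracking start, and \<open>e < dist x0 y0\<close> allows boundary bumping at
      \<open>x0\<close>.\<close>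
    define e where "e = min (min \<eta> \<rho>) (dist x0 y0) / 2"
    have e: "e > 0" "2 * e \<le> \<eta>" "2 * e \<le> \<rho>" "e < dist x0 y0"
    proof -
      have "dist x0 y0 > 0" using C0(7) by simp
      moreover have "\<eta> > 0" using \<eta> by simp
      ultimately show "e > 0" "2 * e \<le> \<eta>" "2 * e \<le> \<rho>" "e < dist x0 y0" using rho(1) unfolding e_def by linarith+
    qed
    obtain C where C: "C \<subseteq> C0" "compact C" "connected C" "x0 \<in> C" "\<forall>x\<in>C. dist x0 x \<le> e" "\<exists>x\<in>C. dist x0 x = e"
      using subcontinuum_reaching[OF C0(1,2,5,6) e(4,1)] by blast
    have CX: "C \<subseteq> X" using C(1) C0(3) by blast
    have dC: "dist x y \<le> 2 * e" if "x \<in> C" "y \<in> C" for x y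
    proof -
      have "dist x0 x \<le> e" "dist x0 y \<le> e" using that C(5) by auto
      then show ?thesis using dist_triangle3[of x y x0] by linarith
    qed
    obtain x1 where "x1 \<in> C" "dist x0 x1 = e" using C(6) by blast
    then have "x1 \<in> C" "x0 \<noteq> x1" using e(1) by auto
    from grow[OF C(1-4) this] obtain x y n' where "x \<in> C" "y \<in> C" "\<not> trk \<phi> \<epsilon> n' x y" by blast
    then obtain m G where mG: "mv C m G" "\<not> small (G ` C)" using not_trk_grows[OF CX] by blast
    have mn: "n \<le> m"
    proof (rule ccontr)
      assume "\<not> n \<le> m"
      then have mn: "m \<le> n" by simp
      have "small (G ` C)"
        unfolding small_def
      proof (intro ballI)
        fix p q assume "p \<in> G ` C" "q \<in> G ` C"
        then obtain x y where xy: "x \<in> C" "y \<in> C" "p = G x" "q = G y" by blast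
        have "dist x y \<le> \<eta>" using dC[OF xy(1,2)] e(2) by linarith
        then have "dist (G x) (G y) < \<rho>" using \<eta>[THEN conjunct2, rule_format, OF mn, of C G x y] CX mG(1) xy(1,2) by simp
        then show "dist p q \<le> \<rho>" using xy(3,4) by simp
      qed
      then show False using mG(2) by simp
    qed
    have dCe: "\<forall>x\<in>C. \<forall>y\<in>C. dist x y \<le> \<epsilon>" using dC e(3) rho(2) by fastforce
    have "bwd n (G x) (G y)" if "x \<in> C" "y \<in> C" for x y
      by (rule trk_mono[OF mn]) (rule mv_bwd[OF mG(1) CX dCe that])
    then have "\<forall>x\<in>G ` C. \<forall>y\<in>G ` C. bwd n x y" by blast
    moreover have "connected (G ` C)" by (rule connected_continuous_image[OF mv_cont[OF mG(1)] C(3)])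
    moreover have "G ` C \<subseteq> X" using mv_in[OF mG(1) CX] by blast
    moreover have "flat (G ` C)" by (rule mv_flat[OF mG(1) flat_subset[OF C0(4) C(1)]])
    moreover have "G ` C \<noteq> {}" using C(4) by blast
    ultimately show ?thesis using mG(2) by (intro exI[of _ "G ` C"]) simp
  qed
  then have "\<forall>n. \<exists>E. connected E \<and> E \<subseteq> X \<and> E \<noteq> {} \<and> flat E \<and> \<not> small E \<and> (\<forall>x\<in>E. \<forall>y\<in>E. bwd n x y)" by (rule allI)
  then obtain E where E: "\<forall>n. connected (E n) \<and> E n \<subseteq> X \<and> E n \<noteq> {} \<and> flat (E n) \<and> \<not> small (E n) \<and> (\<forall>x\<in>E n. \<forall>y\<in>E n. bwd n x y)"
    by (rule choice[THEN exE])
  have E1: "connected (E n)" "E n \<subseteq> X" "E n \<noteq> {}" "flat (E n)" "\<not> small (E n)" for n using E by simp_all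
  have Eb: "bwd n x y" if "x \<in> E n" "y \<in> E n" for n x y using E that by simp
  from continua_limit[of X E, OF compX E1(1-3)] obtain s :: "nat \<Rightarrow> nat" and K where
    s: "strict_mono s" and K: "compact K" "connected K" "K \<subseteq> X" and
    l1: "\<forall>x\<in>K. \<exists>\<xi>. (\<forall>n. \<xi> n \<in> E (s n)) \<and> \<xi> \<longlonglongrightarrow> x" and
    l2: "\<forall>x \<xi> s'. strict_mono s' \<longrightarrow> (\<forall>n. \<xi> n \<in> E (s (s' n))) \<longrightarrow> \<xi> \<longlonglongrightarrow> x \<longrightarrow> x \<in> K"
    by (elim exE conjE)
  have "bwd n x y" if xy: "x \<in> K" "y \<in> K" for n x y
  proof -
    obtain \<xi> where \<xi>: "\<forall>n. \<xi> n \<in> E (s n)" "\<xi> \<longlonglongrightarrow> x" using l1 xy(1) by blast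
    obtain \<theta> where \<theta>: "\<forall>n. \<theta> n \<in> E (s n)" "\<theta> \<longlonglongrightarrow> y" using l1 xy(2) by blast
    show ?thesis
    proof (rule rev.trk_limit[OF \<xi>(2) \<theta>(2)])
      show "\<xi> k \<in> X" "\<theta> k \<in> X" for k using \<xi>(1) \<theta>(1) E1(2) by blast+
      fix i assume "n \<le> i"
      then have "n \<le> s i" using seq_suble[OF s, of i] by linarith
      moreover have "bwd (s i) (\<xi> i) (\<theta> i)" by (rule Eb) (simp_all add: \<xi> \<theta>)
      ultimately show "bwd n (\<xi> i) (\<theta> i)" by (rule trk_mono)
    qed
  qed
  moreover have "flat K"
  proof -
    have "\<forall>n. \<exists>z. z \<in> X \<and> (\<forall>x\<in>E (s n). x \<in> sect z)" using E1(4) unfolding flat_def by blast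
    then obtain \<zeta> where \<zeta>: "\<forall>n. \<zeta> n \<in> X \<and> (\<forall>x\<in>E (s n). x \<in> sect (\<zeta> n))" by (rule choice[THEN exE])
    then have "\<forall>n. \<zeta> n \<in> X" by simp
    with compX obtain z k where z: "z \<in> X" "strict_mono (k::nat\<Rightarrow>nat)" "(\<zeta> \<circ> k) \<longlonglongrightarrow> z" by (rule compactE_subseq)
    have "x \<in> sect z" if x: "x \<in> K" for x
    proof -
      obtain \<xi> where \<xi>: "\<forall>n. \<xi> n \<in> E (s n)" "\<xi> \<longlonglongrightarrow> x" using l1 x by blast
      show ?thesis
      proof (rule sect_limit[OF z(3)])
        show "(\<xi> \<circ> k) \<longlonglongrightarrow> x" by (rule LIMSEQ_subseq_LIMSEQ[OF \<xi>(2) z(2)])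
        show "(\<zeta> \<circ> k) i \<in> X" "(\<xi> \<circ> k) i \<in> sect ((\<zeta> \<circ> k) i)" for i using \<zeta> \<xi>(1) by simp_all
      qed
    qed
    then show ?thesis using z(1) by (auto simp: flat_def)
  qed
  ultimately have "good K" using K by (simp add: good_def)
  \<comment> \<open>Pairs more than \<rho> apart in the grown sets accumulate at a pair in
    \<open>K\<close> at distance at least \<rho>, so the limit does not degenerate.\<close>
  moreover have "\<exists>x\<in>K. \<exists>y\<in>K. x \<noteq> y"
  proof -
    have "\<forall>n. \<exists>p. fst p \<in> E (s n) \<and> snd p \<in> E (s n) \<and> \<rho> < dist (fst p) (snd p)"
    proof
      fix n
      obtain u v where "u \<in> E (s n)" "v \<in> E (s n)" "\<rho> < dist u v" using E1(5)[of "s n"] by (auto simp: small_def not_le)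
      then show "\<exists>p. fst p \<in> E (s n) \<and> snd p \<in> E (s n) \<and> \<rho> < dist (fst p) (snd p)" by (intro exI[of _ "(u, v)"]) simp
    qed
    then obtain p where p: "\<forall>n. fst (p n) \<in> E (s n) \<and> snd (p n) \<in> E (s n) \<and> \<rho> < dist (fst (p n)) (snd (p n))" by (rule choice[THEN exE])
    have "\<forall>n. p n \<in> X \<times> X" using p E1(2) by (metis mem_Times_iff subsetD)
    with compact_Times[OF compX compX] obtain l k where l: "l \<in> X \<times> X" "strict_mono (k::nat\<Rightarrow>nat)" "(p \<circ> k) \<longlonglongrightarrow> l" by (rule compactE_subseq)
    have lim: "(\<lambda>i. fst (p (k i))) \<longlonglongrightarrow> fst l" "(\<lambda>i. snd (p (k i))) \<longlonglongrightarrow> snd l"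
      using tendsto_fst[OF l(3)] tendsto_snd[OF l(3)] by (simp_all add: o_def)
    have "fst l \<in> K" using l2[rule_format, OF l(2) _ lim(1)] p by blast
    moreover have "snd l \<in> K" using l2[rule_format, OF l(2) _ lim(2)] p by blast
    moreover have "(\<lambda>i. dist (fst (p (k i))) (snd (p (k i)))) \<longlonglongrightarrow> dist (fst l) (snd l)" by (intro tendsto_dist lim)
    then have "\<rho> \<le> dist (fst l) (snd l)" by (rule LIMSEQ_le_const) (use p in \<open>auto intro: less_imp_le\<close>)
    then have "fst l \<noteq> snd l" using rho(1) by auto
    ultimately show ?thesis by blast
  qed
  ultimately show ?thesis by blast
qed

end

section \<open>Cross-sections and return maps\<close>

text \<open>\<open>trans\<close> and \<open>box\<close> are the two halves of a flow box: orbits do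
  not return to \<open>V\<close> too soon, and every point of \<open>X\<close> near \<open>V\<close>
  reaches \<open>V\<close> within a short time, forwards or backwards. With minimality this makes
  \<open>V\<close> a global section.\<close>

locale cross_section = compact_flow X \<phi> for X :: "'a::metric_space set" and \<phi> +
  fixes V :: "'a set" and a :: real
  assumes compV: "compact V" and VX: "V \<subseteq> X" and Vne: "V \<noteq> {}" and apos: "0 < a"
    and trans: "\<And>v s. v \<in> V \<Longrightarrow> \<phi> s v \<in> V \<Longrightarrow> \<bar>s\<bar> \<le> a \<Longrightarrow> s = 0"
    and box: "\<And>v \<eta>. v \<in> V \<Longrightarrow> \<eta> > 0 \<Longrightarrow> \<exists>\<rho>>0. \<forall>y\<in>X. dist v y < \<rho> \<longrightarrow> (\<exists>s. \<bar>s\<bar> < \<eta> \<and> \<phi> s y \<in> V)"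
    and td: "\<And>C. C \<subseteq> V \<Longrightarrow> connected C \<Longrightarrow> \<exists>x. C \<subseteq> {x}"
    and minimal: "minimal_flow X \<phi>" and expansive: "expansive_flow X \<phi>"

context compact_flow
begin

lemma sections_totally_disconnected:
  assumes minimal: "minimal_flow X \<phi>" and expansive: "expansive_flow X \<phi>" and S: "sectioned_flow X \<phi> F r a c"
    and z: "z \<in> X" and C: "C \<subseteq> sectioned_flow.sect X F r z" "connected C"
  shows "\<exists>x. C \<subseteq> {x}"
proof (rule ccontr)
  assume neg: "\<nexists>x. C \<subseteq> {x}"
  interpret sf: sectioned_flow X \<phi> F r a c by fact
  interpret rf: sectioned_flow X "\<lambda>t. \<phi> (- t)" "\<lambda>z y. - F z y" r a c by (rule sectioned_flow_reverse[OF S])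
  from expansive_trk[OF expansive sf.apos] obtain \<epsilon>0 where
    \<epsilon>0: "\<epsilon>0 > 0 \<and> (\<forall>\<epsilon>\<le>\<epsilon>0. \<forall>x\<in>X. \<forall>y\<in>X. (\<forall>n. trk \<phi> \<epsilon> n x y) \<and> (\<forall>n. trk (\<lambda>t. \<phi> (- t)) \<epsilon> n x y) \<longrightarrow> (\<exists>s. \<bar>s\<bar> \<le> a \<and> y = \<phi> s x))" by (rule exE)
  define \<epsilon> where "\<epsilon> = min \<epsilon>0 (min (a/2) (1/2))"
  have \<epsilon>: "0 < \<epsilon>" "2 * \<epsilon> \<le> a" "\<epsilon> \<le> 1/2" "\<epsilon> \<le> \<epsilon>0" using \<epsilon>0 sf.apos by (auto simp: \<epsilon>_def)
  from sf.step_exists[OF \<epsilon>(1,2)] obtain \<rho>1 where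
    \<rho>1: "\<rho>1 > 0 \<and> (\<forall>C\<subseteq>X. (\<forall>x\<in>C. \<forall>y\<in>C. dist x y \<le> \<rho>1) \<and> C \<noteq> {} \<longrightarrow> (\<exists>g. sf.step \<epsilon> C g))" by (rule exE)
  from rf.step_exists[OF \<epsilon>(1,2)] obtain \<rho>2 where
    \<rho>2: "\<rho>2 > 0 \<and> (\<forall>C\<subseteq>X. (\<forall>x\<in>C. \<forall>y\<in>C. dist x y \<le> \<rho>2) \<and> C \<noteq> {} \<longrightarrow> (\<exists>g. rf.step \<epsilon> C g))" by (rule exE)
  \<comment> \<open>The flow and its reverse share \<epsilon> and \<rho>, so that forward tracking
    for one is backward tracking for the other.\<close>
  define \<rho> where "\<rho> = min \<epsilon> (min \<rho>1 \<rho>2)"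
  have \<rho>: "0 < \<rho>" "\<rho> \<le> \<epsilon>" "\<rho> \<le> \<rho>1" "\<rho> \<le> \<rho>2" using \<epsilon> \<rho>1 \<rho>2 by (auto simp: \<rho>_def)
  have exp: "\<exists>s. \<bar>s\<bar> \<le> a \<and> y = \<phi> s x" if "x \<in> X" "y \<in> X" "\<forall>n. trk \<phi> \<epsilon> n x y" "\<forall>n. trk (\<lambda>t. \<phi> (- t)) \<epsilon> n x y" for x y
    using \<epsilon>0[THEN conjunct2, rule_format, OF \<epsilon>(4) that(1,2)] that(3,4) by simp
  interpret g: growth_flow X \<phi> F r a c \<epsilon> \<rho>
  proof
    fix C assume C: "C \<subseteq> X" "\<forall>x\<in>C. \<forall>y\<in>C. dist x y \<le> \<rho>" "C \<noteq> {}"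
    have "\<forall>x\<in>C. \<forall>y\<in>C. dist x y \<le> \<rho>1" using C(2) \<rho>(3) by fastforce
    then show "\<exists>g. sf.step \<epsilon> C g" using \<rho>1[THEN conjunct2, rule_format, OF C(1)] C(3) by simp
  qed (use \<epsilon> \<rho> in simp_all, rule exp)
  interpret h: growth_flow X "\<lambda>t. \<phi> (- t)" "\<lambda>z y. - F z y" r a c \<epsilon> \<rho>
  proof
    fix C assume C: "C \<subseteq> X" "\<forall>x\<in>C. \<forall>y\<in>C. dist x y \<le> \<rho>" "C \<noteq> {}"
    have "\<forall>x\<in>C. \<forall>y\<in>C. dist x y \<le> \<rho>2" using C(2) \<rho>(4) by fastforce
    then show "\<exists>g. rf.step \<epsilon> C g" using \<rho>2[THEN conjunct2, rule_format, OF C(1)] C(3) by simp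
  next
    fix x y assume A: "x \<in> X" "y \<in> X" "\<forall>n. trk (\<lambda>t. \<phi> (- t)) \<epsilon> n x y" "\<forall>n. trk (\<lambda>t. \<phi> (- (- t))) \<epsilon> n x y"
    have "\<forall>n. trk \<phi> \<epsilon> n x y" using A(4) by simp
    then obtain s where "\<bar>s\<bar> \<le> a" "y = \<phi> s x" using exp[OF A(1,2) _ A(3)] by blast
    then show "\<exists>s. \<bar>s\<bar> \<le> a \<and> y = \<phi> (- s) x" by (intro exI[of _ "- s"]) simp
  qed (use \<epsilon> \<rho> in simp_all)
  define C0 where "C0 = closure C"
  have csz: "compact (sf.sect z)" by (rule sf.compact_sect[OF z])
  have C0s: "C0 \<subseteq> sf.sect z" unfolding C0_def using C(1) csz by (simp add: closure_minimal compact_imp_closed)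
  have "closed C0" by (simp add: C0_def)
  then have cC0: "compact C0" using compact_Int_closed[OF csz] C0s by (metis inf.absorb2)
  have conC0: "connected C0" unfolding C0_def using C(2) by (rule connected_imp_connected_closure)
  have C0X: "C0 \<subseteq> X" using C0s sf.sect_sub by blast
  have fl: "g.flat C0" unfolding g.flat_def using z C0s by blast
  have "C \<noteq> {}" using neg by blast
  then obtain x0 where x0: "x0 \<in> C" by blast
  then obtain y0 where y0: "y0 \<in> C" "x0 \<noteq> y0" using neg by blast
  have xy0: "x0 \<in> C0" "y0 \<in> C0" using x0 y0 closure_subset[of C] by (auto simp: C0_def)
  show False
  proof (cases "\<exists>D x y. D \<subseteq> C0 \<and> compact D \<and> connected D \<and> x \<in> D \<and> y \<in> D \<and> x \<noteq> y \<and> (\<forall>x\<in>D. \<forall>y\<in>D. \<forall>n. trk \<phi> \<epsilon> n x y)")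
    case True
    then obtain D x y where D: "D \<subseteq> C0" "compact D" "connected D" "x \<in> D" "y \<in> D" "x \<noteq> y" "\<forall>x\<in>D. \<forall>y\<in>D. \<forall>n. trk \<phi> \<epsilon> n x y" by blast
    have "rf.sect z = sf.sect z" unfolding rf.sect_def sf.sect_def by simp
    then have "h.flat D" unfolding h.flat_def using z C0s D(1) by blast
    then have "h.good D" unfolding h.good_def using D(1-3,7) C0X by simp
    then have "x = y" using D(4,5) by (rule h.no_good[OF minimal_flow_reverse[OF minimal]])
    then show False using D(6) by simp
  next
    case False
    have grow: "\<exists>x\<in>D. \<exists>y\<in>D. \<exists>n. \<not> trk \<phi> \<epsilon> n x y" if "D \<subseteq> C0" "compact D" "connected D" "x \<in> D" "y \<in> D" "x \<noteq> y" for D x y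
      using False that by blast
    have "\<exists>D x y. g.good D \<and> x \<in> D \<and> y \<in> D \<and> x \<noteq> y"
      by (rule g.grown_limit[OF cC0 conC0 C0X fl xy0 y0(2)]) (rule grow)
    then obtain D x y where "g.good D" "x \<in> D" "y \<in> D" "x \<noteq> y" by blast
    then show False using g.no_good[OF minimal] by blast
  qed
qed

text \<open>The danger for \<open>box\<close> is the rim of a local section, where crossings may
  leave the ball of radius \<open>r\<close>. A clopen partition of mesh below \<open>r\<close>
  avoids it: the piece \<open>V\<close> of \<open>z\<close> lies in the open ball, and being
  relatively open in the section it retains all nearby crossings.\<close>

lemma cross_section_exists:
  assumes minimal: "minimal_flow X \<phi>" and expansive: "expansive_flow X \<phi>" and nt: "\<exists>x\<in>X. \<exists>y\<in>X. x \<noteq> y"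
  shows "\<exists>V a. cross_section X \<phi> V a"
proof -
  have "\<exists>\<tau>>0. \<forall>x\<in>X. \<forall>s. 0 < s \<and> s \<le> \<tau> \<longrightarrow> \<phi> s x \<noteq> x"
    by (rule no_small_periods) (rule minimal_no_fixed[OF minimal nt])
  then obtain \<tau> where
    \<tau>: "\<tau> > 0 \<and> (\<forall>x\<in>X. \<forall>s. 0 < s \<and> s \<le> \<tau> \<longrightarrow> \<phi> s x \<noteq> x)" by (rule exE)
  have \<tau>2: "\<phi> s x \<noteq> x" if "x \<in> X" "0 < s" "s \<le> \<tau>" for x s using \<tau> that by blast
  obtain z where z: "z \<in> X" using nt by blast
  then have "X \<noteq> {}" by blast
  then have "\<exists>F r a c. sectioned_flow X \<phi> F r a c"
    by (rule section_function_exists[of \<tau>, rotated 2]) (use \<tau> \<tau>2 in auto)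
  then obtain F r a c where S: "sectioned_flow X \<phi> F r a c" by (elim exE)
  interpret sf: sectioned_flow X \<phi> F r a c by fact
  let ?K = "sf.sect z"
  have K: "compact ?K" by (rule sf.compact_sect[OF z])
  have tdK: "\<exists>x. C \<subseteq> {x}" if "C \<subseteq> ?K" "connected C" for C
    by (rule sections_totally_disconnected[OF minimal expansive S z that])
  have "\<exists>P::'a \<Rightarrow> nat. finite (P ` ?K) \<and> continuous_on ?K P \<and> (\<forall>x\<in>?K. \<forall>y\<in>?K. P x = P y \<longrightarrow> dist x y < r)"
    by (rule zero_dim_labelling[OF K _ sf.rpos]) (rule tdK)
  then obtain P :: "'a \<Rightarrow> nat" where
    P: "finite (P ` ?K) \<and> continuous_on ?K P \<and> (\<forall>x\<in>?K. \<forall>y\<in>?K. P x = P y \<longrightarrow> dist x y < r)" by (rule exE)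
  define V where "V = ?K \<inter> P -` {P z}"
  have zK: "z \<in> ?K" using z sf.rpos by (simp add: sf.sect_def)
  have VK: "V \<subseteq> ?K" by (auto simp: V_def)
  have "closed V" unfolding V_def using P K by (intro continuous_closed_preimage) (auto simp: compact_imp_closed)
  then have "compact V" unfolding V_def by (rule compact_Int_of_closed[OF K])
  moreover have "V \<subseteq> X" using VK sf.sect_sub by blast
  moreover have "V \<noteq> {}" using zK by (auto simp: V_def)
  moreover have "s = 0" if "v \<in> V" "\<phi> s v \<in> V" "\<bar>s\<bar> \<le> a" for v s
    using sf.transversal[OF z, of v s] VK that by blast
  moreover have "\<exists>\<rho>>0. \<forall>y\<in>X. dist v y < \<rho> \<longrightarrow> (\<exists>s. \<bar>s\<bar> < \<eta> \<and> \<phi> s y \<in> V)" if v: "v \<in> V" and \<eta>: "\<eta> > 0" for v \<eta>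
  proof -
    have vK: "v \<in> ?K" "P v = P z" "v \<in> X" "F z v = F z z" "dist z v \<le> r" using v by (auto simp: V_def sf.sect_def)
    have dzv: "dist z v < r" using P zK vK(1,2) by metis
    have "open {P v}" by (simp add: open_discrete)
    then obtain W where W: "open W" "W \<inter> ?K = P -` {P v} \<inter> ?K" using P by (metis continuous_on_open_invariant)
    have "v \<in> W" using W(2) vK(1) by blast
    then obtain \<delta> where \<delta>: "\<delta> > 0" "ball v \<delta> \<subseteq> W" using W(1) open_contains_ball by blast
    have PK: "P x = P z" if "x \<in> ?K" "dist v x < \<delta>" for x
    proof -
      have "x \<in> W \<inter> ?K" using that \<delta>(2) by auto
      then have "x \<in> P -` {P v}" using W(2) by blast
      then show ?thesis using vK(2) by simp
    qed
    \<comment> \<open>Within \<delta> of \<open>v\<close> a crossing keeps the label of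
      \<open>z\<close>; within \<open>r - dist z v\<close> it stays in the ball that defines the
      section.\<close>
    define m where "m = min \<delta> (r - dist z v)"
    have "m > 0" using \<delta>(1) dzv by (simp add: m_def)
    then obtain \<kappa> where \<kappa>: "\<kappa> > 0" "flow_modulus 0 \<kappa> m" using flow_uniform by blast
    define h where "h = min \<kappa> (min a (\<eta>/2))"
    have h: "h > 0" "h \<le> \<kappa>" "h \<le> a" "h < \<eta>" using \<kappa>(1) sf.apos \<eta> by (auto simp: h_def)
    have up: "F z z < F z (\<phi> h v)" and dn: "F z (\<phi> (- h) v) < F z z"
    proof -
      have "c * h > 0" using sf.cpos h(1) by simp
      then show "F z z < F z (\<phi> h v)" "F z (\<phi> (- h) v) < F z z"
        using sf.incr[OF z vK(3,5), of 0 h] sf.incr[OF z vK(3,5), of "- h" 0] h vK(3,4) by simp_all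
    qed
    have "continuous_on X (\<lambda>y. F z (\<phi> h y))" "continuous_on X (\<lambda>y. F z (\<phi> (- h) y))"
      using z by (auto intro!: sf.continuous_on_F continuous_on_flow continuous_intros)
    then obtain d1 d2 where d: "d1 > 0" "\<forall>y\<in>X. dist y v < d1 \<longrightarrow> dist (F z (\<phi> h y)) (F z (\<phi> h v)) < F z (\<phi> h v) - F z z"
      "d2 > 0" "\<forall>y\<in>X. dist y v < d2 \<longrightarrow> dist (F z (\<phi> (- h) y)) (F z (\<phi> (- h) v)) < F z z - F z (\<phi> (- h) v)"
      using vK(3) up dn unfolding continuous_on_iff by (metis diff_gt_0_iff_gt)
    have "\<exists>s. \<bar>s\<bar> < \<eta> \<and> \<phi> s y \<in> V" if y: "y \<in> X" "dist v y < min \<kappa> (min d1 d2)" for y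
    proof -
      have "F z z < F z (\<phi> h y)" "F z (\<phi> (- h) y) < F z z"
        using d(2)[rule_format, OF y(1)] d(4)[rule_format, OF y(1)] y(2) by (auto simp: dist_commute dist_real_def)
      then have "\<exists>s\<ge>-h. s \<le> h \<and> F z (\<phi> s y) = F z z"
        using h(1) y(1) z by (intro IVT' sf.continuous_on_F continuous_on_flow continuous_intros) auto
      then obtain s where s: "- h \<le> s" "s \<le> h" "F z (\<phi> s y) = F z z" by blast
      have "dist (\<phi> 0 v) (\<phi> s y) < m"
        using s h y vK(3) by (intro flow_modulusD[OF \<kappa>(2)]) auto
      then have ds: "dist v (\<phi> s y) < \<delta>" "dist v (\<phi> s y) < r - dist z v" using vK(3) by (simp_all add: m_def)
      then have "dist z (\<phi> s y) \<le> r" using dist_triangle[of z "\<phi> s y" v] by linarith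
      then have sK: "\<phi> s y \<in> ?K" using y(1) s(3) by (simp add: sf.sect_def)
      then have "\<phi> s y \<in> V" using PK[OF sK ds(1)] by (simp add: V_def)
      moreover have "\<bar>s\<bar> < \<eta>" using s h(4) by linarith
      ultimately show ?thesis by blast
    qed
    then show ?thesis using \<kappa>(1) d(1,3) by (intro exI[of _ "min \<kappa> (min d1 d2)"]) simp
  qed
  moreover have "\<exists>x. C \<subseteq> {x}" if "C \<subseteq> V" "connected C" for C using tdK[OF _ that(2)] that(1) VK by blast
  ultimately have "cross_section X \<phi> V a"
    using minimal expansive sf.apos by unfold_locales
  then show ?thesis by blast
qed

end

section \<open>Integer iterates and signed sums\<close>

text \<open>\<open>f\<close> will be a bijection of \<open>V\<close> only, so negative powers use
  the inverse relative to \<open>V\<close>.\<close>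

definition ipow :: "'a set \<Rightarrow> ('a \<Rightarrow> 'a) \<Rightarrow> int \<Rightarrow> 'a \<Rightarrow> 'a" where
  "ipow V f k = (if 0 \<le> k then f ^^ nat k else inv_into V f ^^ nat (- k))"

lemma ipow_0 [simp]: "ipow V f 0 v = v"
  by (simp add: ipow_def)

lemma ipow_in:
  assumes "bij_betw f V V" "v \<in> V" shows "ipow V f k v \<in> V"
proof -
  have f: "f x \<in> V" if "x \<in> V" for x using bij_betwE[OF assms(1)] that by (rule bspec)
  have i: "inv_into V f x \<in> V" if "x \<in> V" for x
    by (rule inv_into_into) (simp add: bij_betw_imp_surj_on[OF assms(1)] that)
  have "(f ^^ n) v \<in> V" for n by (induction n) (simp_all add: assms(2) f)
  moreover have "(inv_into V f ^^ n) v \<in> V" for n by (induction n) (simp_all add: assms(2) i)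
  ultimately show ?thesis by (simp add: ipow_def)
qed

lemma ipow_Suc:
  assumes "bij_betw f V V" "v \<in> V" shows "ipow V f (k + 1) v = f (ipow V f k v)"
proof (cases "0 \<le> k")
  case True
  then have "nat (k + 1) = Suc (nat k)" by simp
  then show ?thesis using True by (simp add: ipow_def)
next
  case False
  define m where "m = nat (- k - 1)"
  have m: "nat (- k) = Suc m" using False by (simp add: m_def)
  have fi: "f (inv_into V f x) = x" if "x \<in> V" for x using assms(1) that by (simp add: bij_betw_inv_into_right)
  have 1: "ipow V f (k + 1) v = (inv_into V f ^^ m) v"
  proof (cases "k = -1")
    case True then show ?thesis by (simp add: ipow_def m_def)
  next
    case False
    then have "nat (- (k + 1)) = m" "\<not> 0 \<le> k + 1" using \<open>\<not> 0 \<le> k\<close> by (auto simp: m_def)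
    then show ?thesis by (simp only: ipow_def if_False)
  qed
  have "(inv_into V f ^^ m) v \<in> V" using ipow_in[OF assms, of "k + 1"] by (simp add: 1)
  then have "f (inv_into V f ((inv_into V f ^^ m) v)) = (inv_into V f ^^ m) v" by (rule fi)
  moreover have "ipow V f k v = inv_into V f ((inv_into V f ^^ m) v)" using False m by (simp add: ipow_def)
  ultimately show ?thesis using 1 by simp
qed

lemma ipow_add:
  assumes "bij_betw f V V" "v \<in> V" shows "ipow V f (k + m) v = ipow V f k (ipow V f m v)"
proof (induction k rule: int_induct[where k = 0])
  case base
  then show ?case by simp
next
  case (step1 i)
  have "ipow V f (i + 1 + m) v = f (ipow V f (i + m) v)" using ipow_Suc[OF assms, of "i + m"] by (simp add: algebra_simps)
  also have "\<dots> = ipow V f (i + 1) (ipow V f m v)" using step1 ipow_Suc[OF assms(1) ipow_in[OF assms]] by simp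
  finally show ?case .
next
  case (step2 i)
  have "f (ipow V f (i - 1 + m) v) = ipow V f (i + m) v" using ipow_Suc[OF assms, of "i - 1 + m"] by simp
  also have "\<dots> = f (ipow V f (i - 1) (ipow V f m v))" using step2 ipow_Suc[OF assms(1) ipow_in[OF assms], of "i - 1"] by simp
  finally have "f (ipow V f (i - 1 + m) v) = f (ipow V f (i - 1) (ipow V f m v))" .
  moreover have "inj_on f V" using assms(1) bij_betw_imp_inj_on by blast
  ultimately show ?case using inj_onD ipow_in[OF assms(1)] ipow_in[OF assms] assms(2) by metis
qed

text \<open>The sign convention for negative \<open>k\<close> makes \<open>isum_Suc\<close> valid at
  every integer; \<open>roof_sum\<close> is the case of the roof along a shift orbit.\<close>

definition isum :: "(int \<Rightarrow> real) \<Rightarrow> int \<Rightarrow> real" where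
  "isum g k = (if 0 \<le> k then (\<Sum>j\<in>{0..<k}. g j) else - (\<Sum>j\<in>{k..<0}. g j))"

lemma isum_0 [simp]: "isum g 0 = 0"
  by (simp add: isum_def)

lemma isum_Suc: "isum g (k + 1) = isum g k + g k"
proof (cases "0 \<le> k")
  case True
  then have "{0..<k + 1} = insert k {0..<k}" by auto
  then show ?thesis using True by (simp add: isum_def)
next
  case False
  then have "{k..<0} = insert k {k + 1..<0}" by auto
  then show ?thesis using False by (cases "k = -1") (simp_all add: isum_def)
qed

lemma roof_sum_isum: "roof_sum r y k = isum (\<lambda>j. r (shiftk j y)) k"
  by (simp add: roof_sum_def isum_def)

lemma roof_sum_0 [simp]: "roof_sum r y 0 = 0"
  by (simp add: roof_sum_isum)

lemma roof_sum_Suc: "roof_sum r y (k + 1) = roof_sum r y k + r (shiftk k y)"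
  by (simp add: roof_sum_isum isum_Suc)

context cross_section
begin

sublocale rev: compact_flow X "\<lambda>t. \<phi> (- t)"
  by unfold_locales (rule compX is_flow_reverse[OF flow])+

lemma V_in_X: "v \<in> V \<Longrightarrow> v \<in> X"
  using VX by blast

lemma hit_near:
  assumes "x \<in> X" "u \<in> V" "e > 0"
  shows "\<exists>t\<ge>T. \<phi> t x \<in> V \<and> dist u (\<phi> t x) < e"
proof -
  have uX: "u \<in> X" using assms(2) VX by blast
  obtain \<kappa> where \<kappa>: "\<kappa> > 0" "\<kappa> \<le> 1" "flow_modulus 0 \<kappa> e" using flow_uniform[OF assms(3)] by blast
  from box[OF assms(2) \<kappa>(1)] obtain \<rho> where \<rho>: "\<rho> > 0 \<and> (\<forall>y\<in>X. dist u y < \<rho> \<longrightarrow> (\<exists>s. \<bar>s\<bar> < \<kappa> \<and> \<phi> s y \<in> V))" by (rule exE)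
  have "u \<in> ball u (min \<rho> \<kappa>)" using \<rho> \<kappa> by simp
  \<comment> \<open>Reaching \<open>V\<close> costs a correction of less than
    \<open>\<kappa> \<le> 1\<close> in time, hence \<open>T + 1\<close>.\<close>
  from recurrence[OF minimal assms(1) open_ball this uX, of "T + 1"] obtain t where
    t: "t \<ge> T + 1 \<and> \<phi> t x \<in> ball u (min \<rho> \<kappa>)" by (rule exE)
  have xt: "\<phi> t x \<in> X" using assms(1) by simp
  then obtain s where s: "\<bar>s\<bar> < \<kappa>" "\<phi> s (\<phi> t x) \<in> V" using \<rho> t by auto
  have "dist (\<phi> 0 u) (\<phi> s (\<phi> t x)) < e"
    using s(1) t xt uX by (intro flow_modulusD[OF \<kappa>(3)]) auto
  then have "dist u (\<phi> (t + s) x) < e" using uX assms(1) by simp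
  moreover have "\<phi> (t + s) x \<in> V" using s(2) assms(1) by simp
  moreover have "t + s \<ge> T" using t s(1) \<kappa>(2) by linarith
  ultimately show ?thesis by blast
qed

lemma hit_backward:
  assumes "x \<in> X"
  shows "\<exists>t\<ge>0. \<phi> (- t) x \<in> V"
proof -
  obtain u where u: "u \<in> V" "u \<in> X" using Vne VX by blast
  from box[OF u(1) zero_less_one] obtain \<rho> where \<rho>: "\<rho> > 0 \<and> (\<forall>y\<in>X. dist u y < \<rho> \<longrightarrow> (\<exists>s. \<bar>s\<bar> < 1 \<and> \<phi> s y \<in> V))" by (rule exE)
  have "u \<in> ball u \<rho>" using \<rho> by simp
  from rev.recurrence[OF minimal_flow_reverse[OF minimal] assms open_ball this u(2), of 1] obtain t where
    t: "t \<ge> 1 \<and> \<phi> (- t) x \<in> ball u \<rho>" by (rule exE)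
  have "\<phi> (- t) x \<in> X" using assms by simp
  then obtain s where s: "\<bar>s\<bar> < 1" "\<phi> s (\<phi> (- t) x) \<in> V" using \<rho> t by auto
  have "\<phi> (- (t - s)) x \<in> V" using s(2) assms by (simp add: algebra_simps)
  moreover have "t - s \<ge> 0" using s(1) t by linarith
  ultimately show ?thesis by blast
qed

text \<open>The first return time. By \<open>trans\<close> there is no return at positive times up
  to \<open>a\<close>, so starting at \<open>a\<close> gives the same infimum and makes the set of
  times closed, so that the infimum is attained.\<close>

definition ret :: "'a \<Rightarrow> real" where
  "ret v = Inf {t. a \<le> t \<and> \<phi> t v \<in> V}"

lemma ret:
  assumes v: "v \<in> V"
  shows "a \<le> ret v" "\<phi> (ret v) v \<in> V" "\<And>t. 0 < t \<Longrightarrow> t < ret v \<Longrightarrow> \<phi> t v \<notin> V"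
proof -
  let ?R = "{t. a \<le> t \<and> \<phi> t v \<in> V}"
  have vX: "v \<in> X" using v VX by blast
  have "continuous_on UNIV (\<lambda>t. \<phi> t v)" using vX by (intro continuous_on_flow continuous_intros) auto
  then have "closed ((\<lambda>t. \<phi> t v) -` V)" using compact_imp_closed[OF compV] continuous_on_closed_vimage[of UNIV "\<lambda>t. \<phi> t v"] by auto
  then have "closed ({a..} \<inter> (\<lambda>t. \<phi> t v) -` V)" by (intro closed_Int) auto
  also have "{a..} \<inter> (\<lambda>t. \<phi> t v) -` V = ?R" by auto
  finally have cl: "closed ?R" .
  have ne: "?R \<noteq> {}" using hit_near[OF vX v zero_less_one, of a] by blast
  have bd: "bdd_below ?R" by (rule bdd_belowI[of _ a]) auto
  have "ret v \<in> ?R" unfolding ret_def by (rule closed_contains_Inf[OF ne bd cl])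
  then show "a \<le> ret v" "\<phi> (ret v) v \<in> V" by auto
  show "\<phi> t v \<notin> V" if t: "0 < t" "t < ret v" for t
  proof
    assume h: "\<phi> t v \<in> V"
    have "\<not> t \<le> a" using trans[OF v h] t(1) by auto
    then have "t \<in> ?R" using h by simp
    then have "ret v \<le> t" unfolding ret_def by (rule cInf_lower[OF _ bd])
    then show False using t by simp
  qed
qed

lemma ret_pos: "v \<in> V \<Longrightarrow> 0 < ret v"
  using ret(1) apos by fastforce

text \<open>Upper bound: \<open>box\<close> at the return point of \<open>v\<close> gives nearby
  points a visit at almost the same time, still positive because \<open>\<eta> < a\<close>. Lower
  bound: from time \<open>a\<close> to \<open>ret v - e\<close> the orbit of \<open>v\<close> keeps
  a positive distance from \<open>V\<close>, which nearby orbits cannot bridge.\<close>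

lemma continuous_ret: "continuous_on V ret"
  unfolding continuous_on_iff
proof (intro ballI allI impI)
  fix v and e :: real assume v: "v \<in> V" and e: "e > 0"
  define \<eta> where "\<eta> = min e a / 2"
  have \<eta>: "\<eta> > 0" "\<eta> < e" "\<eta> < a" using e apos by (auto simp: \<eta>_def)
  have vX: "v \<in> X" using v VX by blast
  from box[OF ret(2)[OF v] \<eta>(1)] obtain \<rho> where
    \<rho>: "\<rho> > 0 \<and> (\<forall>y\<in>X. dist (\<phi> (ret v) v) y < \<rho> \<longrightarrow> (\<exists>s. \<bar>s\<bar> < \<eta> \<and> \<phi> s y \<in> V))" by (rule exE)
  obtain \<kappa>1 where \<kappa>1: "\<kappa>1 > 0" "flow_modulus \<bar>ret v\<bar> \<kappa>1 \<rho>" using flow_uniform[OF \<rho>[THEN conjunct1]] by blast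
  have upper: "ret w < ret v + e" if w: "w \<in> V" "dist w v < \<kappa>1" for w
  proof -
    have wX: "w \<in> X" using w VX by blast
    have "dist (\<phi> (ret v) v) (\<phi> (ret v) w) < \<rho>"
      using w(2) \<kappa>1(1) vX wX by (intro flow_modulusD[OF \<kappa>1(2)]) (auto simp: dist_commute)
    then obtain s where s: "\<bar>s\<bar> < \<eta>" "\<phi> s (\<phi> (ret v) w) \<in> V" using \<rho> wX by auto
    then have "\<phi> (ret v + s) w \<in> V" using wX by simp
    moreover have "0 < ret v + s" using s(1) \<eta>(3) ret(1)[OF v] by linarith
    ultimately have "ret w \<le> ret v + s" using ret(3)[OF w(1)] not_le by blast
    then show ?thesis using s(1) \<eta>(2) by linarith
  qed
  have "\<exists>\<kappa>2>0. \<forall>w\<in>V. dist w v < \<kappa>2 \<longrightarrow> ret v - e < ret w"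
  proof (cases "a \<le> ret v - e")
    case False
    then have "\<forall>w\<in>V. ret v - e < ret w" using ret(1) by fastforce
    then show ?thesis by (intro exI[of _ 1]) simp
  next
    case True
    let ?I = "{a..ret v - e}"
    have "continuous_on ?I (\<lambda>t. infdist (\<phi> t v) V)" using vX by (intro continuous_on_infdist continuous_on_flow continuous_intros) auto
    moreover have "compact ?I" "?I \<noteq> {}" using True by auto
    ultimately obtain t0 where t0: "t0 \<in> ?I" "\<forall>t\<in>?I. infdist (\<phi> t0 v) V \<le> infdist (\<phi> t v) V" using continuous_attains_inf by blast
    have "\<phi> t0 v \<notin> V" using ret(3)[OF v, of t0] t0(1) apos e by auto
    then have m: "infdist (\<phi> t0 v) V > 0" using infdist_pos_not_in_closed[OF compact_imp_closed[OF compV] Vne] by blast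
    obtain \<kappa>2 where \<kappa>2: "\<kappa>2 > 0" "flow_modulus \<bar>ret v - e\<bar> \<kappa>2 (infdist (\<phi> t0 v) V)" using flow_uniform[OF m] by blast
    have "ret v - e < ret w" if w: "w \<in> V" "dist w v < \<kappa>2" for w
    proof (rule ccontr)
      assume "\<not> ret v - e < ret w"
      then have t: "ret w \<in> ?I" using ret(1)[OF w(1)] by simp
      have wX: "w \<in> X" using w VX by blast
      have "dist (\<phi> (ret w) v) (\<phi> (ret w) w) < infdist (\<phi> t0 v) V"
        using w(2) \<kappa>2(1) vX wX t apos by (intro flow_modulusD[OF \<kappa>2(2)]) (auto simp: dist_commute)
      moreover have "infdist (\<phi> (ret w) v) V \<le> dist (\<phi> (ret w) v) (\<phi> (ret w) w)" by (rule infdist_le[OF ret(2)[OF w(1)]])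
      ultimately show False using t0(2) t by fastforce
    qed
    then show ?thesis using \<kappa>2(1) by blast
  qed
  then obtain \<kappa>2 where \<kappa>2: "\<kappa>2 > 0" "\<forall>w\<in>V. dist w v < \<kappa>2 \<longrightarrow> ret v - e < ret w" by blast
  have "dist (ret w) (ret v) < e" if "w \<in> V" "dist w v < min \<kappa>1 \<kappa>2" for w
    using upper[OF that(1)] \<kappa>2(2) that by (auto simp: dist_real_def abs_less_iff)
  then show "\<exists>d>0. \<forall>w\<in>V. dist w v < d \<longrightarrow> dist (ret w) (ret v) < e" using \<kappa>1(1) \<kappa>2(1) by (intro exI[of _ "min \<kappa>1 \<kappa>2"]) simp
qed

text \<open>The Poincare return map of \<open>V\<close>.\<close>

definition fm :: "'a \<Rightarrow> 'a" where
  "fm v = \<phi> (ret v) v"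

lemma continuous_fm: "continuous_on V fm"
  unfolding fm_def using VX by (intro continuous_on_flow continuous_ret continuous_on_id) auto

lemma first_return:
  assumes "v \<in> V" "0 \<le> t" "t \<le> ret v" "\<phi> t v \<in> V"
  shows "t = 0 \<or> t = ret v"
  using ret(3)[OF assms(1), of t] assms by linarith

text \<open>\<open>t\<close> is the time elapsed since the last visit to \<open>V\<close>; a return
  within \<open>t\<close> would be a later visit.\<close>

lemma reach_from_V:
  assumes x: "x \<in> X"
  shows "\<exists>v\<in>V. \<exists>t. 0 \<le> t \<and> t < ret v \<and> x = \<phi> t v"
proof -
  let ?R = "{t. 0 \<le> t \<and> \<phi> (- t) x \<in> V}"
  have "continuous_on UNIV (\<lambda>t. \<phi> (- t) x)" using x by (intro continuous_on_flow continuous_intros) auto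
  then have "closed ((\<lambda>t. \<phi> (- t) x) -` V)" using compact_imp_closed[OF compV] continuous_on_closed_vimage[of UNIV "\<lambda>t. \<phi> (- t) x"] by auto
  then have "closed ({0..} \<inter> (\<lambda>t. \<phi> (- t) x) -` V)" by (intro closed_Int) auto
  also have "{0..} \<inter> (\<lambda>t. \<phi> (- t) x) -` V = ?R" by auto
  finally have cl: "closed ?R" .
  have ne: "?R \<noteq> {}" using hit_backward[OF x] by blast
  have bd: "bdd_below ?R" by (rule bdd_belowI[of _ 0]) auto
  define t where "t = Inf ?R"
  have "t \<in> ?R" unfolding t_def by (rule closed_contains_Inf[OF ne bd cl])
  then have t: "0 \<le> t" "\<phi> (- t) x \<in> V" by auto
  have "t < ret (\<phi> (- t) x)"
  proof (rule ccontr)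
    assume "\<not> ?thesis"
    then have le: "ret (\<phi> (- t) x) \<le> t" by simp
    have "\<phi> (ret (\<phi> (- t) x)) (\<phi> (- t) x) \<in> V" by (rule ret(2)[OF t(2)])
    then have "\<phi> (- (t - ret (\<phi> (- t) x))) x \<in> V" using x by (simp add: algebra_simps)
    then have "t - ret (\<phi> (- t) x) \<in> ?R" using le by simp
    then have "t \<le> t - ret (\<phi> (- t) x)" unfolding t_def by (rule cInf_lower[OF _ bd])
    then show False using ret_pos[OF t(2)] by simp
  qed
  moreover have "x = \<phi> t (\<phi> (- t) x)" using x by simp
  ultimately show ?thesis using t by blast
qed

text \<open>If two points have the same image, the one with the shorter return time lies on the
  orbit of the other before its first return, so they coincide. For surjectivity, the visit
  preceding \<open>w\<close> is searched from the point at time \<open>a/2\<close> before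
  \<open>w\<close>.\<close>

lemma fm_bij: "bij_betw fm V V"
proof (rule bij_betw_imageI)
  have key: "v = w" if "v \<in> V" "w \<in> V" "fm v = fm w" "ret w \<le> ret v" for v w
  proof -
    have X: "v \<in> X" "w \<in> X" using that VX by auto
    have "w = \<phi> (ret v - ret w) v" using that(3) X by (simp add: fm_def flow_eq_iff)
    then have "\<phi> (ret v - ret w) v \<in> V" using that(2) by simp
    then have "ret v - ret w = 0 \<or> ret v - ret w = ret v"
      by (intro first_return[OF that(1)]) (use that(4) ret_pos[OF that(2)] in auto)
    then have "ret v - ret w = 0" using ret_pos[OF that(2)] by linarith
    then show ?thesis using \<open>w = \<phi> (ret v - ret w) v\<close> X by simp
  qed
  show "inj_on fm V"
  proof (rule inj_onI)
    fix v w assume "v \<in> V" "w \<in> V" "fm v = fm w"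
    then show "v = w" using key[of v w] key[of w v] by (metis linear)
  qed
  show "fm ` V = V"
  proof
    show "fm ` V \<subseteq> V" using ret(2) by (auto simp: fm_def)
    show "V \<subseteq> fm ` V"
    proof
      fix w assume w: "w \<in> V"
      then have wX: "w \<in> X" using VX by blast
      \<comment> \<open>Starting before \<open>w\<close> excludes \<open>w\<close> itself as the
        last visit. If \<open>v\<close> returned strictly before \<open>w\<close> is reached,
        \<open>w\<close> would follow that return within time \<open>a\<close>, against
        \<open>trans\<close>.\<close>
      obtain v t where v: "v \<in> V" "0 \<le> t" "t < ret v" "\<phi> (- (a/2)) w = \<phi> t v" using reach_from_V[of "\<phi> (- (a/2)) w"] wX by auto
      have vX: "v \<in> X" using v(1) VX by blast
      have w2: "w = \<phi> (t + a/2) v"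
      proof -
        have "\<phi> (a/2) (\<phi> (- (a/2)) w) = \<phi> (a/2) (\<phi> t v)" using v(4) by simp
        then show ?thesis using wX vX by simp
      qed
      have "t + a/2 = ret v"
      proof (rule ccontr)
        assume ne: "t + a/2 \<noteq> ret v"
        show False
        proof (cases "t + a/2 < ret v")
          case True
          then show False using ret(3)[OF v(1), of "t + a/2"] v(2) apos w w2 by simp
        next
          case False
          then have lt: "0 < t + a/2 - ret v" "t + a/2 - ret v \<le> a" using ne v(3) apos by auto
          have "\<phi> (t + a/2 - ret v) (\<phi> (ret v) v) = w" using w2 vX by simp
          then show False using trans[OF ret(2)[OF v(1)], of "t + a/2 - ret v"] w lt by simp
        qed
      qed
      then show "w \<in> fm ` V" using v(1) w2 by (auto simp: fm_def)
    qed
  qed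
qed

abbreviation fi :: "int \<Rightarrow> 'a \<Rightarrow> 'a" where
  "fi \<equiv> ipow V fm"

lemmas fi_in = ipow_in[OF fm_bij] and fi_Suc = ipow_Suc[OF fm_bij] and fi_add = ipow_add[OF fm_bij]

lemma fi_1: "v \<in> V \<Longrightarrow> fi 1 v = fm v"
  using fi_Suc[of v 0] by simp

lemma flow_isum:
  assumes v: "v \<in> V"
  shows "\<phi> (isum (\<lambda>j. ret (fi j v)) k) v = fi k v"
proof (induction k rule: int_induct[where k = 0])
  case base
  then show ?case using v VX by auto
next
  case (step1 i)
  have "\<phi> (isum (\<lambda>j. ret (fi j v)) (i + 1)) v = \<phi> (ret (fi i v)) (\<phi> (isum (\<lambda>j. ret (fi j v)) i) v)"
    using V_in_X[OF v] by (simp add: isum_Suc)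
  also have "\<dots> = \<phi> (ret (fi i v)) (fi i v)" by (simp only: step1)
  also have "\<dots> = fi (i + 1) v" by (simp only: fi_Suc[OF v] fm_def[symmetric])
  finally show ?case .
next
  case (step2 i)
  have "\<phi> (ret (fi (i - 1) v)) (\<phi> (isum (\<lambda>j. ret (fi j v)) (i - 1)) v) = \<phi> (isum (\<lambda>j. ret (fi j v)) i) v"
    using V_in_X[OF v] isum_Suc[of "\<lambda>j. ret (fi j v)" "i - 1"] by simp
  also have "\<dots> = fi (i - 1 + 1) v" using step2 by (simp only: diff_add_cancel)
  also have "\<dots> = \<phi> (ret (fi (i - 1) v)) (fi (i - 1) v)" by (simp only: fi_Suc[OF v] fm_def[symmetric])
  finally show ?case
    by (rule flow_inj[rotated -1]) (use V_in_X[OF v] V_in_X[OF fi_in[OF v]] in auto)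
qed

text \<open>Every return takes at least \<open>a\<close>, so \<open>t \<le> real n * a\<close>
  bounds the number of returns and permits induction on \<open>n\<close>.\<close>

lemma visit_is_iterate:
  assumes "v \<in> V" "0 \<le> t" "\<phi> t v \<in> V"
  shows "\<exists>k. \<phi> t v = fi k v"
proof -
  obtain n :: nat where n: "t \<le> real n * a" using reals_Archimedean3[OF apos] less_imp_le by blast
  have "\<exists>k. \<phi> t v = fi k v" if "v \<in> V" "0 \<le> t" "\<phi> t v \<in> V" "t \<le> real n * a" for v t
    using that
  proof (induction n arbitrary: v t)
    case 0
    then have "t = 0" by simp
    then have "\<phi> t v = fi 0 v" using V_in_X[OF 0(1)] by simp
    then show ?case by blast
  next
    case (Suc n)
    have vX: "v \<in> X" by (rule V_in_X[OF Suc.prems(1)])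
    show ?case
    proof (cases "t < ret v")
      case True
      then have "t = 0" using first_return[OF Suc.prems(1,2) _ Suc.prems(3)] by simp
      then have "\<phi> t v = fi 0 v" using vX by simp
      then show ?thesis by blast
    next
      case False
      have eq: "\<phi> (t - ret v) (fm v) = \<phi> t v" using vX by (simp add: fm_def)
      have fmV: "fm v \<in> V" using ret(2)[OF Suc.prems(1)] by (simp add: fm_def)
      have "t - ret v \<le> real n * a" using Suc.prems(4) ret(1)[OF Suc.prems(1)] by (simp add: algebra_simps)
      then obtain k where "\<phi> (t - ret v) (fm v) = fi k (fm v)" using Suc.IH[OF fmV, of "t - ret v"] False eq Suc.prems(3) by auto
      then have "\<phi> t v = fi (k + 1) v" using eq fi_add[OF Suc.prems(1), of k 1] fi_1[OF Suc.prems(1)] by simp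
      then show ?thesis by blast
    qed
  qed
  then show ?thesis using assms n by blast
qed

lemma iterates_dense:
  assumes "v \<in> V" "u \<in> V" "e > 0"
  shows "\<exists>k. dist u (fi k v) < e"
proof -
  from hit_near[OF V_in_X[OF assms(1)] assms(2,3), of 0] obtain t where t: "t \<ge> 0 \<and> \<phi> t v \<in> V \<and> dist u (\<phi> t v) < e" by (rule exE)
  then obtain k where "\<phi> t v = fi k v" using visit_is_iterate[OF assms(1)] by blast
  then show ?thesis using t by (intro exI[of _ k]) simp
qed

end

section \<open>Symbolic coding of a cross-section\<close>

text \<open>With this discrete metric on \<open>nat\<close> the library's metric on countable products applies to \<open>int \<Rightarrow> nat\<close>.\<close>

instantiation nat :: metric_space
begin

definition dist_nat :: "nat \<Rightarrow> nat \<Rightarrow> real" where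
  "dist_nat m n = \<bar>real m - real n\<bar>"

definition uniformity_nat :: "(nat \<times> nat) filter" where
  "uniformity_nat = (INF e\<in>{0 <..}. principal {(x, y). dist x y < e})"

instance
proof
  show "uniformity = (INF e\<in>{0 <..}. principal {(x::nat, y). dist x y < e})" by (rule uniformity_nat_def)
  fix U :: "nat set" and x y z :: nat
  have "\<forall>\<^sub>F (x', y) in uniformity. x' = x \<longrightarrow> y \<in> U" if "x \<in> U" for x
    unfolding uniformity_nat_def
  proof (rule eventually_INF1[of 1])
    have "y = x" if "\<bar>real x - real y\<bar> < 1" for y using that by linarith
    then show "\<forall>\<^sub>F (x', y) in principal {(x, y). dist x y < 1}. x' = x \<longrightarrow> y \<in> U"
      using that by (auto simp: eventually_principal dist_nat_def)
  qed simp
  then show "open U = (\<forall>x\<in>U. \<forall>\<^sub>F (x', y) in uniformity. x' = x \<longrightarrow> y \<in> U)"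
    by (simp add: open_discrete)
  show "(dist x y = 0) = (x = y)" by (simp add: dist_nat_def)
  show "dist x y \<le> dist x z + dist y z" by (simp add: dist_nat_def)
qed

end

lemma continuous_on_funpow:
  assumes "continuous_on V g" "\<And>x. x \<in> V \<Longrightarrow> g x \<in> V"
  shows "continuous_on V (g ^^ n) \<and> (\<forall>x\<in>V. (g ^^ n) x \<in> V)"
proof (induction n)
  case (Suc n)
  have "continuous_on V (\<lambda>x. g ((g ^^ n) x))"
    by (rule continuous_on_compose2[OF assms(1) Suc[THEN conjunct1]]) (use Suc in blast)
  then show ?case using Suc assms(2) by (simp add: o_def)
qed simp

lemma continuous_on_inv_into_compact:
  fixes f :: "'a::metric_space \<Rightarrow> 'b::t2_space"
  assumes "continuous_on S f" "compact S" "inj_on f S"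
  shows "continuous_on (f ` S) (inv_into S f)"
  by (rule continuous_on_inv[OF assms(1,2)]) (simp add: assms(3))

lemma continuous_on_ipow:
  fixes V :: "'a::metric_space set"
  assumes "compact V" "continuous_on V f" "bij_betw f V V"
  shows "continuous_on V (ipow V f k)"
proof (cases "0 \<le> k")
  case True
  have "f x \<in> V" if "x \<in> V" for x using bij_betwE[OF assms(3)] that by (rule bspec)
  then show ?thesis using continuous_on_funpow[OF assms(2)] True by (simp add: ipow_def)
next
  case False
  have "f ` V = V" "inj_on f V" using assms(3) by (auto simp: bij_betw_def)
  then have "continuous_on V (inv_into V f)" using continuous_on_inv_into_compact[OF assms(2,1)] by simp
  moreover have "inv_into V f x \<in> V" if "x \<in> V" for x
    by (rule inv_into_into) (simp add: \<open>f ` V = V\<close> that)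
  ultimately show ?thesis using continuous_on_funpow[of V "inv_into V f"] False by (simp add: ipow_def)
qed

locale coded_section = cross_section X \<phi> V a for X :: "'a::metric_space set" and \<phi> V a +
  fixes P :: "'a \<Rightarrow> nat"
  assumes contP: "continuous_on V P" and finP: "finite (P ` V)"
    and sep: "\<And>v w. v \<in> V \<Longrightarrow> w \<in> V \<Longrightarrow> \<forall>n. P (fi n v) = P (fi n w) \<Longrightarrow> v = w"

text \<open>The mesh is so fine that points with equal labels are within \<kappa> and have return
  times within \<kappa>. Equal itineraries then satisfy \<open>expansive_nodes\<close> with the
  successive visits as nodes, so both points lie on one orbit piece of duration at most
  \<open>a\<close> and are equal by \<open>trans\<close>.\<close>

lemma (in cross_section) coded_section_exists: "\<exists>P. coded_section X \<phi> V a P"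
proof -
  obtain v0 where "v0 \<in> V" "\<forall>v\<in>V. ret v \<le> ret v0" using continuous_attains_sup[OF compV Vne continuous_ret] by blast
  then obtain R where R: "\<And>v. v \<in> V \<Longrightarrow> ret v \<le> R" by blast
  from expansive_nodes[OF expansive apos, of R] obtain \<kappa> where
    \<kappa>: "\<kappa> > 0 \<and> \<kappa> \<le> 1 \<and> (\<forall>x\<in>X. \<forall>y\<in>X. \<forall>(A::int\<Rightarrow>real) B c. A 0 = 0 \<and> B 0 = 0 \<and> c > 0 \<and>
      (\<forall>n. A n + c \<le> A (n + 1) \<and> A (n + 1) \<le> A n + R \<and> B n + c \<le> B (n + 1) \<and>
           \<bar>(A (n + 1) - A n) - (B (n + 1) - B n)\<bar> \<le> \<kappa> \<and> dist (\<phi> (A n) x) (\<phi> (B n) y) \<le> \<kappa>)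
      \<longrightarrow> (\<exists>s. \<bar>s\<bar> \<le> a \<and> y = \<phi> s x))" by (rule exE)
  have "uniformly_continuous_on V ret" by (rule compact_uniformly_continuous[OF continuous_ret compV])
  then obtain d where d: "d > 0" "\<forall>x\<in>V. \<forall>x'\<in>V. dist x' x < d \<longrightarrow> dist (ret x') (ret x) < \<kappa>"
    using \<kappa> unfolding uniformly_continuous_on_def by blast
  define e where "e = min d \<kappa>"
  have e: "e > 0" using d(1) \<kappa> by (simp add: e_def)
  have "\<exists>P::'a \<Rightarrow> nat. finite (P ` V) \<and> continuous_on V P \<and> (\<forall>x\<in>V. \<forall>y\<in>V. P x = P y \<longrightarrow> dist x y < e)"
    by (rule zero_dim_labelling[OF compV _ e]) (rule td)
  then obtain P :: "'a \<Rightarrow> nat" where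
    P: "finite (P ` V) \<and> continuous_on V P \<and> (\<forall>x\<in>V. \<forall>y\<in>V. P x = P y \<longrightarrow> dist x y < e)" by (rule exE)
  have "v = w" if vw: "v \<in> V" "w \<in> V" and eq: "\<forall>n. P (fi n v) = P (fi n w)" for v w
  proof -
    define A where "A = isum (\<lambda>j. ret (fi j v))"
    define B where "B = isum (\<lambda>j. ret (fi j w))"
    have nodes: "A n + a \<le> A (n + 1)" "A (n + 1) \<le> A n + R" "B n + a \<le> B (n + 1)"
           "\<bar>(A (n + 1) - A n) - (B (n + 1) - B n)\<bar> \<le> \<kappa>" "dist (\<phi> (A n) v) (\<phi> (B n) w) \<le> \<kappa>" for n
    proof -
      have in_V: "fi n v \<in> V" "fi n w \<in> V" using fi_in vw by auto
      have dd: "dist (fi n v) (fi n w) < e" using P in_V eq by blast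
      then have "dist (ret (fi n v)) (ret (fi n w)) < \<kappa>" using d(2) in_V by (simp add: e_def)
      then show "\<bar>(A (n + 1) - A n) - (B (n + 1) - B n)\<bar> \<le> \<kappa>" by (simp add: A_def B_def isum_Suc dist_real_def)
      show "A n + a \<le> A (n + 1)" "A (n + 1) \<le> A n + R" "B n + a \<le> B (n + 1)"
        using ret(1)[OF in_V(1)] ret(1)[OF in_V(2)] R[OF in_V(1)] by (simp_all add: A_def B_def isum_Suc)
      show "dist (\<phi> (A n) v) (\<phi> (B n) w) \<le> \<kappa>" using dd flow_isum[OF vw(1)] flow_isum[OF vw(2)] by (simp add: A_def B_def e_def)
    qed
    have "A 0 = 0 \<and> B 0 = 0 \<and> a > 0 \<and>
      (\<forall>n. A n + a \<le> A (n + 1) \<and> A (n + 1) \<le> A n + R \<and> B n + a \<le> B (n + 1) \<and>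
           \<bar>(A (n + 1) - A n) - (B (n + 1) - B n)\<bar> \<le> \<kappa> \<and> dist (\<phi> (A n) v) (\<phi> (B n) w) \<le> \<kappa>)"
    proof (intro conjI allI)
      show "A 0 = 0" "B 0 = 0" by (simp_all add: A_def B_def)
    qed (rule nodes apos)+
    with \<kappa>[THEN conjunct2, THEN conjunct2, rule_format, OF V_in_X[OF vw(1)] V_in_X[OF vw(2)], of A B a]
    obtain s where s: "\<bar>s\<bar> \<le> a" "w = \<phi> s v" by blast
    then have "s = 0" using trans[OF vw(1), of s] vw(2) by simp
    then show ?thesis using s(2) V_in_X[OF vw(1)] by simp
  qed
  then have "coded_section X \<phi> V a P" using P by unfold_locales auto
  then show ?thesis by blast
qed

context coded_section
begin

definition itin :: "'a \<Rightarrow> int \<Rightarrow> nat" where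
  "itin v = (\<lambda>n. P (fi n v))"

lemma itin_shift: "v \<in> V \<Longrightarrow> shiftk k (itin v) = itin (fi k v)"
  by (simp add: shiftk_def itin_def fi_add)

lemma itin_inj: "inj_on itin V"
  by (rule inj_onI) (auto intro: sep simp: itin_def dest: fun_cong)

lemma itin_continuous: "continuous_on V itin"
proof (rule continuous_on_coordinatewise_then_product)
  fix n
  have "continuous_on V (\<lambda>v. P (fi n v))"
    by (rule continuous_on_compose2[OF contP continuous_on_ipow[OF compV continuous_fm fm_bij]]) (use fi_in in blast)
  then show "continuous_on V (\<lambda>v. itin v n)" by (simp add: itin_def)
qed

definition code :: "(int \<Rightarrow> nat) set" where
  "code = itin ` V"

definition dec :: "(int \<Rightarrow> nat) \<Rightarrow> 'a" where
  "dec = inv_into V itin"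

definition roof :: "(int \<Rightarrow> nat) \<Rightarrow> real" where
  "roof y = ret (dec y)"

text \<open>Decoding keeps unit speed, so orbits will match under the identity time change.\<close>

definition quot :: "(int \<Rightarrow> nat) \<times> real \<Rightarrow> 'a" where
  "quot p = \<phi> (snd p) (dec (fst p))"

lemma dec_itin [simp]: "v \<in> V \<Longrightarrow> dec (itin v) = v"
  by (simp add: dec_def itin_inj)

lemma compact_code: "compact code"
  unfolding code_def by (rule compact_continuous_image[OF itin_continuous compV])

lemma continuous_dec: "continuous_on code dec"
  unfolding code_def dec_def by (rule continuous_on_inv_into_compact[OF itin_continuous compV itin_inj])

lemma dec_in: "y \<in> code \<Longrightarrow> dec y \<in> V"
  by (auto simp: code_def)

lemma continuous_roof: "continuous_on code roof"
  unfolding roof_def by (rule continuous_on_compose2[OF continuous_ret continuous_dec]) (use dec_in in blast)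

lemma code_minimal: "minimal_subshift (P ` V) code"
proof -
  have "shiftk 1 ` code = code"
  proof -
    have "shiftk 1 ` code = (\<lambda>v. itin (fm v)) ` V"
      unfolding code_def image_image by (rule image_cong) (simp_all add: itin_shift fi_1)
    also have "\<dots> = itin ` (fm ` V)" by (simp only: image_image)
    finally show ?thesis using fm_bij by (simp add: code_def bij_betw_def)
  qed
  moreover have "code \<subseteq> {y. \<forall>n. y n \<in> P ` V}" by (auto simp: code_def itin_def intro: fi_in)
  moreover have "closed code" by (rule compact_imp_closed[OF compact_code])
  moreover have "y' \<in> closure {shiftk k y | k. True}" if y: "y \<in> code" and y': "y' \<in> code" for y y'
  proof -
    obtain v u where v: "v \<in> V" "y = itin v" and u: "u \<in> V" "y' = itin u" using y y' by (auto simp: code_def)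
    have "\<forall>n. \<exists>k. dist u (fi k v) < 1 / real (Suc n)" using iterates_dense[OF v(1) u(1)] by simp
    then obtain k where k: "\<forall>n. dist u (fi (k n) v) < 1 / real (Suc n)" by (rule choice[THEN exE])
    have "dist (fi (k n) v) u \<le> 1 / real (Suc n)" for n using k[rule_format, of n] by (simp add: dist_commute)
    then have "(\<lambda>n. fi (k n) v) \<longlonglongrightarrow> u" using LIMSEQ_inverse_Suc by (rule LIMSEQ_dist_le)
    then have "(\<lambda>n. itin (fi (k n) v)) \<longlonglongrightarrow> itin u"
      by (rule continuous_on_tendsto_compose[OF itin_continuous]) (use u(1) fi_in[OF v(1)] in simp_all)
    moreover have "itin (fi (k n) v) \<in> {shiftk k y | k. True}" for n
      unfolding mem_Collect_eq by (rule exI[of _ "k n"]) (simp add: itin_shift[OF v(1)] v(2))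
    ultimately show ?thesis unfolding closure_sequential u(2)
      by (intro exI[of _ "\<lambda>n. itin (fi (k n) v)"] conjI allI)
  qed
  ultimately show ?thesis using finP unfolding minimal_subshift_def subshift_def by blast
qed

lemma quot_in: "fst p \<in> code \<Longrightarrow> quot p \<in> X"
  unfolding quot_def using dec_in V_in_X by simp

lemma compact_susp_dom: "compact (susp_dom code roof)"
proof -
  obtain v0 where v0: "v0 \<in> V" "\<forall>v\<in>V. ret v \<le> ret v0" using continuous_attains_sup[OF compV Vne continuous_ret] by blast
  let ?K = "code \<times> {0..ret v0}"
  have K: "compact ?K" by (intro compact_Times compact_code compact_Icc)
  have "continuous_on ?K (\<lambda>p. roof (fst p) - snd p)"
    by (intro continuous_intros continuous_on_compose2[OF continuous_roof]) auto
  then have "closed (?K \<inter> (\<lambda>p. roof (fst p) - snd p) -` {0..})"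
    by (rule continuous_closed_preimage) (auto intro: compact_imp_closed[OF K])
  then have "compact (?K \<inter> (\<lambda>p. roof (fst p) - snd p) -` {0..})" by (rule compact_Int_of_closed[OF K])
  moreover have "?K \<inter> (\<lambda>p. roof (fst p) - snd p) -` {0..} = susp_dom code roof"
  proof (intro equalityI subsetI)
    fix p assume p: "p \<in> susp_dom code roof"
    obtain y s where ps: "p = (y, s)" by (metis prod.collapse)
    have y: "y \<in> code" "0 \<le> s" "s \<le> roof y" using p by (simp_all add: ps susp_dom_def)
    have "roof y \<le> ret v0" using v0(2) dec_in[OF y(1)] by (simp add: roof_def)
    then show "p \<in> ?K \<inter> (\<lambda>p. roof (fst p) - snd p) -` {0..}" using y by (simp add: ps)
  qed (auto simp: susp_dom_def)
  ultimately show ?thesis by simp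
qed

text \<open>A continuous surjection from a compact space onto a Hausdorff space is a quotient
  map.\<close>

lemma quotient_quot: "quotient_map (top_of_set (susp_dom code roof)) (top_of_set X) quot"
proof -
  let ?D = "susp_dom code roof"
  have fst_in: "fst p \<in> code" if "p \<in> ?D" for p using that by (auto simp: susp_dom_def)
  have cont: "continuous_on ?D quot"
    unfolding quot_def
    by (intro continuous_on_flow continuous_intros continuous_on_compose2[OF continuous_dec])
      (use fst_in dec_in V_in_X in auto)
  have img: "quot ` ?D = X"
  proof
    show "quot ` ?D \<subseteq> X" using quot_in fst_in by blast
    show "X \<subseteq> quot ` ?D"
    proof
      fix x assume "x \<in> X"
      from reach_from_V[OF this] obtain v t where v: "v \<in> V" "0 \<le> t" "t < ret v" "x = \<phi> t v" by blast
      then have "(itin v, t) \<in> ?D" "quot (itin v, t) = x" by (auto simp: susp_dom_def code_def roof_def quot_def)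
      then show "x \<in> quot ` ?D" by (metis imageI)
    qed
  qed
  show ?thesis
    unfolding quotient_map_def
  proof (intro conjI allI impI)
    show "quot ` topspace (top_of_set ?D) = topspace (top_of_set X)" using img by simp
    fix U assume U: "U \<subseteq> topspace (top_of_set X)"
    have "{x \<in> topspace (top_of_set ?D). quot x \<in> U} = ?D \<inter> quot -` U" by auto
    then show "openin (top_of_set ?D) {x \<in> topspace (top_of_set ?D). quot x \<in> U} \<longleftrightarrow> openin (top_of_set X) U"
      using Abstract_Topology_2.continuous_imp_quotient_map[OF cont img compact_susp_dom, of U] U by simp
  qed
qed

text \<open>For two representatives of one point, flowing for the difference of the heights leads
  from one point of \<open>V\<close> to another no later than the first return. The difference is
  therefore 0, which gives equal pairs, or the full return time, which gives the gluing of top and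
  bottom.\<close>

lemma quot_fibres:
  assumes p: "p \<in> susp_dom code roof" and p': "p' \<in> susp_dom code roof"
  shows "quot p = quot p' \<longleftrightarrow> susp_rel roof p p'"
proof -
  have key: "susp_rel roof p p'" if D: "p \<in> susp_dom code roof" "p' \<in> susp_dom code roof" and eq: "quot p = quot p'" and le: "snd p' \<le> snd p" for p p'
  proof -
    obtain y s y' s' where ps: "p = (y, s)" "p' = (y', s')" by (metis prod.collapse)
    obtain v where v: "v \<in> V" "y = itin v" using D(1) by (auto simp: ps susp_dom_def code_def)
    obtain w where w: "w \<in> V" "y' = itin w" using D(2) by (auto simp: ps susp_dom_def code_def)
    have s: "0 \<le> s" "s \<le> ret v" "0 \<le> s'" "s' \<le> s" using D le by (simp_all add: ps susp_dom_def roof_def v w)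
    have X: "v \<in> X" "w \<in> X" using v w VX by auto
    have "\<phi> s v = \<phi> s' w" using eq v w by (simp add: ps quot_def)
    then have wv: "w = \<phi> (s - s') v" using X by (simp add: flow_eq_iff)
    have "s - s' = 0 \<or> s - s' = ret v" by (rule first_return[OF v(1)]) (use s wv w(1) in auto)
    then show ?thesis
    proof
      assume "s - s' = 0"
      then show ?thesis using wv X v w by (simp add: susp_rel_def ps)
    next
      assume r: "s - s' = ret v"
      then have "s = ret v" "s' = 0" using s by auto
      moreover have "w = fm v" using wv r by (simp add: fm_def)
      then have "y' = shiftk 1 y" using v w itin_shift[OF v(1), of 1] by (simp add: fi_1)
      ultimately show ?thesis by (simp add: susp_rel_def ps roof_def v)
    qed
  qed
  have sym: "susp_rel roof p p' = susp_rel roof p' p" by (auto simp: susp_rel_def)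
  have conv: "quot p = quot p'" if D: "p \<in> susp_dom code roof" and r: "snd p = roof (fst p)" "fst p' = shiftk 1 (fst p)" "snd p' = 0" for p p'
  proof -
    have "fst p \<in> code" using D by (auto simp: susp_dom_def)
    then obtain v where v: "v \<in> V" "fst p = itin v" by (auto simp: code_def)
    have fV: "fm v \<in> V" using fi_in[OF v(1), of 1] fi_1[OF v(1)] by simp
    have "fst p' = itin (fm v)" using r(2) v itin_shift[OF v(1), of 1] by (simp add: fi_1)
    then have "quot p' = fm v" using r(3) fV V_in_X by (simp add: quot_def)
    moreover have "quot p = fm v" using r(1) v by (simp add: quot_def roof_def fm_def)
    ultimately show ?thesis by simp
  qed
  show ?thesis
  proof
    assume eq: "quot p = quot p'"
    show "susp_rel roof p p'"
    proof (cases "snd p' \<le> snd p")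
      case True
      then show ?thesis using key[OF p p' eq] by simp
    next
      case False
      then show ?thesis using key[OF p' p eq[symmetric]] sym by simp
    qed
  next
    assume "susp_rel roof p p'"
    then consider "p = p'" | "snd p = roof (fst p)" "fst p' = shiftk 1 (fst p)" "snd p' = 0"
      | "snd p' = roof (fst p')" "fst p = shiftk 1 (fst p')" "snd p = 0" unfolding susp_rel_def by blast
    then show "quot p = quot p'"
    proof cases
      case 2 then show ?thesis by (rule conv[OF p])
    next
      case 3 then show ?thesis by (rule conv[OF p', symmetric])
    qed simp
  qed
qed

text \<open>Shifting by \<open>k\<close> and subtracting \<open>roof_sum\<close> cancel in the flow
  by \<open>flow_isum\<close>, for any integer \<open>k\<close>; so the \<open>THE\<close> in
  \<open>susp_flow\<close> does not have to be evaluated here.\<close>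

lemma quot_flow:
  assumes "p \<in> susp_dom code roof"
  shows "quot (susp_flow roof t p) = \<phi> t (quot p)"
proof -
  obtain y s where ps: "p = (y, s)" by (metis prod.collapse)
  obtain v where v: "v \<in> V" "y = itin v" using assms by (auto simp: ps susp_dom_def code_def)
  have vX: "v \<in> X" using v VX by auto
  define k where "k = (THE k. roof_sum roof y k \<le> s + t \<and> s + t < roof_sum roof y (k + 1))"
  have rs: "roof_sum roof y k = isum (\<lambda>j. ret (fi j v)) k"
    using v fi_in[OF v(1)] by (simp add: roof_sum_isum roof_def itin_shift)
  have fk: "fi k v = \<phi> (roof_sum roof y k) v" using flow_isum[OF v(1), of k] rs by simp
  have "susp_flow roof t p = (shiftk k y, s + t - roof_sum roof y k)"
    by (simp add: susp_flow_def ps k_def Let_def)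
  then have "quot (susp_flow roof t p) = \<phi> (s + t - roof_sum roof y k) (fi k v)"
    using v fi_in[OF v(1)] by (simp add: quot_def itin_shift)
  also have "\<dots> = \<phi> (s + t) v" using fk vX by simp
  also have "\<dots> = \<phi> t (quot p)" using vX v by (simp add: quot_def ps)
  finally show ?thesis .
qed

lemma code_equiv: "equiv_to_suspension X \<phi> code roof"
  unfolding equiv_to_suspension_def
proof (rule exI[of _ quot], intro conjI ballI)
  fix p assume p: "p \<in> susp_dom code roof"
  have "(\<lambda>t. t) \<in> Rep" by (rule RepI) (auto simp: strict_mono_def)
  then show "\<exists>\<alpha>\<in>Rep. \<forall>t. quot (susp_flow roof t p) = \<phi> (\<alpha> t) (quot p)"
    by (rule bexI[rotated]) (simp add: quot_flow[OF p])
qed (rule quotient_quot quot_fibres | assumption)+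

end

lemma (in compact_flow) minimal_expansive_is_suspension:
  assumes "minimal_flow X \<phi>" "expansive_flow X \<phi>" "\<exists>x\<in>X. \<exists>y\<in>X. x \<noteq> y"
  shows "\<exists>A \<Sigma> r. minimal_subshift A \<Sigma> \<and> continuous_on \<Sigma> r \<and> (\<forall>y\<in>\<Sigma>. r y > 0) \<and> equiv_to_suspension X \<phi> \<Sigma> r"
proof -
  obtain V a where "cross_section X \<phi> V a" using cross_section_exists[OF assms] by blast
  then interpret cross_section X \<phi> V a .
  obtain P where "coded_section X \<phi> V a P" using coded_section_exists by blast
  then interpret coded_section X \<phi> V a P .
  have "\<forall>y\<in>code. roof y > 0" using ret_pos dec_in by (simp add: roof_def)
  then show ?thesis using code_minimal continuous_roof code_equiv by blast
qed

section \<open>Suspension flows are minimal and expansive\<close>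

lemma shiftk_0 [simp]: "shiftk 0 y = y"
  by (simp add: shiftk_def)

lemma shiftk_shiftk [simp]: "shiftk j (shiftk k y) = shiftk (j + k) y"
  by (simp add: shiftk_def add.assoc)

text \<open>\<open>qh (y, s)\<close> is the image of the point of the suspension over \<open>y\<close> at the fraction \<open>s\<close> of the height of the roof.
  Then \<open>pt y w\<close> runs through the orbit of \<open>qh (y, 0)\<close>, crossing the base at the integers \<open>w\<close>.\<close>

locale suspension_flow = compact_flow X \<phi> for X :: "'a::metric_space set" and \<phi> +
  fixes \<Sigma> :: "(int \<Rightarrow> nat) set" and qh :: "(int \<Rightarrow> nat) \<times> real \<Rightarrow> 'a"
  assumes comp\<Sigma>: "compact \<Sigma>" and shift_in: "\<And>y k. y \<in> \<Sigma> \<Longrightarrow> shiftk k y \<in> \<Sigma>"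
    and dense: "\<And>y. y \<in> \<Sigma> \<Longrightarrow> \<Sigma> \<subseteq> closure {shiftk k y | k. True}"
    and cont: "continuous_on (\<Sigma> \<times> {0..1}) qh" and onto: "qh ` (\<Sigma> \<times> {0..1}) = X"
    and fib: "\<And>y y' s s'. y \<in> \<Sigma> \<Longrightarrow> y' \<in> \<Sigma> \<Longrightarrow> s \<in> {0..1} \<Longrightarrow> s' \<in> {0..1} \<Longrightarrow> qh (y, s) = qh (y', s') \<Longrightarrow>
      y = y' \<and> s = s' \<or> s = 1 \<and> s' = 0 \<and> y' = shiftk 1 y \<or> s' = 1 \<and> s = 0 \<and> y = shiftk 1 y'"
    and glue: "\<And>y. y \<in> \<Sigma> \<Longrightarrow> qh (y, 1) = qh (shiftk 1 y, 0)"
    and orbit: "\<And>y. y \<in> \<Sigma> \<Longrightarrow> \<exists>\<gamma>\<in>Rep. \<forall>w. qh (shiftk \<lfloor>w\<rfloor> y, frac w) = \<phi> (\<gamma> w) (qh (y, 0))"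
begin

definition pt :: "(int \<Rightarrow> nat) \<Rightarrow> real \<Rightarrow> 'a" where
  "pt y w = qh (shiftk \<lfloor>w\<rfloor> y, frac w)"

lemma compD: "compact (\<Sigma> \<times> {0..1::real})"
  using comp\<Sigma> by (intro compact_Times) auto

lemma qh_in: "y \<in> \<Sigma> \<Longrightarrow> 0 \<le> s \<Longrightarrow> s \<le> 1 \<Longrightarrow> qh (y, s) \<in> X"
  using onto by auto

lemma pt_in: "y \<in> \<Sigma> \<Longrightarrow> pt y w \<in> X"
  unfolding pt_def by (intro qh_in shift_in frac_ge_0 less_imp_le[OF frac_lt_1])

lemma pt_0: "pt y 0 = qh (y, 0)"
  by (simp add: pt_def)

lemma pt_int: "pt y (of_int n) = qh (shiftk n y, 0)"
  by (simp add: pt_def)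

text \<open>At the end \<open>s = 1\<close> the integer part jumps, and \<open>glue\<close>
  identifies the two descriptions of the point.\<close>

lemma pt_slab:
  assumes "y \<in> \<Sigma>" "0 \<le> s" "s \<le> 1"
  shows "pt y (of_int n + s) = qh (shiftk n y, s)"
proof (cases "s = 1")
  case True
  then have "pt y (of_int n + s) = qh (shiftk (n + 1) y, 0)" using pt_int[of y "n + 1"] by simp
  also have "\<dots> = qh (shiftk n y, 1)" using glue[OF shift_in[OF assms(1), of n]] by (simp add: add.commute)
  finally show ?thesis using True by simp
next
  case False
  then have "\<lfloor>of_int n + s\<rfloor> = n" using assms by linarith
  then show ?thesis by (simp add: pt_def frac_def)
qed

lemma pt_shift: "pt (shiftk j y) w = pt y (w + of_int j)"
  by (simp add: pt_def frac_def)

lemma pt_onto: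
  assumes "x \<in> X" shows "\<exists>y\<in>\<Sigma>. \<exists>w. x = pt y w"
proof -
  obtain y s where "y \<in> \<Sigma>" "0 \<le> s" "s \<le> 1" "x = qh (y, s)" using assms onto by force
  then have "x = pt y s" using pt_slab[of y s 0] by simp
  then show ?thesis using \<open>y \<in> \<Sigma>\<close> by blast
qed

lemma pt_orbit:
  assumes "y \<in> \<Sigma>" shows "\<exists>\<gamma>\<in>Rep. \<forall>w. pt y w = \<phi> (\<gamma> w) (pt y 0)"
  using orbit[OF assms] by (simp add: pt_def)

text \<open>Half a unit further along the orbit parameter the fractional part has changed, and no
  gluing can identify the two points because fractional parts stay below 1.\<close>

lemma moving:
  assumes "x \<in> X" shows "\<exists>t. \<phi> t x \<noteq> x"
proof -
  obtain y w where y: "y \<in> \<Sigma>" "x = pt y w" using pt_onto[OF assms] by blast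
  from pt_orbit[OF y(1)] obtain \<gamma> where \<gamma>: "\<And>w. pt y w = \<phi> (\<gamma> w) (pt y 0)" by blast
  have eq: "pt y (w + 1/2) = \<phi> (\<gamma> (w + 1/2) - \<gamma> w) x"
    using \<gamma>[of w] \<gamma>[of "w + 1/2"] y pt_in[OF y(1), of 0] by simp
  have "pt y (w + 1/2) \<noteq> pt y w"
  proof
    assume "pt y (w + 1/2) = pt y w"
    then have "qh (shiftk \<lfloor>w + 1/2\<rfloor> y, frac (w + 1/2)) = qh (shiftk \<lfloor>w\<rfloor> y, frac w)" by (simp only: pt_def)
    moreover have fr: "0 \<le> frac u" "frac u < 1" for u :: real by (simp_all add: frac_lt_1)
    ultimately have "frac (w + 1/2) = frac w"
      using fib[OF shift_in[OF y(1), of "\<lfloor>w + 1/2\<rfloor>"] shift_in[OF y(1), of "\<lfloor>w\<rfloor>"], of "frac (w + 1/2)" "frac w"] fr[of w] fr[of "w + 1/2"] by auto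
    then have "real_of_int (2 * (\<lfloor>w + 1/2\<rfloor> - \<lfloor>w\<rfloor>)) = real_of_int 1" by (simp add: frac_def)
    then have "2 * (\<lfloor>w + 1/2\<rfloor> - \<lfloor>w\<rfloor>) = (1::int)" by (simp only: of_int_eq_iff)
    then show False by presburger
  qed
  then show ?thesis using eq y(2) by metis
qed

text \<open>The base points lying in a compact invariant set form a closed set containing a shift
  orbit, hence are all of \<Sigma>; the orbits through the base exhaust \<open>X\<close>.\<close>

lemma minimal: "minimal_flow X \<phi>"
  unfolding minimal_flow_def
proof (intro allI impI, elim conjE)
  fix K assume K: "K \<subseteq> X" "K \<noteq> {}" "compact K" "flow_invariant K \<phi>"
  have inv: "\<phi> t x \<in> K" if "x \<in> K" for t x using K(4) that by (auto simp: flow_invariant_def)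
  have all: "pt y w' \<in> K" if y: "y \<in> \<Sigma>" and w: "pt y w \<in> K" for y w w'
  proof -
    from pt_orbit[OF y] obtain \<gamma> where \<gamma>: "\<And>w. pt y w = \<phi> (\<gamma> w) (pt y 0)" by blast
    have "pt y w' = \<phi> (\<gamma> w' - \<gamma> w) (pt y w)" using \<gamma>[of w] \<gamma>[of w'] pt_in[OF y, of 0] by simp
    then show ?thesis using inv[OF w] by simp
  qed
  obtain x where x: "x \<in> K" using K(2) by blast
  then obtain y w where y: "y \<in> \<Sigma>" "x = pt y w" using pt_onto K(1) by blast
  let ?g = "\<lambda>z. qh (z, 0)"
  have "continuous_on \<Sigma> ?g" by (rule continuous_on_compose2[OF cont]) (auto intro!: continuous_intros)
  then have "closed (\<Sigma> \<inter> ?g -` K)"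
    by (rule continuous_closed_preimage) (auto intro: compact_imp_closed comp\<Sigma> K(3))
  moreover have "{shiftk k y | k. True} \<subseteq> \<Sigma> \<inter> ?g -` K"
  proof clarify
    fix k
    have "qh (shiftk k y, 0) \<in> K" using all[OF y(1), of w "of_int k"] x y(2) by (simp add: pt_int)
    then show "shiftk k y \<in> \<Sigma> \<inter> ?g -` K" using shift_in[OF y(1)] by simp
  qed
  ultimately have "closure {shiftk k y | k. True} \<subseteq> \<Sigma> \<inter> ?g -` K" by (intro closure_minimal)
  then have base: "qh (z, 0) \<in> K" if "z \<in> \<Sigma>" for z using dense[OF y(1)] that by blast
  show "K = X"
  proof
    show "X \<subseteq> K"
    proof
      fix x' assume "x' \<in> X"
      then obtain y' w' where y': "y' \<in> \<Sigma>" "x' = pt y' w'" using pt_onto by blast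
      have "pt y' 0 \<in> K" using base[OF y'(1)] by (simp add: pt_0)
      then show "x' \<in> K" using all[OF y'(1)] y'(2) by simp
    qed
  qed (rule K(1))
qed

text \<open>The disjunction says that \<open>s\<close> and \<open>s'\<close> are close on the circle \<open>\<real>/\<int>\<close>.\<close>

lemma close_fractions:
  assumes "\<eta> > 0"
  shows "\<exists>\<delta>>0. \<forall>y\<in>\<Sigma>. \<forall>y'\<in>\<Sigma>. \<forall>s\<in>{0..1}. \<forall>s'\<in>{0..1}. dist (qh (y, s)) (qh (y', s')) \<le> \<delta> \<longrightarrow>
    \<bar>s - s'\<bar> < \<eta> \<or> 1 - \<bar>s - s'\<bar> < \<eta>"
proof -
  let ?K = "(\<Sigma> \<times> {0..1::real}) \<times> (\<Sigma> \<times> {0..1::real})"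
  have "\<exists>d>0. \<forall>p\<in>?K. dist (qh (fst p)) (qh (snd p)) \<le> d \<longrightarrow>
      min \<bar>snd (fst p) - snd (snd p)\<bar> (1 - \<bar>snd (fst p) - snd (snd p)\<bar>) < \<eta>"
  proof (rule compact_small[OF compact_Times[OF compD compD] _ _ _ assms])
    show "continuous_on ?K (\<lambda>p. dist (qh (fst p)) (qh (snd p)))"
      by (intro continuous_intros continuous_on_compose2[OF cont]) auto
    show "continuous_on ?K (\<lambda>p. min \<bar>snd (fst p) - snd (snd p)\<bar> (1 - \<bar>snd (fst p) - snd (snd p)\<bar>))"
      by (intro continuous_intros)
    fix p assume p: "p \<in> ?K" "dist (qh (fst p)) (qh (snd p)) \<le> 0"
    obtain y s y' s' where pe: "p = ((y, s), (y', s'))" by (metis prod.collapse)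
    have "s = s' \<or> s = 1 \<and> s' = 0 \<or> s' = 1 \<and> s = 0" using fib[of y y' s s'] p by (auto simp: pe)
    then show "min \<bar>snd (fst p) - snd (snd p)\<bar> (1 - \<bar>snd (fst p) - snd (snd p)\<bar>) \<le> 0" by (auto simp: pe)
  qed
  then obtain d where d: "d > 0 \<and> (\<forall>p\<in>?K. dist (qh (fst p)) (qh (snd p)) \<le> d \<longrightarrow>
      min \<bar>snd (fst p) - snd (snd p)\<bar> (1 - \<bar>snd (fst p) - snd (snd p)\<bar>) < \<eta>)" by (rule exE)
  show ?thesis
  proof (rule exI[of _ d], intro conjI ballI impI)
    fix y y' s s' assume A: "y \<in> \<Sigma>" "y' \<in> \<Sigma>" "s \<in> {0..1::real}" "s' \<in> {0..1::real}" "dist (qh (y, s)) (qh (y', s')) \<le> d"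
    then have "min \<bar>s - s'\<bar> (1 - \<bar>s - s'\<bar>) < \<eta>" using d[THEN conjunct2, rule_format, of "((y, s), (y', s'))"] by simp
    then show "\<bar>s - s'\<bar> < \<eta> \<or> 1 - \<bar>s - s'\<bar> < \<eta>" by (simp add: min_less_iff_disj)
  qed (use d in simp)
qed

text \<open>Height 1/2 and heights between 1/4 and 3/4 are out of reach of the gluing, so coinciding
  points have equal base sequences; symbols are integers, so symbols less than 1 apart are
  equal.\<close>

lemma close_symbols:
  shows "\<exists>\<delta>>0. \<forall>y\<in>\<Sigma>. \<forall>y'\<in>\<Sigma>. \<forall>s\<in>{1/4..3/4}. dist (qh (y, 1/2)) (qh (y', s)) \<le> \<delta> \<longrightarrow> y 0 = y' 0"
proof -
  let ?K = "(\<Sigma> \<times> \<Sigma>) \<times> {1/4..3/4::real}"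
  have "\<exists>d>0. \<forall>p\<in>?K. dist (qh (fst (fst p), 1/2)) (qh (snd (fst p), snd p)) \<le> d \<longrightarrow>
      dist (fst (fst p) 0) (snd (fst p) 0) < 1"
  proof (rule compact_small)
    show "compact ?K" using comp\<Sigma> by (intro compact_Times) auto
    show "continuous_on ?K (\<lambda>p. dist (qh (fst (fst p), 1/2)) (qh (snd (fst p), snd p)))"
      by (intro continuous_intros continuous_on_compose2[OF cont]) auto
    show "continuous_on ?K (\<lambda>p. dist (fst (fst p) 0) (snd (fst p) 0))"
      by (intro continuous_intros continuous_on_compose2[OF continuous_on_product_coordinates[of 0]]) auto
    fix p assume p: "p \<in> ?K" "dist (qh (fst (fst p), 1/2)) (qh (snd (fst p), snd p)) \<le> 0"
    obtain y y' s where pe: "p = ((y, y'), s)" by (metis prod.collapse)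
    have "y = y'" using fib[of y y' "1/2" s] p by (auto simp: pe)
    then show "dist (fst (fst p) 0) (snd (fst p) 0) \<le> 0" by (simp add: pe)
  qed simp
  then obtain d where d: "d > 0 \<and> (\<forall>p\<in>?K. dist (qh (fst (fst p), 1/2)) (qh (snd (fst p), snd p)) \<le> d \<longrightarrow>
      dist (fst (fst p) 0) (snd (fst p) 0) < 1)" by (rule exE)
  show ?thesis
  proof (rule exI[of _ d], intro conjI ballI impI)
    fix y y' s assume A: "y \<in> \<Sigma>" "y' \<in> \<Sigma>" "s \<in> {1/4..3/4::real}" "dist (qh (y, 1/2)) (qh (y', s)) \<le> d"
    then have "dist (y 0) (y' 0) < 1" using d[THEN conjunct2, rule_format, of "((y, y'), s)"] by simp
    then show "y 0 = y' 0" unfolding dist_nat_def by linarith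
  qed (use d in simp)
qed

text \<open>The bound must hold for all time changes at once. A point and its image under time
  \<open>t0\<close> are at least \<open>m\<close> apart. If \<gamma> gained \<open>t0\<close> over a
  short interval inside one slab, the intermediate value theorem would give two points of the slab
  related by \<open>\<phi> t0\<close> but close in coordinates, hence less than \<open>m\<close>
  apart.\<close>

lemma time_change_modulus:
  assumes "e > 0"
  shows "\<exists>\<eta>>0. \<forall>y\<in>\<Sigma>. \<forall>\<gamma>\<in>Rep. (\<forall>w. pt y w = \<phi> (\<gamma> w) (pt y 0)) \<longrightarrow>
    (\<forall>w0 w1. w0 \<le> w1 \<and> w1 - w0 \<le> \<eta> \<longrightarrow> \<gamma> w1 - \<gamma> w0 \<le> e)"
proof (cases "X = {}")
  case True
  then have "\<Sigma> = {}" using qh_in[of _ 0] by force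
  then show ?thesis by (intro exI[of _ 1]) simp
next
  case False
  from no_small_periods[OF moving] obtain \<tau> where \<tau>: "\<tau> > 0 \<and> (\<forall>x\<in>X. \<forall>s. 0 < s \<and> s \<le> \<tau> \<longrightarrow> \<phi> s x \<noteq> x)" by blast
  define t0 where "t0 = min \<tau> (e/2)"
  have t0: "t0 > 0" "t0 \<le> \<tau>" "t0 \<le> e/2" using \<tau> assms by (auto simp: t0_def)
  have "continuous_on X (\<lambda>x. dist x (\<phi> t0 x))" by (intro continuous_intros continuous_on_flow) auto
  from continuous_attains_inf[OF compX False this] obtain x0 where x0: "x0 \<in> X" "\<forall>x\<in>X. dist x0 (\<phi> t0 x0) \<le> dist x (\<phi> t0 x)" by blast
  define m where "m = dist x0 (\<phi> t0 x0)"
  have "\<phi> t0 x0 \<noteq> x0" using \<tau> x0(1) t0 by blast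
  then have m: "m > 0" by (simp add: m_def)
  have "uniformly_continuous_on (\<Sigma> \<times> {0..1}) qh" by (rule compact_uniformly_continuous[OF cont compD])
  then obtain d where d: "d > 0" "\<forall>p\<in>\<Sigma> \<times> {0..1}. \<forall>p'\<in>\<Sigma> \<times> {0..1}. dist p' p < d \<longrightarrow> dist (qh p') (qh p) < m"
    using m unfolding uniformly_continuous_on_def by blast
  define \<eta> where "\<eta> = min (d/2) 1"
  have \<eta>: "\<eta> > 0" "\<eta> < d" "\<eta> \<le> 1" using d(1) by (auto simp: \<eta>_def)
  show ?thesis
  proof (rule exI[of _ \<eta>], intro conjI ballI allI impI)
    show "\<eta> > 0" by (rule \<eta>)
  next
    fix y \<gamma> w0 w1 assume y: "y \<in> \<Sigma>" and \<gamma>: "\<gamma> \<in> Rep" "\<forall>w. pt y w = \<phi> (\<gamma> w) (pt y 0)" and w: "w0 \<le> w1 \<and> w1 - w0 \<le> \<eta>"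
    have slab: "\<gamma> v1 - \<gamma> v0 \<le> e/2" if v: "v0 \<le> v1" "v1 - v0 \<le> \<eta>" "of_int n \<le> v0" "v1 \<le> of_int n + 1" for v0 v1 n
    proof (rule ccontr)
      assume "\<not> ?thesis"
      then have "\<gamma> v0 \<le> \<gamma> v0 + t0" "\<gamma> v0 + t0 \<le> \<gamma> v1" using t0 by auto
      then obtain u where u: "v0 \<le> u" "u \<le> v1" "\<gamma> u = \<gamma> v0 + t0"
        using IVT'[of \<gamma> v0 "\<gamma> v0 + t0" v1] v(1) RepD(1)[OF \<gamma>(1)] by blast
      have eq: "pt y u = \<phi> t0 (pt y v0)" using \<gamma>(2)[rule_format, of u] \<gamma>(2)[rule_format, of v0] u(3) pt_in[OF y, of 0] by simp
      define s0 s where "s0 = v0 - of_int n" and "s = u - of_int n"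
      have s: "0 \<le> s0" "s0 \<le> 1" "0 \<le> s" "s \<le> 1" "\<bar>s - s0\<bar> < d" using u v \<eta>(2) by (auto simp: s0_def s_def)
      have "pt y v0 = qh (shiftk n y, s0)" "pt y u = qh (shiftk n y, s)"
        using pt_slab[OF y s(1,2), of n] pt_slab[OF y s(3,4), of n] by (simp_all add: s0_def s_def)
      moreover have "dist (shiftk n y, s) (shiftk n y, s0) < d" using s(5) by (simp add: dist_Pair_Pair dist_real_def)
      then have "dist (qh (shiftk n y, s)) (qh (shiftk n y, s0)) < m" using d(2) s(1-4) shift_in[OF y, of n] by simp
      ultimately have "dist (pt y v0) (\<phi> t0 (pt y v0)) < m" using eq by (simp add: dist_commute)
      then show False using x0(2) pt_in[OF y, of v0] by (fastforce simp: m_def)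
    qed
    show "\<gamma> w1 - \<gamma> w0 \<le> e"
    \<comment> \<open>An interval of length at most 1 has at most one integer in its interior, so
      two slabs suffice, each contributing at most \<open>e/2\<close>.\<close>
    proof (cases "w1 \<le> of_int \<lfloor>w0\<rfloor> + 1")
      case True
      then have "\<gamma> w1 - \<gamma> w0 \<le> e/2" using w by (intro slab[of w0 w1 "\<lfloor>w0\<rfloor>"]) auto
      then show ?thesis using assms by simp
    next
      case False
      have 1: "w0 \<le> of_int (\<lfloor>w0\<rfloor> + 1)" by linarith
      have "\<gamma> (of_int (\<lfloor>w0\<rfloor> + 1)) - \<gamma> w0 \<le> e/2"
      proof (rule slab[of w0 _ "\<lfloor>w0\<rfloor>"])
        have "real_of_int (\<lfloor>w0\<rfloor> + 1) = of_int \<lfloor>w0\<rfloor> + 1" by simp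
        then show "w0 \<le> of_int (\<lfloor>w0\<rfloor> + 1)" "of_int (\<lfloor>w0\<rfloor> + 1) - w0 \<le> \<eta>" "of_int (\<lfloor>w0\<rfloor> + 1) \<le> real_of_int \<lfloor>w0\<rfloor> + 1"
          using w False 1 by linarith+
      qed simp
      moreover have "\<gamma> w1 - \<gamma> (of_int (\<lfloor>w0\<rfloor> + 1)) \<le> e/2"
      proof (rule slab[of _ w1 "\<lfloor>w0\<rfloor> + 1"])
        have "real_of_int (\<lfloor>w0\<rfloor> + 1) = of_int \<lfloor>w0\<rfloor> + 1" by simp
        then show "of_int (\<lfloor>w0\<rfloor> + 1) \<le> w1" "w1 - of_int (\<lfloor>w0\<rfloor> + 1) \<le> \<eta>" "w1 \<le> of_int (\<lfloor>w0\<rfloor> + 1) + 1"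
          using w False 1 \<eta>(3) by linarith+
      qed simp
      ultimately show ?thesis by simp
    qed
  qed
qed

text \<open>The range of \<open>D\<close> is connected and misses all numbers
  \<open>n + 1/2\<close>, since \<open>\<eta> \<le> 1/4\<close>.\<close>

lemma near_integer_constant:
  fixes D :: "real \<Rightarrow> real"
  assumes D: "continuous_on UNIV D" and near: "\<And>w. \<exists>m::int. \<bar>D w - of_int m\<bar> < \<eta>" and \<eta>: "\<eta> \<le> 1/4"
  shows "\<exists>m::int. \<forall>w. \<bar>D w - of_int m\<bar> < \<eta>"
proof -
  obtain m :: int where m: "\<bar>D 0 - of_int m\<bar> < \<eta>" using near by blast
  have con: "connected (range D)" by (rule connected_continuous_image[OF D connected_UNIV])
  have no_half: "of_int n + 1/2 \<notin> range D" for n :: int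
  proof
    assume "of_int n + 1/2 \<in> range D"
    then obtain w where "D w = of_int n + 1/2" by auto
    moreover obtain k :: int where "\<bar>D w - of_int k\<bar> < \<eta>" using near by blast
    ultimately have k: "\<bar>real_of_int n + 1/2 - of_int k\<bar> < 1/4" using \<eta> by simp
    have "real_of_int n < real_of_int k" using k by linarith
    then have "n < k" by (simp only: of_int_less_iff)
    then have "real_of_int (n + 1) \<le> real_of_int k" by (simp only: of_int_le_iff)
    then have "real_of_int n + 1 \<le> real_of_int k" by (simp only: of_int_add of_int_1)
    then show False using k by linarith
  qed
  have "\<bar>D w - of_int m\<bar> < \<eta>" for w
  proof -
    obtain k :: int where k: "\<bar>D w - of_int k\<bar> < \<eta>" using near by blast
    have "k = m"
    proof (rule ccontr)
      assume "k \<noteq> m"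
      then consider "k \<ge> m + 1" | "k \<le> m - 1" by linarith
      then show False
      proof cases
        case 1
        then have "real_of_int k \<ge> of_int m + 1" by linarith
        then have "D 0 \<le> of_int m + 1/2" "of_int m + 1/2 \<le> D w" using m k \<eta> by linarith+
        then show False using no_half[of m] connected_contains_Icc[OF con, of "D 0" "D w"] by auto
      next
        case 2
        then have "real_of_int k \<le> of_int m - 1" by linarith
        then have "D w \<le> of_int (m - 1) + 1/2" "of_int (m - 1) + 1/2 \<le> D 0" using m k \<eta> by simp_all
        then show False using no_half[of "m - 1"] connected_contains_Icc[OF con, of "D w" "D 0"] by auto
      qed
    qed
    then show ?thesis using k by simp
  qed
  then show ?thesis by blast
qed

lemma expansive: "expansive_flow X \<phi>"
  unfolding expansive_flow_def
proof (intro allI impI)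
  fix \<epsilon> :: real assume \<epsilon>: "\<epsilon> > 0"
  from time_change_modulus[OF \<epsilon>] obtain \<eta>0 where
    \<eta>0: "\<eta>0 > 0 \<and> (\<forall>y\<in>\<Sigma>. \<forall>\<gamma>\<in>Rep. (\<forall>w. pt y w = \<phi> (\<gamma> w) (pt y 0)) \<longrightarrow>
    (\<forall>w0 w1. w0 \<le> w1 \<and> w1 - w0 \<le> \<eta>0 \<longrightarrow> \<gamma> w1 - \<gamma> w0 \<le> \<epsilon>))" by (rule exE)
  \<comment> \<open>\<open>\<eta>0\<close> makes the final time shift at most \<epsilon>; 1/4
    separates the integers and keeps the partners of mid-slab points between heights 1/4 and
    3/4.\<close>
  define \<eta> where "\<eta> = min \<eta>0 (1/4)"
  have \<eta>: "\<eta> > 0" "\<eta> \<le> \<eta>0" "\<eta> \<le> 1/4" using \<eta>0 by (auto simp: \<eta>_def)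
  from close_fractions[OF \<eta>(1)] obtain \<delta>1 where \<delta>1: "\<delta>1 > 0 \<and> (\<forall>y\<in>\<Sigma>. \<forall>y'\<in>\<Sigma>. \<forall>s\<in>{0..1}. \<forall>s'\<in>{0..1}. dist (qh (y, s)) (qh (y', s')) \<le> \<delta>1 \<longrightarrow>
    \<bar>s - s'\<bar> < \<eta> \<or> 1 - \<bar>s - s'\<bar> < \<eta>)" by (rule exE)
  from close_symbols obtain \<delta>2 where \<delta>2: "\<delta>2 > 0 \<and> (\<forall>y\<in>\<Sigma>. \<forall>y'\<in>\<Sigma>. \<forall>s\<in>{1/4..3/4}. dist (qh (y, 1/2)) (qh (y', s)) \<le> \<delta>2 \<longrightarrow> y 0 = y' 0)" by (rule exE)
  define \<delta> where "\<delta> = min \<delta>1 \<delta>2"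
  show "\<exists>\<delta>>0. \<forall>x\<in>X. \<forall>y\<in>X. \<forall>h\<in>Rep. (\<forall>t. dist (\<phi> t x) (\<phi> (h t) y) \<le> \<delta>) \<longrightarrow> (\<exists>s. \<bar>s\<bar> \<le> \<epsilon> \<and> y = \<phi> s x)"
  proof (rule exI[of _ \<delta>], intro conjI ballI impI)
    show "\<delta> > 0" using \<delta>1 \<delta>2 by (simp add: \<delta>_def)
    fix x x' h assume x: "x \<in> X" and x': "x' \<in> X" and h: "h \<in> Rep" and tr: "\<forall>t. dist (\<phi> t x) (\<phi> (h t) x') \<le> \<delta>"
    obtain y w0 where y: "y \<in> \<Sigma>" "x = pt y w0" using pt_onto[OF x] by blast
    obtain y' w0' where y': "y' \<in> \<Sigma>" "x' = pt y' w0'" using pt_onto[OF x'] by blast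
    from pt_orbit[OF y(1)] obtain \<gamma> where \<gamma>: "\<gamma> \<in> Rep" "\<forall>w. pt y w = \<phi> (\<gamma> w) (pt y 0)" by blast
    from pt_orbit[OF y'(1)] obtain \<gamma>' where \<gamma>': "\<gamma>' \<in> Rep" "\<forall>w. pt y' w = \<phi> (\<gamma>' w) (pt y' 0)" by blast
    from Rep_inverse[OF \<gamma>'(1)] obtain \<gamma>i where \<gamma>i: "\<gamma>i \<in> Rep" "\<forall>t. \<gamma>' (\<gamma>i t) = t" "\<forall>t. \<gamma>i (\<gamma>' t) = t" by blast
    \<comment> \<open>\<open>k w\<close> is the parameter on the orbit of \<open>x'\<close> that
      \<open>h\<close> matches with the parameter \<open>w\<close> on the orbit of
      \<open>x\<close>.\<close>
    define k where "k w = \<gamma>i (h (\<gamma> w - \<gamma> w0) + \<gamma>' w0')" for w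
    have k0: "k w0 = w0'" using \<gamma>i(3) RepD(4)[OF h] by (simp add: k_def)
    have dk: "dist (pt y w) (pt y' (k w)) \<le> \<delta>" for w
    proof -
      have "\<phi> (\<gamma> w - \<gamma> w0) x = pt y w"
        using \<gamma>(2)[rule_format, of w] \<gamma>(2)[rule_format, of w0] y pt_in[OF y(1), of 0] by simp
      moreover have "\<phi> (h (\<gamma> w - \<gamma> w0)) x' = pt y' (k w)"
        using \<gamma>'(2)[rule_format, of "k w"] \<gamma>'(2)[rule_format, of w0'] y' pt_in[OF y'(1), of 0] \<gamma>i(2) by (simp add: k_def add.commute)
      ultimately show ?thesis using tr by metis
    qed
    have contk: "continuous_on UNIV (\<lambda>w. w - k w)"
      unfolding k_def
      by (intro continuous_intros continuous_on_compose2[OF RepD(1)[OF \<gamma>i(1), of UNIV]] continuous_on_compose2[OF RepD(1)[OF h, of UNIV]] RepD(1)[OF \<gamma>(1)]) auto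
    have near: "\<exists>m::int. \<bar>(w - k w) - of_int m\<bar> < \<eta>" for w
    proof -
      have fr: "frac u \<in> {0..1}" for u :: real by (simp add: frac_lt_1 less_imp_le)
      have "dist (qh (shiftk \<lfloor>w\<rfloor> y, frac w)) (qh (shiftk \<lfloor>k w\<rfloor> y', frac (k w))) \<le> \<delta>1" using dk[of w] by (simp add: pt_def \<delta>_def)
      then have alt: "\<bar>frac w - frac (k w)\<bar> < \<eta> \<or> 1 - \<bar>frac w - frac (k w)\<bar> < \<eta>"
        using \<delta>1[THEN conjunct2, rule_format, OF shift_in[OF y(1)] shift_in[OF y'(1)] fr fr] by blast
      have dec: "w - k w = of_int (\<lfloor>w\<rfloor> - \<lfloor>k w\<rfloor>) + (frac w - frac (k w))" by (simp add: frac_def)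
      have lt: "\<bar>frac w - frac (k w)\<bar> < 1" using frac_ge_0[of w] frac_ge_0[of "k w"] frac_lt_1[of w] frac_lt_1[of "k w"] by linarith
      \<comment> \<open>In the last two cases the fractional parts are close across the gluing, so
        the nearest integer is off by one from the difference of the floors.\<close>
      consider "\<bar>frac w - frac (k w)\<bar> < \<eta>" | "1 - (frac w - frac (k w)) < \<eta>" "frac w - frac (k w) \<ge> 0"
        | "1 + (frac w - frac (k w)) < \<eta>" "frac w - frac (k w) < 0" using alt by linarith
      then show ?thesis
      proof cases
        case 1 then show ?thesis using dec by (intro exI[of _ "\<lfloor>w\<rfloor> - \<lfloor>k w\<rfloor>"]) simp
      next
        case 2 then show ?thesis using dec lt by (intro exI[of _ "\<lfloor>w\<rfloor> - \<lfloor>k w\<rfloor> + 1"]) simp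
      next
        case 3 then show ?thesis using dec lt by (intro exI[of _ "\<lfloor>w\<rfloor> - \<lfloor>k w\<rfloor> - 1"]) simp
      qed
    qed
    obtain m :: int where m: "\<And>w. \<bar>(w - k w) - of_int m\<bar> < \<eta>" using near_integer_constant[OF contk near \<eta>(3)] by blast
    have sym: "y n = y' (n - m)" for n
    proof -
      define w where "w = of_int n + (1/2 :: real)"
      define s where "s = k w - of_int (n - m)"
      have s: "s \<in> {1/4..3/4}" using m[of w] \<eta>(3) by (auto simp: s_def w_def abs_less_iff)
      have "pt y w = qh (shiftk n y, 1/2)" unfolding w_def by (rule pt_slab[OF y(1)]) auto
      moreover have "pt y' (of_int (n - m) + s) = qh (shiftk (n - m) y', s)" using s by (intro pt_slab[OF y'(1)]) auto
      then have "pt y' (k w) = qh (shiftk (n - m) y', s)" by (simp add: s_def)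
      ultimately have "dist (qh (shiftk n y, 1/2)) (qh (shiftk (n - m) y', s)) \<le> \<delta>2" using dk[of w] by (simp add: \<delta>_def)
      then have "shiftk n y 0 = shiftk (n - m) y' 0"
        using \<delta>2[THEN conjunct2, rule_format, OF shift_in[OF y(1)] shift_in[OF y'(1)] s] by blast
      then show ?thesis by (simp add: shiftk_def)
    qed
    have yy: "y' = shiftk m y" using sym by (auto simp: shiftk_def)
    \<comment> \<open>Equal itineraries put both points on one orbit, at parameters
      \<open>w0\<close> and \<open>w1\<close> closer than \<eta>; the modulus of the time change
      converts this into a bound on time.\<close>
    define w1 where "w1 = w0' + of_int m"
    have x'w: "x' = pt y w1" using y'(2) yy by (simp add: pt_shift w1_def)
    have d01: "\<bar>w0 - w1\<bar> < \<eta>" using m[of w0] k0 by (simp add: w1_def algebra_simps)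
    have mod: "\<gamma> v1 - \<gamma> v0 \<le> \<epsilon>" if "v0 \<le> v1" "v1 - v0 \<le> \<eta>0" for v0 v1
      using \<eta>0[THEN conjunct2, rule_format, OF y(1) \<gamma>(1)] \<gamma>(2) that by blast
    have mono: "\<gamma> v0 \<le> \<gamma> v1" if "v0 \<le> v1" for v0 v1 using RepD(2)[OF \<gamma>(1)] that by (simp add: strict_mono_less_eq)
    have "\<bar>\<gamma> w1 - \<gamma> w0\<bar> \<le> \<epsilon>"
    proof (cases "w0 \<le> w1")
      case True
      then show ?thesis using mod[of w0 w1] mono[of w0 w1] d01 \<eta>(2) by simp
    next
      case False
      then show ?thesis using mod[of w1 w0] mono[of w1 w0] d01 \<eta>(2) by simp
    qed
    moreover have "x' = \<phi> (\<gamma> w1 - \<gamma> w0) x"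
      using \<gamma>(2)[rule_format, of w1] \<gamma>(2)[rule_format, of w0] y x'w pt_in[OF y(1), of 0] by simp
    ultimately show "\<exists>s. \<bar>s\<bar> \<le> \<epsilon> \<and> x' = \<phi> s x" by blast
  qed
qed

end

section \<open>Covering dimension of suspensions\<close>

lemma continuous_on_shiftk: "continuous_on S (shiftk k)"
  unfolding shiftk_def
  by (intro continuous_on_coordinatewise_then_product continuous_on_subset[OF continuous_on_product_coordinates]) auto

text \<open>Heights are divided by the roof, so that all fibres become the unit interval. The time
  change along the orbit of \<open>(y, 0)\<close> is \<alpha> after the interpolation of the
  Birkhoff sums; their gaps are bounded below because the roof has a positive minimum on the compact
  space \<Sigma>.\<close>

lemma (in compact_flow) suspension_coordinates:
  assumes ms: "minimal_subshift A \<Sigma>" and contr: "continuous_on \<Sigma> r" and rpos: "\<forall>y\<in>\<Sigma>. r y > 0"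
    and equiv: "equiv_to_suspension X \<phi> \<Sigma> r" and ne: "X \<noteq> {}"
  shows "\<exists>qh. suspension_flow X \<phi> \<Sigma> qh"
proof -
  let ?D = "susp_dom \<Sigma> r"
  obtain q where Q1: "quotient_map (top_of_set ?D) (top_of_set X) q"
    and Q2: "\<forall>p\<in>?D. \<forall>p'\<in>?D. q p = q p' \<longleftrightarrow> susp_rel r p p'"
    and Q3: "\<forall>p\<in>?D. \<exists>\<alpha>\<in>Rep. \<forall>t. q (susp_flow r t p) = \<phi> (\<alpha> t) (q p)"
    using equiv unfolding equiv_to_suspension_def by blast
  have sub: "finite A" "\<Sigma> \<subseteq> {y. \<forall>n. y n \<in> A}" "closed \<Sigma>" "shiftk 1 ` \<Sigma> = \<Sigma>"
    and dense: "\<And>y. y \<in> \<Sigma> \<Longrightarrow> \<Sigma> \<subseteq> closure {shiftk k y | k. True}"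
    using ms by (auto simp: minimal_subshift_def subshift_def)
  have img: "q ` ?D = X" using Q1 by (simp add: quotient_map_def)
  have contq: "continuous_on ?D q"
    using quotient_imp_continuous_map[OF Q1] by (simp add: continuous_map_in_subtopology)
  have "compact {y::int\<Rightarrow>nat. \<forall>n. y n \<in> A}" by (rule compact_Pi_UNIV) (simp add: sub(1) finite_imp_compact)
  then have "compact ({y::int\<Rightarrow>nat. \<forall>n. y n \<in> A} \<inter> \<Sigma>)" using sub(3) by (rule compact_Int_closed)
  moreover have "{y::int\<Rightarrow>nat. \<forall>n. y n \<in> A} \<inter> \<Sigma> = \<Sigma>" using sub(2) by blast
  ultimately have comp: "compact \<Sigma>" by simp
  have shift_in: "shiftk k y \<in> \<Sigma>" if "y \<in> \<Sigma>" for y k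
  proof (induction k rule: int_induct[where k = 0])
    case base
    then show ?case using that by simp
  next
    case (step1 i)
    have "shiftk (i + 1) y = shiftk 1 (shiftk i y)" by (simp add: add.commute)
    then show ?case using step1 sub(4) by blast
  next
    case (step2 i)
    then obtain y' where y': "y' \<in> \<Sigma>" "shiftk i y = shiftk 1 y'" using sub(4) by blast
    have "shiftk (- 1) (shiftk i y) = shiftk (- 1) (shiftk 1 y')" using y'(2) by simp
    then have "shiftk (i - 1) y = y'" by simp
    then show ?case using y'(1) by simp
  qed
  have \<Sigma>ne: "\<Sigma> \<noteq> {}" using img ne by (auto simp: susp_dom_def)
  from continuous_attains_inf[OF comp \<Sigma>ne contr] obtain y0 where y0: "y0 \<in> \<Sigma>" "\<forall>y\<in>\<Sigma>. r y0 \<le> r y" by blast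
  define c where "c = r y0"
  have c: "c > 0" "\<And>y. y \<in> \<Sigma> \<Longrightarrow> c \<le> r y" using rpos y0 by (auto simp: c_def)
  define qh where "qh p = q (fst p, snd p * r (fst p))" for p
  have inD: "(y, s * r y) \<in> ?D" if "y \<in> \<Sigma>" "s \<in> {0..1}" for y s
    using that rpos mult_left_le_one_le[of "r y" s] by (auto simp: susp_dom_def less_imp_le)
  have "suspension_flow X \<phi> \<Sigma> qh"
  proof
    show "compact \<Sigma>" by (rule comp)
    show "\<And>y k. y \<in> \<Sigma> \<Longrightarrow> shiftk k y \<in> \<Sigma>" by (rule shift_in)
    show "\<And>y. y \<in> \<Sigma> \<Longrightarrow> \<Sigma> \<subseteq> closure {shiftk k y | k. True}" by (rule dense)
    show "continuous_on (\<Sigma> \<times> {0..1}) qh"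
      unfolding qh_def
      by (intro continuous_on_compose2[OF contq] continuous_intros continuous_on_compose2[OF contr]) (use inD in auto)
    show "qh ` (\<Sigma> \<times> {0..1}) = X"
    proof
      show "qh ` (\<Sigma> \<times> {0..1}) \<subseteq> X" using inD img by (auto simp: qh_def)
      show "X \<subseteq> qh ` (\<Sigma> \<times> {0..1})"
      proof
        fix x assume "x \<in> X"
        then obtain y s where ys: "(y, s) \<in> ?D" "x = q (y, s)" using img by auto
        then have y: "y \<in> \<Sigma>" "0 \<le> s" "s \<le> r y" "r y > 0" using rpos by (auto simp: susp_dom_def)
        then have "x = qh (y, s / r y)" "(y, s / r y) \<in> \<Sigma> \<times> {0..1}" using ys(2) by (auto simp: qh_def)
        then show "x \<in> qh ` (\<Sigma> \<times> {0..1})" by blast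
      qed
    qed
    fix y assume y: "y \<in> \<Sigma>"
    show "qh (y, 1) = qh (shiftk 1 y, 0)"
      using Q2[rule_format, OF inD[OF y, of 1] inD[OF shift_in[OF y, of 1], of 0]] by (simp add: qh_def susp_rel_def)
    show "\<exists>\<gamma>\<in>Rep. \<forall>w. qh (shiftk \<lfloor>w\<rfloor> y, frac w) = \<phi> (\<gamma> w) (qh (y, 0))"
    proof -
      have "(y, 0) \<in> ?D" using inD[OF y, of 0] by simp
      then obtain \<alpha> where \<alpha>: "\<alpha> \<in> Rep" "\<forall>t. q (susp_flow r t (y, 0)) = \<phi> (\<alpha> t) (q (y, 0))" using Q3 by blast
      let ?rs = "roof_sum r y"
      have gap: "?rs n + c \<le> ?rs (n + 1)" for n using c(2)[OF shift_in[OF y, of n]] by (simp add: roof_sum_Suc)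
      have R: "(\<lambda>w. \<alpha> (interp ?rs w)) \<in> Rep"
        using Rep_comp[OF \<alpha>(1)] interp_Rep[where a = ?rs, OF gap c(1)] by simp
      have "qh (shiftk \<lfloor>w\<rfloor> y, frac w) = \<phi> (\<alpha> (interp ?rs w)) (qh (y, 0))" for w
      proof -
        let ?u = "interp ?rs w"
        have u: "?u = ?rs \<lfloor>w\<rfloor> + frac w * r (shiftk \<lfloor>w\<rfloor> y)" by (simp add: interp_def roof_sum_Suc)
        have rp: "r (shiftk \<lfloor>w\<rfloor> y) > 0" using rpos shift_in[OF y] by blast
        have "0 \<le> frac w * r (shiftk \<lfloor>w\<rfloor> y)" "frac w * r (shiftk \<lfloor>w\<rfloor> y) < 1 * r (shiftk \<lfloor>w\<rfloor> y)"
          using rp by (simp, intro mult_strict_right_mono frac_lt_1)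
        then have b: "?rs \<lfloor>w\<rfloor> \<le> ?u \<and> ?u < ?rs (\<lfloor>w\<rfloor> + 1)" by (simp add: u roof_sum_Suc)
        have "(THE k. ?rs k \<le> ?u \<and> ?u < ?rs (k + 1)) = \<lfloor>w\<rfloor>"
          by (rule the1_equality[OF ex1_bracket[where a = ?rs, OF gap c(1)] b])
        then have "susp_flow r ?u (y, 0) = (shiftk \<lfloor>w\<rfloor> y, frac w * r (shiftk \<lfloor>w\<rfloor> y))" by (simp add: susp_flow_def Let_def u)
        then show ?thesis using \<alpha>(2)[rule_format, of ?u] by (simp add: qh_def)
      qed
      note E = this
      show ?thesis by (rule bexI[OF _ R], rule allI, rule E)
    qed
    fix y' s s' assume y': "y' \<in> \<Sigma>" and s: "s \<in> {0..1::real}" "s' \<in> {0..1::real}" and eq: "qh (y, s) = qh (y', s')"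
    have "susp_rel r (y, s * r y) (y', s' * r y')"
      using Q2[rule_format, OF inD[OF y s(1)] inD[OF y' s(2)]] eq by (simp add: qh_def)
    moreover have "r y \<noteq> 0" "r y' \<noteq> 0" using rpos y y' by fastforce+
    ultimately show "y = y' \<and> s = s' \<or> s = 1 \<and> s' = 0 \<and> y' = shiftk 1 y \<or> s' = 1 \<and> s = 0 \<and> y = shiftk 1 y'"
      by (auto simp: susp_rel_def)
  qed
  then show ?thesis by blast
qed

text \<open>Each condition \<open>z n = y n\<close> is clopen, so on a connected set it holds
  everywhere as soon as it holds at one point.\<close>

lemma sequence_space_totally_disconnected:
  fixes C :: "(int \<Rightarrow> nat) set"
  assumes "connected C" shows "\<exists>x. C \<subseteq> {x}"
proof (cases "C = {}")
  case False
  then obtain y where y: "y \<in> C" by blast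
  have "z = y" if z: "z \<in> C" for z
  proof
    fix n
    let ?E = "C \<inter> (\<lambda>z. z n) -` {y n}"
    have c: "continuous_on C (\<lambda>z. z n)" by (rule continuous_on_subset[OF continuous_on_product_coordinates]) simp
    have "openin (top_of_set C) ?E" by (rule continuous_openin_preimage_gen[OF c]) (simp add: open_discrete)
    moreover have "closedin (top_of_set C) ?E" by (rule continuous_closedin_preimage[OF c]) simp
    ultimately have "?E = C" using assms y by (metis (mono_tags, lifting) IntI connected_clopen empty_iff singletonI vimage_eq)
    then show "z n = y n" using z by blast
  qed
  then show ?thesis by blast
qed simp

lemma card_disjoint_members:
  assumes "finite \<V>" "\<And>V W. V \<in> \<V> \<Longrightarrow> W \<in> \<V> \<Longrightarrow> x \<in> V \<Longrightarrow> x \<in> W \<Longrightarrow> V = W"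
  shows "card {V \<in> \<V>. x \<in> V} \<le> 1"
  using assms card_le_Suc0_iff_eq[of "{V \<in> \<V>. x \<in> V}"] by auto

context suspension_flow
begin

text \<open>Compatibility with the gluing, so that the set is a union of fibres of
  \<open>qh\<close>. This lets a cover of \<open>X\<close> be built from boxes in the product:
  openness and disjointness pass to the images.\<close>

definition saturated :: "((int \<Rightarrow> nat) \<times> real) set \<Rightarrow> bool" where
  "saturated U \<longleftrightarrow> U \<subseteq> \<Sigma> \<times> {0..1} \<and> (\<forall>y\<in>\<Sigma>. (y, 1) \<in> U \<longleftrightarrow> (shiftk 1 y, 0) \<in> U)"

lemma saturated_fib:
  assumes "saturated U" "p \<in> U" "p' \<in> \<Sigma> \<times> {0..1}" "qh p = qh p'"
  shows "p' \<in> U"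
proof -
  obtain y s y' s' where pe: "p = (y, s)" "p' = (y', s')" by (metis prod.collapse)
  have D: "y \<in> \<Sigma>" "y' \<in> \<Sigma>" "s \<in> {0..1}" "s' \<in> {0..1}" using assms by (auto simp: pe saturated_def)
  then show ?thesis using fib[of y y' s s'] assms by (auto simp: pe saturated_def)
qed

text \<open>The complement of \<open>U\<close> in the product is compact, and so is its image; by
  saturation this image is exactly the complement of the image of \<open>U\<close>.\<close>

lemma saturated_open:
  assumes "saturated U" "openin (top_of_set (\<Sigma> \<times> {0..1})) U"
  shows "openin (top_of_set X) (qh ` U)"
proof -
  let ?D = "\<Sigma> \<times> {0..1::real}"
  have UD: "U \<subseteq> ?D" using assms(1) by (simp add: saturated_def)
  obtain T where T: "open T" "U = ?D \<inter> T" using assms(2) by (auto simp: openin_open)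
  have "?D - U = ?D \<inter> - T" using T(2) by blast
  then have "compact (?D - U)" using compact_Int_closed[OF compD, of "- T"] T(1) by (simp add: closed_Compl)
  then have "compact (qh ` (?D - U))" by (intro compact_continuous_image continuous_on_subset[OF cont]) auto
  then have "open (- qh ` (?D - U))" by (simp add: compact_imp_closed open_Compl)
  moreover have "qh ` U = X \<inter> - qh ` (?D - U)"
  proof
    show "qh ` U \<subseteq> X \<inter> - qh ` (?D - U)"
    proof clarify
      fix y s assume p: "(y, s) \<in> U"
      have "qh (y, s) \<in> X" using p UD onto by blast
      moreover have "qh (y, s) \<notin> qh ` (?D - U)" using saturated_fib[OF assms(1) p] by blast
      ultimately show "qh (y, s) \<in> X \<inter> - qh ` (?D - U)" by blast
    qed
    show "X \<inter> - qh ` (?D - U) \<subseteq> qh ` U" using onto by blast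
  qed
  ultimately show ?thesis by (auto simp: openin_open)
qed

lemma saturated_disjoint:
  assumes "saturated U" "saturated U'" "x \<in> qh ` U" "x \<in> qh ` U'"
  shows "\<exists>p. p \<in> U \<and> p \<in> U'"
proof -
  obtain p p' where p: "p \<in> U" "x = qh p" "p' \<in> U'" "x = qh p'" using assms(3,4) by blast
  have "p' \<in> \<Sigma> \<times> {0..1}" using p(3) assms(2) by (auto simp: saturated_def)
  then have "p' \<in> U" using saturated_fib[OF assms(1) p(1)] p by simp
  then show ?thesis using p(3) by blast
qed

text \<open>The open boxes between consecutive levels \<open>j / N\<close> are disjoint, and so are the neighbourhoods of the levels;
  the neighbourhood of level \<open>0\<close> also contains the top of the boxes that return to the same piece of the base.\<close>

lemma covering_dim_le_1:
  assumes ne: "X \<noteq> {}"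
  shows "covering_dim_le X 1"
  unfolding covering_dim_le_def
proof (intro allI impI, elim conjE)
  fix \<U> assume U: "finite \<U>" "\<forall>U\<in>\<U>. openin (top_of_set X) U" "X \<subseteq> \<Union>\<U>"
  let ?D = "\<Sigma> \<times> {0..1::real}"
  have "X \<subseteq> \<Union>{W. open W \<and> X \<inter> W \<in> \<U>}"
  proof
    fix x assume x: "x \<in> X"
    then obtain V where V: "V \<in> \<U>" "x \<in> V" using U(3) by blast
    then obtain W where "open W" "V = X \<inter> W" using U(2) by (auto simp: openin_open)
    then show "x \<in> \<Union>{W. open W \<and> X \<inter> W \<in> \<U>}" using V by blast
  qed
  \<comment> \<open>A Lebesgue number of the cover.\<close>
  then obtain \<delta> where \<delta>: "\<delta> > 0" "\<And>x. x \<in> X \<Longrightarrow> \<exists>W\<in>{W. open W \<and> X \<inter> W \<in> \<U>}. ball x \<delta> \<subseteq> W"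
    using Heine_Borel_lemma[OF compX, of "{W. open W \<and> X \<inter> W \<in> \<U>}"] by blast
  have refine: "\<exists>V\<in>\<U>. T \<subseteq> V" if T: "T \<subseteq> X" "\<And>x x'. x \<in> T \<Longrightarrow> x' \<in> T \<Longrightarrow> dist x x' < \<delta>" for T
  proof -
    have "\<exists>x\<in>X. T \<subseteq> ball x \<delta>"
    proof (cases "T = {}")
      case True then show ?thesis using ne by blast
    next
      case False
      then obtain x where x: "x \<in> T" by blast
      have "T \<subseteq> ball x \<delta>"
      proof
        fix x' assume "x' \<in> T"
        then show "x' \<in> ball x \<delta>" using T(2)[OF x] by simp
      qed
      then show ?thesis using x T(1) by blast
    qed
    then obtain x where x: "x \<in> X" "T \<subseteq> ball x \<delta>" by blast
    obtain W where "X \<inter> W \<in> \<U>" "ball x \<delta> \<subseteq> W" using \<delta>(2)[OF x(1)] by blast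
    then show ?thesis using x(2) T(1) by (intro bexI[of _ "X \<inter> W"]) auto
  qed
  have "uniformly_continuous_on ?D qh" by (rule compact_uniformly_continuous[OF cont compD])
  \<comment> \<open>Two points in the neighbourhood of one level are compared through two points on
    that level, in three steps shorter than \<open>\<delta>/3\<close>.\<close>
  moreover have "\<delta>/3 > 0" using \<delta>(1) by simp
  ultimately obtain \<kappa> where \<kappa>: "\<kappa> > 0" "\<forall>p\<in>?D. \<forall>p'\<in>?D. dist p' p < \<kappa> \<longrightarrow> dist (qh p') (qh p) < \<delta>/3"
    unfolding uniformly_continuous_on_def by blast
  have "\<exists>P::(int \<Rightarrow> nat) \<Rightarrow> nat. finite (P ` \<Sigma>) \<and> continuous_on \<Sigma> P \<and> (\<forall>x\<in>\<Sigma>. \<forall>y\<in>\<Sigma>. P x = P y \<longrightarrow> dist x y < \<kappa>/2)"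
    using \<kappa>(1) by (intro zero_dim_labelling[OF comp\<Sigma>] sequence_space_totally_disconnected) auto
  then obtain P :: "(int \<Rightarrow> nat) \<Rightarrow> nat" where P: "finite (P ` \<Sigma>)" "continuous_on \<Sigma> P" "\<forall>x\<in>\<Sigma>. \<forall>y\<in>\<Sigma>. P x = P y \<longrightarrow> dist x y < \<kappa>/2"
    by blast
  have "\<kappa>/2 > 0" using \<kappa>(1) by simp
  then obtain N0 where N0: "1 / real (Suc N0) < \<kappa>/2" using nat_approx_posE by blast
  define N where "N = Suc N0"
  have N: "N \<ge> 1" "1 / real N < \<kappa>/2" "real N > 0" "real N \<ge> 1" using N0 by (auto simp: N_def)
  have close: "dist (qh (y, s)) (qh (y', s')) < \<delta>/3"
    if "y \<in> \<Sigma>" "y' \<in> \<Sigma>" "P y = P y'" "s \<in> {0..1}" "s' \<in> {0..1}" "\<bar>s * real N - s' * real N\<bar> \<le> 1" for y y' s s'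
  proof -
    have "\<bar>s - s'\<bar> * real N \<le> 1" using that(6) N(3) by (simp add: abs_mult left_diff_distrib[symmetric])
    then have "\<bar>s - s'\<bar> \<le> 1 / real N" using N(3) by (simp add: field_simps)
    moreover have "dist y y' < \<kappa>/2" using P(3) that by blast
    moreover have "dist (y, s) (y', s') \<le> dist y y' + dist s s'"
      unfolding dist_Pair_Pair by (rule sqrt_sum_squares_le_sum) auto
    ultimately have "dist (y, s) (y', s') < \<kappa>" using N(2) by (simp add: dist_real_def)
    then show ?thesis using \<kappa>(2) that by (simp add: dist_commute)
  qed
  define W where "W ij = {p \<in> ?D. P (fst p) = fst ij \<and> real (snd ij) < snd p * real N \<and> snd p * real N < real (snd ij) + 1}" for ij
  \<comment> \<open>The margin 1/4 keeps neighbourhoods of different levels disjoint. Indices run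
    below \<open>N\<close> only, as level \<open>N\<close> is level 0 over the shifted
    sequence.\<close>
  define J where "J ij = {p \<in> ?D. (P (fst p) = fst ij \<and> real (snd ij) - 1/4 < snd p * real N \<and> snd p * real N < real (snd ij) + 1/4)
     \<or> (snd ij = 0 \<and> P (shiftk 1 (fst p)) = fst ij \<and> real N - 1/4 < snd p * real N)}" for ij
  let ?I = "P ` \<Sigma> \<times> {..<N}"
  have fI: "finite ?I" using P(1) by simp
  have cP: "continuous_on ?D (\<lambda>p. P (fst p))" "continuous_on ?D (\<lambda>p. P (shiftk 1 (fst p)))"
    by (intro continuous_on_compose2[OF P(2)] continuous_intros continuous_on_compose2[OF continuous_on_shiftk[of UNIV]]; use shift_in in force)+
  have cs: "continuous_on ?D (\<lambda>p. snd p * real N)" by (intro continuous_intros)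
  have opP: "openin (top_of_set ?D) (?D \<inter> (\<lambda>p. P (fst p)) -` {i})" "openin (top_of_set ?D) (?D \<inter> (\<lambda>p. P (shiftk 1 (fst p))) -` {i})" for i
    by (rule continuous_openin_preimage_gen[OF cP(1)], simp add: open_discrete, rule continuous_openin_preimage_gen[OF cP(2)], simp add: open_discrete)
  have ops: "openin (top_of_set ?D) (?D \<inter> (\<lambda>p. snd p * real N) -` {l<..<u})" "openin (top_of_set ?D) (?D \<inter> (\<lambda>p. snd p * real N) -` {l<..})" for l u
    by (rule continuous_openin_preimage_gen[OF cs], simp)+
  have Wopen: "openin (top_of_set ?D) (W ij)" for ij
  proof -
    have "W ij = (?D \<inter> (\<lambda>p. P (fst p)) -` {fst ij}) \<inter> (?D \<inter> (\<lambda>p. snd p * real N) -` {real (snd ij)<..<real (snd ij) + 1})"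
      by (auto simp: W_def)
    then show ?thesis using openin_Int[OF opP(1) ops(1)] by simp
  qed
  have Jopen: "openin (top_of_set ?D) (J ij)" for ij
  proof -
    have "J ij = ((?D \<inter> (\<lambda>p. P (fst p)) -` {fst ij}) \<inter> (?D \<inter> (\<lambda>p. snd p * real N) -` {real (snd ij) - 1/4<..<real (snd ij) + 1/4}))
      \<union> (if snd ij = 0 then (?D \<inter> (\<lambda>p. P (shiftk 1 (fst p))) -` {fst ij}) \<inter> (?D \<inter> (\<lambda>p. snd p * real N) -` {real N - 1/4<..}) else {})"
      by (auto simp: J_def)
    then show ?thesis using openin_Int[OF opP(1) ops(1)] openin_Int[OF opP(2) ops(2)] by (simp add: openin_Un)
  qed
  have Wsat: "saturated (W ij)" if "ij \<in> ?I" for ij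
    using that by (auto simp: saturated_def W_def)
  have Jsat: "saturated (J ij)" if "ij \<in> ?I" for ij
  proof -
    have j: "snd ij < N" "real (snd ij) \<le> real N - 1" using that by auto
    have "(y, 1) \<in> J ij \<longleftrightarrow> (shiftk 1 y, 0) \<in> J ij" if y: "y \<in> \<Sigma>" for y
    proof -
      have "(y, 1) \<in> J ij \<longleftrightarrow> snd ij = 0 \<and> P (shiftk 1 y) = fst ij" using y j(2) by (auto simp: J_def)
      moreover have "(shiftk 1 y, 0) \<in> J ij \<longleftrightarrow> snd ij = 0 \<and> P (shiftk 1 y) = fst ij"
        using shift_in[OF y, of 1] N(4) by (auto simp: J_def)
      ultimately show ?thesis by simp
    qed
    moreover have "J ij \<subseteq> ?D" by (auto simp: J_def)
    ultimately show ?thesis by (simp add: saturated_def)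
  qed
  have Wdisj: "ij = kl" if p: "p \<in> W ij" "p \<in> W kl" for ij kl p
  proof (rule prod_eqI)
    show "fst ij = fst kl" using p by (simp add: W_def)
    have "real (snd ij) < real (snd kl) + 1" "real (snd kl) < real (snd ij) + 1" using p by (simp_all add: W_def)
    then show "snd ij = snd kl" by linarith
  qed
  have Jdisj: "ij = kl" if ij: "ij \<in> ?I" "kl \<in> ?I" and p: "p \<in> J ij" "p \<in> J kl" for ij kl p
  proof -
    have j: "real (snd ij) \<le> real N - 1" "real (snd kl) \<le> real N - 1" using ij by auto
    have pij: "P (fst p) = fst ij \<and> real (snd ij) - 1/4 < snd p * real N \<and> snd p * real N < real (snd ij) + 1/4
        \<or> snd ij = 0 \<and> P (shiftk 1 (fst p)) = fst ij \<and> real N - 1/4 < snd p * real N" using p(1) unfolding J_def by blast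
    have pkl: "P (fst p) = fst kl \<and> real (snd kl) - 1/4 < snd p * real N \<and> snd p * real N < real (snd kl) + 1/4
        \<or> snd kl = 0 \<and> P (shiftk 1 (fst p)) = fst kl \<and> real N - 1/4 < snd p * real N" using p(2) unfolding J_def by blast
    show ?thesis
    proof (cases "real N - 1/4 < snd p * real N")
      case True
      then have "snd ij = 0 \<and> P (shiftk 1 (fst p)) = fst ij" "snd kl = 0 \<and> P (shiftk 1 (fst p)) = fst kl"
        using pij pkl j by linarith+
      then show ?thesis by (intro prod_eqI) simp_all
    next
      case False
      then have 1: "P (fst p) = fst ij" "real (snd ij) - 1/4 < snd p * real N" "snd p * real N < real (snd ij) + 1/4"
        "P (fst p) = fst kl" "real (snd kl) - 1/4 < snd p * real N" "snd p * real N < real (snd kl) + 1/4" using pij pkl by blast+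
      then have "real (snd ij) < real (snd kl) + 1" "real (snd kl) < real (snd ij) + 1" by linarith+
      then have "snd ij = snd kl" by linarith
      then show ?thesis using 1(1,4) by (intro prod_eqI) simp_all
    qed
  qed
  have Wsmall: "dist x x' < \<delta>" if x: "x \<in> qh ` W ij" "x' \<in> qh ` W ij" for ij x x'
  proof -
    obtain p where p: "p \<in> W ij" "x = qh p" using x(1) by blast
    obtain p' where p': "p' \<in> W ij" "x' = qh p'" using x(2) by blast
    have w: "fst p \<in> \<Sigma>" "fst p' \<in> \<Sigma>" "P (fst p) = P (fst p')" "snd p \<in> {0..1}" "snd p' \<in> {0..1}"
      "real (snd ij) < snd p * real N" "snd p * real N < real (snd ij) + 1"
      "real (snd ij) < snd p' * real N" "snd p' * real N < real (snd ij) + 1"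
      using p(1) p'(1) by (auto simp: W_def)
    have "\<bar>snd p * real N - snd p' * real N\<bar> \<le> 1" using w(6-9) by linarith
    then have "dist (qh (fst p, snd p)) (qh (fst p', snd p')) < \<delta>/3" by (intro close w)
    then show ?thesis using p(2) p'(2) \<delta>(1) by simp
  qed
  have Jsmall: "dist x x' < \<delta>" if ij: "ij \<in> ?I" and x: "x \<in> qh ` J ij" "x' \<in> qh ` J ij" for ij x x'
  proof -
    define s0 where "s0 = real (snd ij) / real N"
    have s0: "s0 \<in> {0..1}" "s0 * real N = real (snd ij)" using ij N(3) by (auto simp: s0_def field_simps)
    have near: "\<exists>u\<in>\<Sigma>. P u = fst ij \<and> dist z (qh (u, s0)) < \<delta>/3" if zJ: "z \<in> qh ` J ij" for z
    proof -
      obtain p where "p \<in> J ij" "z = qh p" using zJ by blast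
      then obtain y s where p: "(y, s) \<in> J ij" "z = qh (y, s)" by (metis prod.collapse)
      then have D: "y \<in> \<Sigma>" "s \<in> {0..1}" by (auto simp: J_def)
      consider "P y = fst ij" "real (snd ij) - 1/4 < s * real N" "s * real N < real (snd ij) + 1/4"
        | "snd ij = 0" "P (shiftk 1 y) = fst ij" "real N - 1/4 < s * real N" using p(1) by (auto simp: J_def)
      then show ?thesis
      proof cases
        case 1
        have "\<bar>s * real N - s0 * real N\<bar> \<le> 1" using 1(2,3) unfolding s0(2) by linarith
        then have "dist (qh (y, s)) (qh (y, s0)) < \<delta>/3" by (intro close D s0(1) refl)
        then show ?thesis unfolding p(2) using 1(1) D(1) by (intro bexI[of _ y] conjI)
      next
        case 2
        have "s * real N \<le> 1 * real N" using D(2) by (intro mult_right_mono) auto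
        then have "\<bar>s * real N - 1 * real N\<bar> \<le> 1" using 2(3) by linarith
        then have "dist (qh (y, s)) (qh (y, 1)) < \<delta>/3" by (intro close D refl) auto
        moreover have "s0 = 0" using 2 by (simp add: s0_def)
        ultimately show ?thesis using 2 p(2) glue[OF D(1)] shift_in[OF D(1), of 1] by (intro bexI[of _ "shiftk 1 y"]) auto
      qed
    qed
    obtain u where u: "u \<in> \<Sigma>" "P u = fst ij" "dist x (qh (u, s0)) < \<delta>/3" using near[OF x(1)] by blast
    obtain u' where u': "u' \<in> \<Sigma>" "P u' = fst ij" "dist x' (qh (u', s0)) < \<delta>/3" using near[OF x(2)] by blast
    have "dist (qh (u, s0)) (qh (u', s0)) < \<delta>/3" using u u' s0 by (intro close) auto
    moreover have "dist x x' \<le> dist x (qh (u, s0)) + dist (qh (u, s0)) (qh (u', s0)) + dist x' (qh (u', s0))"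
      using dist_triangle[of x x' "qh (u, s0)"] dist_triangle2[of "qh (u, s0)" x' "qh (u', s0)"] by linarith
    ultimately show ?thesis using u(3) u'(3) by linarith
  qed
  define \<W> where "\<W> = (\<lambda>ij. qh ` W ij) ` ?I"
  define \<J> where "\<J> = (\<lambda>ij. qh ` J ij) ` ?I"
  have fin: "finite \<W>" "finite \<J>" using fI by (auto simp: \<W>_def \<J>_def)
  have W1: "card {V \<in> \<W>. x \<in> V} \<le> 1" for x
  proof (rule card_disjoint_members[OF fin(1)])
    fix V V' assume A: "V \<in> \<W>" "V' \<in> \<W>" "x \<in> V" "x \<in> V'"
    from A(1) obtain ij where ij: "ij \<in> ?I" "V = qh ` W ij" unfolding \<W>_def by blast
    from A(2) obtain kl where kl: "kl \<in> ?I" "V' = qh ` W kl" unfolding \<W>_def by blast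
    have "x \<in> qh ` W ij" "x \<in> qh ` W kl" using A(3,4) ij(2) kl(2) by simp_all
    from saturated_disjoint[OF Wsat[OF ij(1)] Wsat[OF kl(1)] this] obtain p where p: "p \<in> W ij" "p \<in> W kl" by (elim exE conjE)
    then have "ij = kl" using Wdisj[OF p] by simp
    then show "V = V'" using ij(2) kl(2) by simp
  qed
  have J1: "card {V \<in> \<J>. x \<in> V} \<le> 1" for x
  proof (rule card_disjoint_members[OF fin(2)])
    fix V V' assume A: "V \<in> \<J>" "V' \<in> \<J>" "x \<in> V" "x \<in> V'"
    from A(1) obtain ij where ij: "ij \<in> ?I" "V = qh ` J ij" unfolding \<J>_def by blast
    from A(2) obtain kl where kl: "kl \<in> ?I" "V' = qh ` J kl" unfolding \<J>_def by blast
    have "x \<in> qh ` J ij" "x \<in> qh ` J kl" using A(3,4) ij(2) kl(2) by simp_all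
    from saturated_disjoint[OF Jsat[OF ij(1)] Jsat[OF kl(1)] this] obtain p where p: "p \<in> J ij" "p \<in> J kl" by (elim exE conjE)
    then have "ij = kl" using Jdisj[OF ij(1) kl(1) p] by simp
    then show "V = V'" using ij(2) kl(2) by simp
  qed
  have cover: "X \<subseteq> \<Union>(\<W> \<union> \<J>)"
  proof
    fix x assume "x \<in> X"
    then obtain y s where p: "y \<in> \<Sigma>" "0 \<le> s" "s \<le> 1" "x = qh (y, s)" using onto by force
    show "x \<in> \<Union>(\<W> \<union> \<J>)"
    proof (cases "s = 1")
      case True
      have "(y, s) \<in> J (P (shiftk 1 y), 0)" using p True by (simp add: J_def)
      moreover have "(P (shiftk 1 y), 0) \<in> ?I" using shift_in[OF p(1), of 1] N(1) by simp
      ultimately show ?thesis using p(4) unfolding \<J>_def by blast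
    next
      case False
      define j where "j = nat \<lfloor>s * real N\<rfloor>"
      have "0 \<le> s * real N" using p(2) by simp
      then have rj: "real j = of_int \<lfloor>s * real N\<rfloor>" by (simp add: j_def)
      have j: "real j \<le> s * real N" "s * real N < real j + 1" unfolding rj by linarith+
      have "s * real N < 1 * real N" using False p(3) N(3) by (intro mult_strict_right_mono) auto
      then have jN: "j < N" using j(1) by simp
      have I: "(P y, j) \<in> ?I" using p(1) jN by simp
      show ?thesis
      proof (cases "s * real N = real j")
        case True
        then have "(y, s) \<in> J (P y, j)" using p by (simp add: J_def)
        then show ?thesis using p(4) I unfolding \<J>_def by blast
      next
        case False
        then have "(y, s) \<in> W (P y, j)" using p j by (simp add: W_def)
        then show ?thesis using p(4) I unfolding \<W>_def by blast
      qed
    qed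
  qed
  show "\<exists>\<V>. finite \<V> \<and> (\<forall>V\<in>\<V>. openin (top_of_set X) V) \<and> X \<subseteq> \<Union>\<V> \<and>
             (\<forall>V\<in>\<V>. \<exists>U\<in>\<U>. V \<subseteq> U) \<and> (\<forall>x\<in>X. card {V\<in>\<V>. x \<in> V} \<le> 1 + 1)"
  proof (rule exI[of _ "\<W> \<union> \<J>"], intro conjI)
    show "finite (\<W> \<union> \<J>)" using fin by simp
    show "\<forall>V\<in>\<W> \<union> \<J>. openin (top_of_set X) V"
      using saturated_open[OF Wsat Wopen] saturated_open[OF Jsat Jopen] unfolding \<W>_def \<J>_def by blast
    show "X \<subseteq> \<Union>(\<W> \<union> \<J>)" by (rule cover)
    show "\<forall>V\<in>\<W> \<union> \<J>. \<exists>U\<in>\<U>. V \<subseteq> U"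
    proof
      fix V assume "V \<in> \<W> \<union> \<J>"
      then obtain ij where ij: "ij \<in> ?I" "V = qh ` W ij \<or> V = qh ` J ij" unfolding \<W>_def \<J>_def by blast
      have "W ij \<subseteq> ?D" "J ij \<subseteq> ?D" by (auto simp: W_def J_def)
      then have "V \<subseteq> X" using ij(2) onto by blast
      moreover have "dist x x' < \<delta>" if "x \<in> V" "x' \<in> V" for x x'
        using ij(2) that Wsmall[of x ij x'] Jsmall[OF ij(1), of x x'] by blast
      ultimately show "\<exists>U\<in>\<U>. V \<subseteq> U" by (rule refine)
    qed
    show "\<forall>x\<in>X. card {V \<in> \<W> \<union> \<J>. x \<in> V} \<le> 1 + 1"
    proof
      fix x
      have "{V \<in> \<W> \<union> \<J>. x \<in> V} = {V \<in> \<W>. x \<in> V} \<union> {V \<in> \<J>. x \<in> V}" by blast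
      then show "card {V \<in> \<W> \<union> \<J>. x \<in> V} \<le> 1 + 1"
        using card_Un_le[of "{V \<in> \<W>. x \<in> V}" "{V \<in> \<J>. x \<in> V}"] W1[of x] J1[of x] by simp
    qed
  qed
qed

end

text \<open>A cover of order one consists of disjoint open sets, so its member through
  \<open>x\<close> is clopen and equals the connected set \<open>X\<close>; but a refinement must
  put it inside \<open>X - {x}\<close> or \<open>X - {y}\<close>.\<close>

lemma connected_not_covering_dim_0:
  fixes X :: "'a::metric_space set"
  assumes con: "connected X" and xy: "x \<in> X" "y \<in> X" "x \<noteq> y"
  shows "\<not> covering_dim_le X 0"
proof
  assume dim: "covering_dim_le X 0"
  let ?U = "{X - {x}, X - {y}}"
  have H: "finite ?U \<and> (\<forall>U\<in>?U. openin (top_of_set X) U) \<and> X \<subseteq> \<Union>?U"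
  proof (intro conjI)
    have "openin (top_of_set X) (X - {z})" for z
      by (simp add: openin_delete)
    then show "\<forall>U\<in>?U. openin (top_of_set X) U" by blast
  qed (use xy in auto)
  from dim[unfolded covering_dim_le_def, THEN spec, THEN mp, OF H] obtain \<V> where
    V0: "finite \<V> \<and> (\<forall>V\<in>\<V>. openin (top_of_set X) V) \<and> X \<subseteq> \<Union>\<V> \<and> (\<forall>V\<in>\<V>. \<exists>U\<in>?U. V \<subseteq> U) \<and>
      (\<forall>x\<in>X. card {V\<in>\<V>. x \<in> V} \<le> 0 + 1)" by (rule exE)
  note V = V0[THEN conjunct1] V0[THEN conjunct2, THEN conjunct1] V0[THEN conjunct2, THEN conjunct2, THEN conjunct1]
    V0[THEN conjunct2, THEN conjunct2, THEN conjunct2, THEN conjunct1] V0[THEN conjunct2, THEN conjunct2, THEN conjunct2, THEN conjunct2]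
  obtain V where Vx: "V \<in> \<V>" "x \<in> V" using V(3) xy(1) by blast
  have VX: "V \<subseteq> X" using V(2) Vx(1) openin_imp_subset by blast
  have "X - V = \<Union>(\<V> - {V}) \<inter> X"
  proof (intro equalityI subsetI)
    fix z assume z: "z \<in> \<Union>(\<V> - {V}) \<inter> X"
    then obtain V' where V': "V' \<in> \<V>" "V' \<noteq> V" "z \<in> V'" by blast
    have "z \<notin> V"
    proof
      assume "z \<in> V"
      then have "{V, V'} \<subseteq> {V\<in>\<V>. z \<in> V}" using V' Vx by blast
      then have "card {V, V'} \<le> card {V\<in>\<V>. z \<in> V}" using V(1) by (intro card_mono) auto
      moreover have "card {V\<in>\<V>. z \<in> V} \<le> 1" using V(5) z by simp
      ultimately show False using V'(2) by simp
    qed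
    then show "z \<in> X - V" using z by blast
  qed (use V(3) in blast)
  moreover have "openin (top_of_set X) (\<Union>(\<V> - {V}) \<inter> X)"
    using V(2) by (intro openin_Int openin_Union) auto
  ultimately have "openin (top_of_set X) (X - V)" by simp
  then have "closedin (top_of_set X) V" using VX by (simp add: closedin_def)
  then have "V = X" using con V(2) Vx by (auto simp: connected_clopen)
  then show False using V(4) Vx(1) xy by blast
qed

text \<open>An orbit is connected as an image of the line, and dense by recurrence.\<close>

lemma (in compact_flow) minimal_connected:
  assumes "minimal_flow X \<phi>"
  shows "connected X"
proof (cases "X = {}")
  case False
  then obtain x where x: "x \<in> X" by blast
  let ?O = "range (\<lambda>t. \<phi> t x)"
  have "continuous_on UNIV (\<lambda>t. \<phi> t x)" using x by (intro continuous_on_flow continuous_intros) auto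
  then have "connected ?O" by (rule connected_continuous_image) simp
  moreover have "?O \<subseteq> X" using x by auto
  moreover have "X \<subseteq> closure ?O"
  proof
    fix b assume b: "b \<in> X"
    have "\<exists>y\<in>?O. dist y b < e" if e: "e > 0" for e
    proof -
      have "b \<in> ball b e" using e by simp
      from recurrence[OF assms x open_ball this b, of 0] obtain t where "dist b (\<phi> t x) < e" by auto
      then show ?thesis by (auto simp: dist_commute)
    qed
    then show "b \<in> closure ?O" by (simp add: closure_approachable)
  qed
  ultimately show ?thesis by (rule connected_intermediate_closure)
qed simp

theorem theoremA:
  fixes X :: "'a::metric_space set" and \<phi> :: "real \<Rightarrow> 'a \<Rightarrow> 'a"
  assumes "compact X"
    and "is_flow X \<phi>"
    and "\<exists>x\<in>X. \<exists>y\<in>X. x \<noteq> y"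
  shows "(minimal_flow X \<phi> \<and> expansive_flow X \<phi> \<longrightarrow> covering_dim_eq X 1)
       \<and> (minimal_flow X \<phi> \<and> expansive_flow X \<phi> \<longleftrightarrow>
           (\<exists>A \<Sigma> r. minimal_subshift A \<Sigma> \<and> continuous_on \<Sigma> r \<and> (\<forall>y\<in>\<Sigma>. r y > 0) \<and>
                    equiv_to_suspension X \<phi> \<Sigma> r))"
proof -
  interpret compact_flow X \<phi> by unfold_locales (rule assms)+
  obtain x y where xy: "x \<in> X" "y \<in> X" "x \<noteq> y" using assms(3) by blast
  have ne: "X \<noteq> {}" using xy by blast
  have coords: "\<exists>qh. suspension_flow X \<phi> \<Sigma> qh"
    if "minimal_subshift A \<Sigma> \<and> continuous_on \<Sigma> r \<and> (\<forall>y\<in>\<Sigma>. r y > 0) \<and> equiv_to_suspension X \<phi> \<Sigma> r" for A \<Sigma> r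
    using suspension_coordinates[of A \<Sigma> r] that ne by blast
  have fwd: "\<exists>A \<Sigma> r. minimal_subshift A \<Sigma> \<and> continuous_on \<Sigma> r \<and> (\<forall>y\<in>\<Sigma>. r y > 0) \<and> equiv_to_suspension X \<phi> \<Sigma> r"
    if "minimal_flow X \<phi> \<and> expansive_flow X \<phi>"
    using minimal_expansive_is_suspension that assms(3) by blast
  show ?thesis
  proof (intro conjI impI iffI)
    assume me: "minimal_flow X \<phi> \<and> expansive_flow X \<phi>"
    then obtain \<Sigma> qh where S: "suspension_flow X \<phi> \<Sigma> qh" using fwd coords by blast
    have "covering_dim_le X 1" by (rule suspension_flow.covering_dim_le_1[OF S ne])
    moreover have "\<not> covering_dim_le X m" if "m < 1" for m
      using connected_not_covering_dim_0[OF minimal_connected xy] me that by simp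
    ultimately show "covering_dim_eq X 1" by (simp add: covering_dim_eq_def)
  next
    assume "minimal_flow X \<phi> \<and> expansive_flow X \<phi>"
    then show "\<exists>A \<Sigma> r. minimal_subshift A \<Sigma> \<and> continuous_on \<Sigma> r \<and> (\<forall>y\<in>\<Sigma>. r y > 0) \<and> equiv_to_suspension X \<phi> \<Sigma> r"
      by (rule fwd)
  next
    assume "\<exists>A \<Sigma> r. minimal_subshift A \<Sigma> \<and> continuous_on \<Sigma> r \<and> (\<forall>y\<in>\<Sigma>. r y > 0) \<and> equiv_to_suspension X \<phi> \<Sigma> r"
    then obtain \<Sigma> qh where S: "suspension_flow X \<phi> \<Sigma> qh" using coords by blast
    show "minimal_flow X \<phi>" by (rule suspension_flow.minimal[OF S])
    show "expansive_flow X \<phi>" by (rule suspension_flow.expansive[OF S])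
  qed
qed

end
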